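(* Let $N\ge 2$. For every $z\in S(\mathbf{C}^N)^{\#}$ there exists a representation $(\mathcal H,\pi)$ of the Cuntz algebra $\mathcal O_N$ which is $GP(z)$. Such a representation is unique up to unitary equivalence, i.e. any two representations of $\mathcal O_N$ which are both $GP(z)$ are unitarily equivalent.
   Context: $\mathcal O_N$ ($N\ge2$) is the Cuntz algebra: the universal C$^*$-algebra generated by $s_1,\dots,s_N$ with $s_i^*s_j=\delta_{ij}I$ and $\sum_{i=1}^N s_is_i^*=I$. A representation means a unital $*$-representation on a complex Hilbert space. $\mathbf N=\{1,2,3,\dots\}$. Inner products are linear in the second variable. Parameter sets: $S(\mathbf C^N)=\{z\in\mathbf C^N:\|z\|=1\}$; $S(\mathbf C^N)^{\otimes k}=\{z^{(1)}\otimes\cdots\otimes z^{(k)}: z^{(i)}\in S(\mathbf C^N)\}$ for $k\ge1$ (unit elementary tensors); $S(\mathbf C^N)^{\otimes *}=\coprod_{k\ge1}S(\mathbf C^N)^{\otimes k}$; $S(\mathbf C^N)^\infty=\{(z^{(n)})_{n\in\mathbf N}: z^{(n)}\in S(\mathbf C^N)\}$; $S(\mathbf C^N)^{\#}=S(\mathbf C^N)^{\otimes *}\cup S(\mathbf C^N)^\infty$. For $z=(z_1,\dots,z_N)\in\mathbf C^N$ put $s(z)=z_1s_1+\cdots+z_Ns_N$, and for $z=z^{(1)}\otimes\cdots\otimes z^{(k)}$ put $s(z)=s(z^{(1)})\cdots s(z^{(k)})$. Definition. (cycle) For $z=z^{(1)}\otimes\cdots\otimes z^{(k)}\in S(\mathbf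 C^N)^{\otimes k}$, a representation $(\mathcal H,\pi)$ of $\mathcal O_N$ is $GP(z)$ if there is a unit cyclic vector $\Omega\in\mathcal H$ such that $\pi(s(z))\Omega=\Omega$ and $\{\pi(s(z^{(i)})\cdots s(z^{(k)}))\Omega\}_{i=1}^k$ is an orthonormal family. (chain) For $z=(z^{(n)})_{n\in\mathbf N}\in S(\mathbf C^N)^\infty$, $(\mathcal H,\pi)$ is $GP(z)$ if there is a unit cyclic vector $\Omega\in\mathcal H$ such that $\{\pi(s(z^{(n)})^*\cdots s(z^{(1)})^* )\Omega: n\in\mathbf N\}$ is an orthonormal family. *)

theory Defs
  imports "HOL-Analysis.Analysis" "HOL-Library.Poly_Mapping"
begin

section \<open>Complex Hilbert spaces\<close>

class complex_vector = real_vector +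
  fixes scaleC :: "complex \<Rightarrow> 'a \<Rightarrow> 'a"  (infixr "*\<^sub>C" 75)
  assumes scaleC_add_right: "c *\<^sub>C (x + y) = c *\<^sub>C x + c *\<^sub>C y"
    and scaleC_add_left: "(c + d) *\<^sub>C x = c *\<^sub>C x + d *\<^sub>C x"
    and scaleC_scaleC: "c *\<^sub>C (d *\<^sub>C x) = (c * d) *\<^sub>C x"
    and scaleC_of_real: "complex_of_real r *\<^sub>C x = r *\<^sub>R x"

text \<open>The inner product is linear in the second variable. The norm and the topology are those of the
  underlying real inner product space, whose inner product is the real part.\<close>

class chilbert_space = complex_vector + real_inner + complete_space +
  fixes cinner :: "'a \<Rightarrow> 'a \<Rightarrow> complex"
  assumes cinner_commute: "cinner x y = cnj (cinner y x)"
    and cinner_add_right: "cinner x (y + z) = cinner x y + cinner x z"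
    and cinner_scaleC_right: "cinner x (c *\<^sub>C y) = c * cinner x y"
    and Re_cinner: "Re (cinner x y) = inner x y"

text \<open>The Hilbert space of square-summable families indexed by \<^typ>\<open>'i\<close>.\<close>

typedef 'i ell2 = "{f :: 'i \<Rightarrow> complex. (\<lambda>i. (cmod (f i))\<^sup>2) summable_on UNIV}"
  morphisms ell2_coord Abs_ell2
  by (rule exI[of _ "\<lambda>_. 0"]) simp

setup_lifting type_definition_ell2

lemma ell2_coord_summable: "(\<lambda>i. (cmod (ell2_coord x i))\<^sup>2) summable_on UNIV"
  using ell2_coord[of x] by simp

lemma ell2_product_abs_summable:
  assumes "(\<lambda>i. (cmod (f i))\<^sup>2) summable_on UNIV" "(\<lambda>i. (cmod (g i))\<^sup>2) summable_on UNIV"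
  shows "(\<lambda>i. norm (cnj (f i) * g i)) summable_on UNIV"
proof (rule summable_on_comparison_test[OF summable_on_add[OF assms]])
  fix i
  have "2 * (cmod (f i) * cmod (g i)) \<le> (cmod (f i))\<^sup>2 + (cmod (g i))\<^sup>2"
    using sum_squares_bound[of "cmod (f i)" "cmod (g i)"] by simp
  moreover have "0 \<le> cmod (f i) * cmod (g i)" by simp
  ultimately have "cmod (f i) * cmod (g i) \<le> (cmod (f i))\<^sup>2 + (cmod (g i))\<^sup>2" by linarith
  then show "norm (cnj (f i) * g i) \<le> (cmod (f i))\<^sup>2 + (cmod (g i))\<^sup>2"
    by (simp add: norm_mult)
qed auto

lemma ell2_add_summable:
  assumes "(\<lambda>i. (cmod (f i))\<^sup>2) summable_on UNIV" "(\<lambda>i. (cmod (g i))\<^sup>2) summable_on UNIV"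
  shows "(\<lambda>i. (cmod (f i + g i))\<^sup>2) summable_on UNIV"
proof (rule summable_on_comparison_test)
  show "(\<lambda>i. 2 * (cmod (f i))\<^sup>2 + 2 * (cmod (g i))\<^sup>2) summable_on UNIV"
    by (intro summable_on_add summable_on_cmult_right assms)
  fix i
  have "(cmod (f i + g i))\<^sup>2 \<le> (cmod (f i) + cmod (g i))\<^sup>2"
    by (intro power_mono norm_triangle_ineq) simp
  also have "\<dots> \<le> 2 * (cmod (f i))\<^sup>2 + 2 * (cmod (g i))\<^sup>2"
    using sum_squares_bound[of "cmod (f i)" "cmod (g i)"] by (simp add: power2_sum)
  finally show "(cmod (f i + g i))\<^sup>2 \<le> 2 * (cmod (f i))\<^sup>2 + 2 * (cmod (g i))\<^sup>2" .
qed auto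

lemma ell2_scale_summable:
  assumes "(\<lambda>i. (cmod (f i))\<^sup>2) summable_on UNIV"
  shows "(\<lambda>i. (cmod (c * f i))\<^sup>2) summable_on UNIV"
  unfolding norm_mult power_mult_distrib by (intro summable_on_cmult_right assms)

instantiation ell2 :: (type) complex_vector
begin

lift_definition zero_ell2 :: "'a ell2" is "\<lambda>_. 0" by simp
lift_definition plus_ell2 :: "'a ell2 \<Rightarrow> 'a ell2 \<Rightarrow> 'a ell2" is "\<lambda>f g i. f i + g i"
  by (rule ell2_add_summable)
lift_definition uminus_ell2 :: "'a ell2 \<Rightarrow> 'a ell2" is "\<lambda>f i. - f i" by simp
lift_definition minus_ell2 :: "'a ell2 \<Rightarrow> 'a ell2 \<Rightarrow> 'a ell2" is "\<lambda>f g i. f i - g i"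
  subgoal for f g using ell2_add_summable[of f "\<lambda>i. - g i"] by simp
  done
lift_definition scaleC_ell2 :: "complex \<Rightarrow> 'a ell2 \<Rightarrow> 'a ell2" is "\<lambda>c f i. c * f i"
  by (rule ell2_scale_summable)
definition scaleR_ell2 :: "real \<Rightarrow> 'a ell2 \<Rightarrow> 'a ell2" where
  "scaleR_ell2 r x = complex_of_real r *\<^sub>C x"

instance
  by standard (unfold scaleR_ell2_def, (transfer, simp add: fun_eq_iff algebra_simps)+)

end

instantiation ell2 :: (type) real_inner
begin

lift_definition inner_ell2 :: "'a ell2 \<Rightarrow> 'a ell2 \<Rightarrow> real"
  is "\<lambda>f g. Re (\<Sum>\<^sub>\<infinity>i. cnj (f i) * g i)" .
definition norm_ell2 :: "'a ell2 \<Rightarrow> real" where "norm_ell2 x = sqrt (inner x x)"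
definition dist_ell2 :: "'a ell2 \<Rightarrow> 'a ell2 \<Rightarrow> real" where "dist_ell2 x y = norm (x - y)"
definition sgn_ell2 :: "'a ell2 \<Rightarrow> 'a ell2" where "sgn_ell2 x = x /\<^sub>R norm x"
definition uniformity_ell2 :: "('a ell2 \<times> 'a ell2) filter" where
  "uniformity_ell2 = (INF e\<in>{0<..}. principal {(x, y). dist x y < e})"
definition open_ell2 :: "'a ell2 set \<Rightarrow> bool" where
  "open_ell2 U \<longleftrightarrow> (\<forall>x\<in>U. eventually (\<lambda>(x', y). x' = x \<longrightarrow> y \<in> U) uniformity)"

lemma inner_ell2_self: "inner x x = (\<Sum>\<^sub>\<infinity>i. (cmod (ell2_coord x i))\<^sup>2)"
proof -
  have "(\<lambda>i. cnj (ell2_coord x i) * ell2_coord x i) summable_on UNIV"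
    by (rule abs_summable_summable)
      (rule ell2_product_abs_summable[OF ell2_coord_summable ell2_coord_summable])
  moreover have "(cmod c)\<^sup>2 = Re (cnj c * c)" for c
    unfolding cmod_power2 by (simp add: power2_eq_square)
  ultimately show ?thesis
    by (simp only: inner_ell2.rep_eq infsum_Re)
qed

instance
proof
  fix x y z :: "'a ell2" and r :: real
  let ?f = "ell2_coord x" and ?g = "ell2_coord y" and ?h = "ell2_coord z"
  have S: "(\<lambda>i. cnj (ell2_coord u i) * ell2_coord v i) summable_on UNIV" for u v :: "'a ell2"
    by (rule abs_summable_summable)
      (rule ell2_product_abs_summable[OF ell2_coord_summable ell2_coord_summable])
  show "dist x y = norm (x - y)" by (rule dist_ell2_def)
  show "sgn x = x /\<^sub>R norm x" by (rule sgn_ell2_def)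
  show "(uniformity :: ('a ell2 \<times> 'a ell2) filter)
    = (INF e\<in>{0<..}. principal {(x, y). dist x y < e})" by (rule uniformity_ell2_def)
  show "open U \<longleftrightarrow> (\<forall>x\<in>U. eventually (\<lambda>(x', y). x' = x \<longrightarrow> y \<in> U) uniformity)" for U :: "'a ell2 set"
    by (rule open_ell2_def)
  show "inner x y = inner y x"
  proof -
    have "(\<Sum>\<^sub>\<infinity>i. cnj (?f i) * ?g i) = cnj (\<Sum>\<^sub>\<infinity>i. cnj (?g i) * ?f i)"
      unfolding infsum_cnj[symmetric] by (simp add: mult.commute)
    then show ?thesis by (simp add: inner_ell2.rep_eq)
  qed
  show "inner (x + y) z = inner x z + inner y z"
    by (simp add: inner_ell2.rep_eq plus_ell2.rep_eq distrib_right infsum_add[OF S S])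
  show "inner (r *\<^sub>R x) y = r * inner x y"
    by (simp add: inner_ell2.rep_eq scaleR_ell2_def scaleC_ell2.rep_eq mult.assoc infsum_cmult_right[OF S])
  show "0 \<le> inner x x" by (simp add: inner_ell2_self infsum_nonneg)
  show "inner x x = 0 \<longleftrightarrow> x = 0"
  proof
    assume "inner x x = 0"
    then have "(cmod (?f i))\<^sup>2 = 0" for i
      using nonneg_infsum_le_0D[of "\<lambda>i. (cmod (?f i))\<^sup>2" UNIV i] ell2_coord_summable[of x]
      by (simp add: inner_ell2_self)
    then show "x = 0" by (simp add: ell2_coord_inject[symmetric] zero_ell2.rep_eq fun_eq_iff)
  qed (simp add: inner_ell2_self zero_ell2.rep_eq)
  show "norm x = sqrt (inner x x)" by (rule norm_ell2_def)
qed

end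

lemma norm_ell2_sq: "(norm x)\<^sup>2 = (\<Sum>\<^sub>\<infinity>i. (cmod (ell2_coord x i))\<^sup>2)"
  by (simp add: norm_eq_sqrt_inner inner_ell2_self infsum_nonneg)

lemma ell2_finite_sum_le:
  "finite F \<Longrightarrow> (\<Sum>i\<in>F. (cmod (ell2_coord x i))\<^sup>2) \<le> (norm x)\<^sup>2"
  unfolding norm_ell2_sq by (rule finite_sum_le_infsum[OF ell2_coord_summable]) auto

lemma ell2_norm_leI:
  assumes "0 \<le> e" "\<And>F. finite F \<Longrightarrow> (\<Sum>i\<in>F. (cmod (ell2_coord x i))\<^sup>2) \<le> e\<^sup>2"
  shows "norm x \<le> e"
proof -
  have "(norm x)\<^sup>2 \<le> e\<^sup>2"
    unfolding norm_ell2_sq by (rule infsum_le_finite_sums[OF ell2_coord_summable]) (use assms in auto)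
  then show ?thesis using assms(1) power2_le_imp_le by blast
qed

instance ell2 :: (type) complete_space
proof
  fix X :: "nat \<Rightarrow> 'a ell2" assume X: "Cauchy X"
  have coord_diff: "ell2_coord (x - y) i = ell2_coord x i - ell2_coord y i" for x y :: "'a ell2" and i
    by (simp add: minus_ell2.rep_eq)
  have le: "cmod (ell2_coord x i) \<le> norm x" for x :: "'a ell2" and i
    using ell2_finite_sum_le[of "{i}" x] by (auto intro: power2_le_imp_le)
  have "Cauchy (\<lambda>n. ell2_coord (X n) i)" for i
  proof (rule CauchyI)
    fix e :: real assume "0 < e"
    then obtain M where "\<forall>m\<ge>M. \<forall>n\<ge>M. norm (X m - X n) < e" using CauchyD[OF X] by blast
    then show "\<exists>M. \<forall>m\<ge>M. \<forall>n\<ge>M. norm (ell2_coord (X m) i - ell2_coord (X n) i) < e"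
      using le[of "X _ - X _" i] unfolding coord_diff by (meson le_less_trans)
  qed
  then have "\<forall>i. \<exists>l. (\<lambda>n. ell2_coord (X n) i) \<longlonglongrightarrow> l"
    using Cauchy_convergent convergent_def by blast
  then obtain L where L: "\<And>i. (\<lambda>n. ell2_coord (X n) i) \<longlonglongrightarrow> L i" by metis
  have key: "(\<Sum>i\<in>F. (cmod (L i - ell2_coord (X n) i))\<^sup>2) \<le> e\<^sup>2"
    if e: "0 < e" and M: "\<forall>m\<ge>M. \<forall>n\<ge>M. norm (X m - X n) < e" and n: "n \<ge> M" and F: "finite F" for e M n F
  proof (rule LIMSEQ_le_const2)
    show "(\<lambda>m. \<Sum>i\<in>F. (cmod (ell2_coord (X m) i - ell2_coord (X n) i))\<^sup>2)
      \<longlonglongrightarrow> (\<Sum>i\<in>F. (cmod (L i - ell2_coord (X n) i))\<^sup>2)"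
      by (intro tendsto_sum tendsto_power tendsto_norm tendsto_diff L tendsto_const)
    show "\<exists>N. \<forall>m\<ge>N. (\<Sum>i\<in>F. (cmod (ell2_coord (X m) i - ell2_coord (X n) i))\<^sup>2) \<le> e\<^sup>2"
    proof (intro exI[of _ M] allI impI)
      fix m assume "m \<ge> M"
      have "(\<Sum>i\<in>F. (cmod (ell2_coord (X m - X n) i))\<^sup>2) \<le> (norm (X m - X n))\<^sup>2"
        by (rule ell2_finite_sum_le[OF F])
      also have "\<dots> \<le> e\<^sup>2" using M \<open>m \<ge> M\<close> n by (intro power_mono) (auto intro: less_imp_le)
      finally show "(\<Sum>i\<in>F. (cmod (ell2_coord (X m) i - ell2_coord (X n) i))\<^sup>2) \<le> e\<^sup>2"
        by (simp add: coord_diff)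
    qed
  qed
  obtain M1 where M1: "\<forall>m\<ge>M1. \<forall>n\<ge>M1. norm (X m - X n) < 1" using CauchyD[OF X, of 1] by auto
  have "(\<lambda>i. (cmod (L i - ell2_coord (X M1) i))\<^sup>2) summable_on UNIV"
  proof (rule nonneg_bdd_above_summable_on)
    show "bdd_above (sum (\<lambda>i. (cmod (L i - ell2_coord (X M1) i))\<^sup>2) ` {F. F \<subseteq> UNIV \<and> finite F})"
      using key[OF _ M1, of M1] by (intro bdd_aboveI2[where M = "1\<^sup>2"]) auto
  qed auto
  from ell2_add_summable[OF this ell2_coord_summable[of "X M1"]]
  have "(\<lambda>i. (cmod (L i))\<^sup>2) summable_on UNIV" by simp
  then have aL: "ell2_coord (Abs_ell2 L) = L" by (simp add: Abs_ell2_inverse)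
  have "X \<longlonglongrightarrow> Abs_ell2 L"
  proof (rule LIMSEQ_I)
    fix r :: real assume r: "0 < r"
    then obtain M where M: "\<forall>m\<ge>M. \<forall>n\<ge>M. norm (X m - X n) < r / 2"
      using CauchyD[OF X, of "r / 2"] by auto
    have "norm (X n - Abs_ell2 L) < r" if "n \<ge> M" for n
    proof -
      have "norm (Abs_ell2 L - X n) \<le> r / 2"
        by (rule ell2_norm_leI) (use r key[OF _ M that] in \<open>auto simp: coord_diff aL\<close>)
      then show ?thesis using r by (simp add: norm_minus_commute)
    qed
    then show "\<exists>no. \<forall>n\<ge>no. norm (X n - Abs_ell2 L) < r" by blast
  qed
  then show "convergent X" by (rule convergentI)
qed

instantiation ell2 :: (type) chilbert_space
begin

lift_definition cinner_ell2 :: "'a ell2 \<Rightarrow> 'a ell2 \<Rightarrow> complex"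
  is "\<lambda>f g. \<Sum>\<^sub>\<infinity>i. cnj (f i) * g i" .

instance
proof
  fix x y z :: "'a ell2" and c :: complex
  let ?f = "ell2_coord x" and ?g = "ell2_coord y" and ?h = "ell2_coord z"
  have S: "(\<lambda>i. cnj (ell2_coord u i) * ell2_coord v i) summable_on UNIV" for u v :: "'a ell2"
    by (rule abs_summable_summable)
      (rule ell2_product_abs_summable[OF ell2_coord_summable ell2_coord_summable])
  show "cinner x y = cnj (cinner y x)"
    unfolding cinner_ell2.rep_eq infsum_cnj[symmetric] by (simp add: mult.commute)
  show "cinner x (y + z) = cinner x y + cinner x z"
    by (simp add: cinner_ell2.rep_eq plus_ell2.rep_eq distrib_left infsum_add[OF S S])
  show "cinner x (c *\<^sub>C y) = c * cinner x y"
    by (simp add: cinner_ell2.rep_eq scaleC_ell2.rep_eq mult.left_commute infsum_cmult_right[OF S])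
  show "Re (cinner x y) = inner x y"
    by (simp add: cinner_ell2.rep_eq inner_ell2.rep_eq)
qed

end

section \<open>Unital C*-algebras\<close>

text \<open>The zero algebra is admitted: \<open>0 \<noteq> 1\<close> is not an axiom.\<close>

class unital_cstar_algebra = complex_vector + banach + real_normed_algebra + monoid_mult +
  fixes star :: "'a \<Rightarrow> 'a"
  assumes mult_scaleC_left: "(c *\<^sub>C a) * b = c *\<^sub>C (a * b)"
    and mult_scaleC_right: "a * (c *\<^sub>C b) = c *\<^sub>C (a * b)"
    and norm_scaleC: "norm (c *\<^sub>C a) = cmod c * norm a"
    and star_add: "star (a + b) = star a + star b"
    and star_scaleC: "star (c *\<^sub>C a) = cnj c *\<^sub>C star a"
    and star_mult: "star (a * b) = star b * star a"
    and star_star: "star (star a) = a"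
    and cstar_identity: "norm (star a * a) = (norm a)\<^sup>2"

section \<open>The free unital *-algebra\<close>

text \<open>Noncommutative *-polynomials in the variables \<^typ>\<open>'n\<close>, that is the monoid algebra over the
  complex numbers of the free monoid on the letters \<open>Gen i\<close> and \<open>Adj i\<close>. The addition on words is
  concatenation, because \<open>poly_mapping\<close> writes the monoid of exponents additively.\<close>

datatype 'n letter = Gen 'n | Adj 'n

datatype 'n word = Word (letters: "'n letter list")

instantiation word :: (type) monoid_add
begin
definition zero_word :: "'a word" where "0 = Word []"
definition plus_word :: "'a word \<Rightarrow> 'a word \<Rightarrow> 'a word" where
  "v + w = Word (letters v @ letters w)"
instance
  by standard (simp_all add: zero_word_def plus_word_def)
end

type_synonym 'n star_poly = "'n word \<Rightarrow>\<^sub>0 complex"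

fun adj_letter :: "'n letter \<Rightarrow> 'n letter" where
  "adj_letter (Gen i) = Adj i"
| "adj_letter (Adj i) = Gen i"

definition adj_word :: "'n word \<Rightarrow> 'n word" where
  "adj_word w = Word (rev (map adj_letter (letters w)))"

lemma adj_letter_adj_letter [simp]: "adj_letter (adj_letter l) = l"
  by (cases l) simp_all

lemma adj_word_adj_word [simp]: "adj_word (adj_word w) = w"
  by (simp add: adj_word_def rev_map o_def)

lift_definition poly_adj :: "'n star_poly \<Rightarrow> 'n star_poly" is "\<lambda>p w. cnj (p (adj_word w))"
proof -
  fix p :: "'n word \<Rightarrow> complex" assume "finite {w. p w \<noteq> 0}"
  moreover have "{w. cnj (p (adj_word w)) \<noteq> 0} = adj_word ` {w. p w \<noteq> 0}"
    by (auto simp: image_iff) (metis adj_word_adj_word)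
  ultimately show "finite {w. cnj (p (adj_word w)) \<noteq> 0}" by simp
qed

definition poly_scale :: "complex \<Rightarrow> 'n star_poly \<Rightarrow> 'n star_poly" where
  "poly_scale c p = Poly_Mapping.single 0 c * p"

definition poly_gen :: "'n \<Rightarrow> 'n star_poly" where
  "poly_gen i = Poly_Mapping.single (Word [Gen i]) 1"

lemma star_poly_induct [case_names zero add]:
  fixes p :: "'n star_poly"
  assumes "P 0" "\<And>p w c. P p \<Longrightarrow> P (p + Poly_Mapping.single w c)"
  shows "P p"
proof (induction p rule: update_induct)
  case (update p w c)
  have "Poly_Mapping.update w c p = p + Poly_Mapping.single w c"
    using update(1)
    by (intro poly_mapping_eqI)
      (auto simp: lookup_update lookup_add lookup_single in_keys_iff when_def)
  then show ?case using assms(2) update by simp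
qed (use assms in simp)

lemma poly_adj_add: "poly_adj (p + q) = poly_adj p + poly_adj q"
  by (rule poly_mapping_eqI) (simp add: poly_adj.rep_eq lookup_add)

lemma poly_adj_zero [simp]: "poly_adj 0 = 0"
  by (rule poly_mapping_eqI) (simp add: poly_adj.rep_eq)

lemma poly_adj_minus: "poly_adj (- p) = - poly_adj p"
  by (rule poly_mapping_eqI) (simp add: poly_adj.rep_eq lookup_minus)

lemma poly_adj_diff: "poly_adj (p - q) = poly_adj p - poly_adj q"
  by (rule poly_mapping_eqI) (simp add: poly_adj.rep_eq lookup_minus)

lemma poly_adj_single: "poly_adj (Poly_Mapping.single w c) = Poly_Mapping.single (adj_word w) (cnj c)"
  by (rule poly_mapping_eqI)
    (auto simp: poly_adj.rep_eq lookup_single when_def)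

lemma adj_word_add: "adj_word (v + w) = adj_word w + adj_word v"
  by (simp add: adj_word_def plus_word_def)

lemma adj_word_zero [simp]: "adj_word 0 = 0"
  by (simp add: adj_word_def zero_word_def)

lemma poly_adj_mult: "poly_adj (p * q) = poly_adj q * poly_adj p"
proof (induction p rule: star_poly_induct)
  case (add p v c)
  have "poly_adj (Poly_Mapping.single v c * q) = poly_adj q * poly_adj (Poly_Mapping.single v c)"
  proof (induction q rule: star_poly_induct)
    case (add q w d)
    then show ?case
      by (simp add: distrib_left distrib_right poly_adj_add mult_single poly_adj_single adj_word_add
          mult.commute)
  qed simp
  with add show ?case by (simp add: distrib_left distrib_right poly_adj_add)
qed simp

lemma poly_adj_poly_adj [simp]: "poly_adj (poly_adj p) = p"
  by (rule poly_mapping_eqI) (simp add: poly_adj.rep_eq)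

lemma poly_adj_one [simp]: "poly_adj 1 = 1"
  using poly_adj_single[of 0 1] by simp

lemma poly_const_commute: "p * Poly_Mapping.single 0 c = Poly_Mapping.single 0 c * (p :: 'n star_poly)"
proof (induction p rule: star_poly_induct)
  case (add p w d)
  then show ?case by (simp add: distrib_left distrib_right mult_single mult.commute)
qed simp

lemma poly_scale_add_right: "poly_scale c (p + q) = poly_scale c p + poly_scale c q"
  and poly_scale_diff_right: "poly_scale c (p - q) = poly_scale c p - poly_scale c q"
  and poly_scale_add_left: "poly_scale (c + d) p = poly_scale c p + poly_scale d p"
  and poly_scale_scale: "poly_scale c (poly_scale d p) = poly_scale (c * d) p"
  and poly_scale_one: "poly_scale 1 p = p"
  and poly_scale_zero_left: "poly_scale 0 p = 0"
  and poly_scale_minus_one: "poly_scale (- 1) p = - p"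
  and poly_scale_mult_left: "poly_scale c p * q = poly_scale c (p * q)"
  by (simp_all add: poly_scale_def distrib_left distrib_right right_diff_distrib single_add
      mult.assoc[symmetric] mult_single single_uminus)

lemma poly_adj_scale: "poly_adj (poly_scale c p) = poly_scale (cnj c) (poly_adj p)"
  by (simp add: poly_scale_def poly_adj_mult poly_adj_single poly_const_commute[of "poly_adj p"])

lemma poly_scale_mult_right: "p * poly_scale c q = poly_scale c (p * q)"
  unfolding poly_scale_def by (metis mult.assoc poly_const_commute)

section \<open>The Cuntz algebra\<close>

text \<open>A C*-seminorm on the free unital *-algebra that vanishes on the Cuntz relations
  \<open>s\<^sub>i\<^sup>* s\<^sub>j = \<delta>\<^sub>i\<^sub>j 1\<close> and \<open>\<Sum>\<^sub>i s\<^sub>i s\<^sub>i\<^sup>* = 1\<close>.\<close>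

definition cuntz_seminorm :: "('n::finite star_poly \<Rightarrow> real) \<Rightarrow> bool" where
  "cuntz_seminorm r \<longleftrightarrow>
     (\<forall>p q. r (p + q) \<le> r p + r q) \<and>
     (\<forall>c p. r (poly_scale c p) = cmod c * r p) \<and>
     (\<forall>p q. r (p * q) \<le> r p * r q) \<and>
     (\<forall>p. r (poly_adj p * p) = (r p)\<^sup>2) \<and>
     (\<forall>i j. r (poly_adj (poly_gen i) * poly_gen j - (if i = j then 1 else 0)) = 0) \<and>
     r ((\<Sum>i\<in>UNIV. poly_gen i * poly_adj (poly_gen i)) - 1) = 0"

text \<open>The largest such seminorm (the supremum is finite by \<open>cuntz_seminorm_bounded\<close> below). The universal
  C*-algebra of the Cuntz relations is the completion of the free *-algebra modulo its null ideal.\<close>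

definition cuntz_norm :: "'n::finite star_poly \<Rightarrow> real" where
  "cuntz_norm p = (SUP r\<in>Collect cuntz_seminorm. r p)"

context
  fixes r :: "'n::finite star_poly \<Rightarrow> real"
  assumes r: "cuntz_seminorm r"
begin

lemma cuntz_seminormD:
  shows "r (p + q) \<le> r p + r q"
    and "r (poly_scale c p) = cmod c * r p"
    and "r (p * q) \<le> r p * r q"
    and "r (poly_adj p * p) = (r p)\<^sup>2"
    and "r (poly_adj (poly_gen i) * poly_gen j - (if i = j then 1 else 0)) = 0"
    and "r ((\<Sum>i\<in>UNIV. poly_gen i * poly_adj (poly_gen i)) - 1) = 0"
  using r unfolding cuntz_seminorm_def by blast+

lemma cuntz_seminorm_zero: "r 0 = 0"
  using cuntz_seminormD(2)[of 0 0] by (simp add: poly_scale_zero_left)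

lemma cuntz_seminorm_minus: "r (- p) = r p"
  using cuntz_seminormD(2)[of "-1" p] by (simp add: poly_scale_minus_one)

lemma cuntz_seminorm_nonneg: "0 \<le> r p"
  using cuntz_seminormD(1)[of p "- p"] by (simp add: cuntz_seminorm_zero cuntz_seminorm_minus)

lemma cuntz_seminorm_diff_le: "r (p - q) \<le> r p + r q"
  using cuntz_seminormD(1)[of p "- q"] by (simp add: cuntz_seminorm_minus)

lemma cuntz_seminorm_commute: "r (p - q) = r (q - p)"
  using cuntz_seminorm_minus[of "p - q"] by simp

lemma cuntz_seminorm_abs_diff: "\<bar>r p - r q\<bar> \<le> r (p - q)"
  using cuntz_seminormD(1)[of q "p - q"] cuntz_seminormD(1)[of p "q - p"] cuntz_seminorm_commute[of p q]
  by simp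

lemma cuntz_seminorm_adj: "r (poly_adj p) = r p"
proof -
  have le: "r p \<le> r (poly_adj p)" for p
  proof (cases "r p = 0")
    case False
    with cuntz_seminorm_nonneg[of p] have "0 < r p" by simp
    moreover have "r p * r p \<le> r (poly_adj p) * r p"
      using cuntz_seminormD(3)[of "poly_adj p" p] cuntz_seminormD(4)[of p] by (simp add: power2_eq_square)
    ultimately show ?thesis by simp
  qed (simp add: cuntz_seminorm_nonneg)
  from le[of p] le[of "poly_adj p"] show ?thesis by simp
qed

lemma cuntz_seminorm_one_le: "r 1 \<le> 1"
proof -
  have "r 1 = r 1 * r 1" using cuntz_seminormD(4)[of 1] by (simp add: power2_eq_square)
  then show ?thesis by (metis dual_order.refl mult_cancel_right1 zero_le_one)
qed

lemma cuntz_seminorm_gen_le: "r (poly_gen i) \<le> 1"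
proof -
  have "(r (poly_gen i))\<^sup>2 = r ((poly_adj (poly_gen i) * poly_gen i - 1) + 1)"
    by (simp add: cuntz_seminormD(4))
  also have "\<dots> \<le> r (poly_adj (poly_gen i) * poly_gen i - 1) + r 1"
    by (rule cuntz_seminormD(1))
  also have "\<dots> \<le> 1"
    using cuntz_seminormD(5)[of i i] cuntz_seminorm_one_le by simp
  finally have "(r (poly_gen i))\<^sup>2 \<le> 1\<^sup>2" by simp
  then show ?thesis using power2_le_imp_le zero_le_one by blast
qed

lemma cuntz_seminorm_letter_le: "r (Poly_Mapping.single (Word [l]) 1) \<le> 1"
proof (cases l)
  case (Gen i)
  then show ?thesis using cuntz_seminorm_gen_le[of i] by (simp add: poly_gen_def)
next
  case (Adj i)
  have "poly_adj (poly_gen i) = Poly_Mapping.single (Word [Adj i]) 1"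
    by (simp add: poly_gen_def poly_adj_single adj_word_def)
  then show ?thesis using cuntz_seminorm_gen_le[of i] cuntz_seminorm_adj[of "poly_gen i"] Adj by simp
qed

lemma cuntz_seminorm_word_le: "r (Poly_Mapping.single (Word ls) 1) \<le> 1"
proof (induction ls)
  case Nil
  show ?case using cuntz_seminorm_one_le by (simp flip: zero_word_def)
next
  case (Cons l ls)
  have eq: "Poly_Mapping.single (Word (l # ls)) 1
    = (Poly_Mapping.single (Word [l]) 1 * Poly_Mapping.single (Word ls) 1 :: 'n star_poly)"
    by (simp add: mult_single plus_word_def)
  have "r (Poly_Mapping.single (Word (l # ls)) 1)
      \<le> r (Poly_Mapping.single (Word [l]) 1) * r (Poly_Mapping.single (Word ls) 1)"
    unfolding eq by (rule cuntz_seminormD(3))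
  also have "\<dots> \<le> 1 * 1"
    by (intro mult_mono cuntz_seminorm_letter_le Cons cuntz_seminorm_nonneg) simp
  finally show ?case by simp
qed

lemma cuntz_seminorm_single_le: "r (Poly_Mapping.single w c) \<le> cmod c"
proof -
  have "Poly_Mapping.single w c = poly_scale c (Poly_Mapping.single (Word (letters w)) 1)"
    by (simp add: poly_scale_def mult_single)
  then show ?thesis
    using cuntz_seminorm_word_le[of "letters w"] cuntz_seminormD(2)[of c "Poly_Mapping.single w 1"]
    by (simp add: mult_left_le)
qed

end

lemma cuntz_seminorm_bounded: "\<exists>B. \<forall>r. cuntz_seminorm r \<longrightarrow> r p \<le> B"
proof (induction p rule: star_poly_induct)
  case zero
  then show ?case by (auto simp: cuntz_seminorm_zero)
next
  case (add p w c)
  then obtain B where B: "\<And>r. cuntz_seminorm r \<Longrightarrow> r p \<le> B" by blast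
  have "r (p + Poly_Mapping.single w c) \<le> B + cmod c" if "cuntz_seminorm r" for r
    using cuntz_seminormD(1)[OF that, of p "Poly_Mapping.single w c"] B[OF that]
      cuntz_seminorm_single_le[OF that, of w c] by linarith
  then show ?case by blast
qed

lemma cuntz_seminorm_trivial: "cuntz_seminorm (\<lambda>_. 0)"
  by (simp add: cuntz_seminorm_def)

lemma cuntz_norm_upper: "cuntz_seminorm r \<Longrightarrow> r p \<le> cuntz_norm p"
  unfolding cuntz_norm_def using cuntz_seminorm_bounded[of p]
  by (intro cSUP_upper) (auto simp: bdd_above_def)

lemma cuntz_norm_least: "(\<And>r. cuntz_seminorm r \<Longrightarrow> r p \<le> B) \<Longrightarrow> cuntz_norm p \<le> B"
  unfolding cuntz_norm_def using cuntz_seminorm_trivial by (intro cSUP_least) auto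

lemma cuntz_norm_ge0: "0 \<le> cuntz_norm p"
  by (rule cuntz_norm_upper[OF cuntz_seminorm_trivial])

lemma cuntz_seminorm_cuntz_norm: "cuntz_seminorm cuntz_norm"
  unfolding cuntz_seminorm_def
proof (intro conjI allI)
  fix p q :: "'a star_poly" and c :: complex and i j :: 'a
  show "cuntz_norm (p + q) \<le> cuntz_norm p + cuntz_norm q"
  proof (rule cuntz_norm_least)
    fix r :: "'a star_poly \<Rightarrow> real" assume r: "cuntz_seminorm r"
    show "r (p + q) \<le> cuntz_norm p + cuntz_norm q"
      using cuntz_seminormD(1)[OF r, of p q] cuntz_norm_upper[OF r, of p] cuntz_norm_upper[OF r, of q]
      by linarith
  qed
  have scale_le: "cuntz_norm (poly_scale c p) \<le> cmod c * cuntz_norm p" for c and p :: "'a star_poly"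
    by (rule cuntz_norm_least) (simp add: cuntz_seminormD(2) cuntz_norm_upper mult_left_mono)
  show "cuntz_norm (poly_scale c p) = cmod c * cuntz_norm p"
  proof (cases "c = 0")
    case True
    then show ?thesis using scale_le[of c p] cuntz_norm_ge0[of "poly_scale c p"] by simp
  next
    case False
    then have "cuntz_norm p \<le> cmod (inverse c) * cuntz_norm (poly_scale c p)"
      using scale_le[of "inverse c" "poly_scale c p"] by (simp add: poly_scale_scale poly_scale_one)
    then show ?thesis using scale_le[of c p] False
      by (simp add: norm_inverse norm_divide field_simps)
  qed
  show "cuntz_norm (p * q) \<le> cuntz_norm p * cuntz_norm q"
  proof (rule cuntz_norm_least)
    fix r :: "'a star_poly \<Rightarrow> real" assume r: "cuntz_seminorm r"
    have "r (p * q) \<le> r p * r q" by (rule cuntz_seminormD(3)[OF r])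
    also have "\<dots> \<le> cuntz_norm p * cuntz_norm q"
      by (intro mult_mono cuntz_norm_upper r cuntz_norm_ge0 cuntz_seminorm_nonneg[OF r])
    finally show "r (p * q) \<le> cuntz_norm p * cuntz_norm q" .
  qed
  show "cuntz_norm (poly_adj p * p) = (cuntz_norm p)\<^sup>2"
  proof (rule antisym)
    show "cuntz_norm (poly_adj p * p) \<le> (cuntz_norm p)\<^sup>2"
      by (rule cuntz_norm_least)
        (simp add: cuntz_seminormD(4) cuntz_norm_upper power_mono cuntz_seminorm_nonneg)
    have "cuntz_norm p \<le> sqrt (cuntz_norm (poly_adj p * p))"
    proof (rule cuntz_norm_least)
      fix r :: "'a star_poly \<Rightarrow> real" assume r: "cuntz_seminorm r"
      show "r p \<le> sqrt (cuntz_norm (poly_adj p * p))"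
        using cuntz_norm_upper[OF r, of "poly_adj p * p"] cuntz_seminormD(4)[OF r, of p]
        by (simp add: real_le_rsqrt)
    qed
    then have "(cuntz_norm p)\<^sup>2 \<le> (sqrt (cuntz_norm (poly_adj p * p)))\<^sup>2"
      by (intro power_mono cuntz_norm_ge0)
    then show "(cuntz_norm p)\<^sup>2 \<le> cuntz_norm (poly_adj p * p)"
      by (simp add: cuntz_norm_ge0)
  qed
  have zero: "cuntz_norm p = 0" if "\<And>r. cuntz_seminorm r \<Longrightarrow> r p = 0" for p :: "'a star_poly"
    by (rule antisym[OF cuntz_norm_least cuntz_norm_ge0]) (simp add: that)
  show "cuntz_norm (poly_adj (poly_gen i) * poly_gen j - (if i = j then 1 else 0)) = 0"
    by (rule zero) (rule cuntz_seminormD)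
  show "cuntz_norm ((\<Sum>i\<in>UNIV. poly_gen i * poly_adj (poly_gen i)) - (1 :: 'a star_poly)) = 0"
    by (rule zero) (rule cuntz_seminormD)
qed

lemmas cuntz_norm_add = cuntz_seminormD(1)[OF cuntz_seminorm_cuntz_norm]
  and cuntz_norm_scale = cuntz_seminormD(2)[OF cuntz_seminorm_cuntz_norm]
  and cuntz_norm_mult = cuntz_seminormD(3)[OF cuntz_seminorm_cuntz_norm]
  and cuntz_norm_cstar = cuntz_seminormD(4)[OF cuntz_seminorm_cuntz_norm]
  and cuntz_norm_isometry = cuntz_seminormD(5)[OF cuntz_seminorm_cuntz_norm]
  and cuntz_norm_range = cuntz_seminormD(6)[OF cuntz_seminorm_cuntz_norm]
  and cuntz_norm_zero [simp] = cuntz_seminorm_zero[OF cuntz_seminorm_cuntz_norm]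
  and cuntz_norm_minus [simp] = cuntz_seminorm_minus[OF cuntz_seminorm_cuntz_norm]
  and cuntz_norm_commute = cuntz_seminorm_commute[OF cuntz_seminorm_cuntz_norm]
  and cuntz_norm_abs_diff = cuntz_seminorm_abs_diff[OF cuntz_seminorm_cuntz_norm]
  and cuntz_norm_adj [simp] = cuntz_seminorm_adj[OF cuntz_seminorm_cuntz_norm]

definition cuntz_Cauchy :: "(nat \<Rightarrow> 'n::finite star_poly) \<Rightarrow> bool" where
  "cuntz_Cauchy X \<longleftrightarrow> (\<forall>e>0. \<exists>M. \<forall>m\<ge>M. \<forall>n\<ge>M. cuntz_norm (X m - X n) < e)"

definition cuntz_rel :: "(nat \<Rightarrow> 'n::finite star_poly) \<Rightarrow> (nat \<Rightarrow> 'n star_poly) \<Rightarrow> bool" where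
  "cuntz_rel X Y \<longleftrightarrow> cuntz_Cauchy X \<and> cuntz_Cauchy Y \<and> (\<lambda>n. cuntz_norm (X n - Y n)) \<longlonglongrightarrow> 0"

lemma cuntz_Cauchy_const: "cuntz_Cauchy (\<lambda>_. p)"
  by (simp add: cuntz_Cauchy_def)

lemma cuntz_Cauchy_filter:
  "cuntz_Cauchy X \<longleftrightarrow>
   ((\<lambda>mn. cuntz_norm (X (fst mn) - X (snd mn))) \<longlongrightarrow> 0) (sequentially \<times>\<^sub>F sequentially)"
  unfolding cuntz_Cauchy_def tendsto_iff eventually_prod_sequentially dist_real_def
  by (auto simp add: cuntz_norm_ge0) blast+

lemma cuntz_Cauchy_comparison:
  assumes "((\<lambda>mn. g (fst mn) (snd mn)) \<longlongrightarrow> 0) (sequentially \<times>\<^sub>F sequentially)"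
    and "\<And>m n. cuntz_norm (X m - X n) \<le> g m n"
  shows "cuntz_Cauchy X"
  unfolding cuntz_Cauchy_filter
  by (rule Lim_null_comparison[OF _ assms(1)]) (simp add: cuntz_norm_ge0 assms(2))

lemma cuntz_rel_comparison:
  assumes "cuntz_Cauchy X" "cuntz_Cauchy Y" "g \<longlonglongrightarrow> 0" "\<And>n. cuntz_norm (X n - Y n) \<le> g n"
  shows "cuntz_rel X Y"
  unfolding cuntz_rel_def using assms(1,2)
  by (auto intro!: Lim_null_comparison[OF _ assms(3)] simp: cuntz_norm_ge0 assms(4))

lemma cuntz_rel_refl: "cuntz_Cauchy X \<Longrightarrow> cuntz_rel X X"
  by (simp add: cuntz_rel_def)

lemma cuntz_norm_convergent: "cuntz_Cauchy X \<Longrightarrow> convergent (\<lambda>n. cuntz_norm (X n))"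
proof (rule Cauchy_convergent, rule CauchyI)
  fix e :: real assume "cuntz_Cauchy X" "0 < e"
  then obtain M where "\<forall>m\<ge>M. \<forall>n\<ge>M. cuntz_norm (X m - X n) < e"
    unfolding cuntz_Cauchy_def by blast
  then show "\<exists>M. \<forall>m\<ge>M. \<forall>n\<ge>M. norm (cuntz_norm (X m) - cuntz_norm (X n)) < e"
    by (metis cuntz_norm_abs_diff le_less_trans real_norm_def)
qed

lemma cuntz_Cauchy_bounded:
  assumes "cuntz_Cauchy X" obtains B where "0 \<le> B" "\<And>n. cuntz_norm (X n) \<le> B"
proof -
  obtain B where "0 < B" "\<And>n. norm (cuntz_norm (X n)) \<le> B"
    using convergent_imp_Bseq[OF cuntz_norm_convergent[OF assms]] by (metis BseqE)
  then show ?thesis by (intro that[of B]) (auto simp: cuntz_norm_ge0)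
qed

text \<open>The Hausdorff completion of the free *-algebra: Cauchy sequences modulo null sequences. The number
  of generators is \<open>CARD('n)\<close>.\<close>

quotient_type 'n cuntz = "nat \<Rightarrow> 'n::finite star_poly" / partial: cuntz_rel
proof (rule part_equivpI)
  show "\<exists>X. cuntz_rel X X" using cuntz_rel_refl cuntz_Cauchy_const by blast
  show "symp cuntz_rel"
    by (rule sympI) (simp add: cuntz_rel_def cuntz_norm_commute)
  show "transp (cuntz_rel :: (nat \<Rightarrow> 'n star_poly) \<Rightarrow> _)"
  proof (rule transpI)
    fix X Y Z :: "nat \<Rightarrow> 'n star_poly" assume R: "cuntz_rel X Y" "cuntz_rel Y Z"
    show "cuntz_rel X Z"
    proof (rule cuntz_rel_comparison[where g = "\<lambda>n. cuntz_norm (X n - Y n) + cuntz_norm (Y n - Z n)"])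
      show "(\<lambda>n. cuntz_norm (X n - Y n) + cuntz_norm (Y n - Z n)) \<longlonglongrightarrow> 0"
        using R by (intro tendsto_add_zero) (auto simp: cuntz_rel_def)
      show "cuntz_norm (X n - Z n) \<le> cuntz_norm (X n - Y n) + cuntz_norm (Y n - Z n)" for n
        using cuntz_norm_add[of "X n - Y n" "Y n - Z n"] by simp
    qed (use R in \<open>auto simp: cuntz_rel_def\<close>)
  qed
qed

lemma cuntz_Cauchy_double:
  "cuntz_Cauchy X \<Longrightarrow> ((\<lambda>mn. cuntz_norm (X (fst mn) - X (snd mn))) \<longlongrightarrow> 0) (sequentially \<times>\<^sub>F sequentially)"
  by (simp add: cuntz_Cauchy_filter)

lemma cuntz_Cauchy_add:
  assumes "cuntz_Cauchy X" "cuntz_Cauchy Y"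
  shows "cuntz_Cauchy (\<lambda>n. X n + Y n)"
proof (rule cuntz_Cauchy_comparison[where g = "\<lambda>m n. cuntz_norm (X m - X n) + cuntz_norm (Y m - Y n)"])
  show "cuntz_norm (X m + Y m - (X n + Y n)) \<le> cuntz_norm (X m - X n) + cuntz_norm (Y m - Y n)" for m n
    using cuntz_norm_add[of "X m - X n" "Y m - Y n"] by (simp add: algebra_simps)
qed (intro tendsto_add_zero cuntz_Cauchy_double assms)

lemma cuntz_Cauchy_scale:
  assumes "cuntz_Cauchy X"
  shows "cuntz_Cauchy (\<lambda>n. poly_scale c (X n))"
proof (rule cuntz_Cauchy_comparison[where g = "\<lambda>m n. cmod c * cuntz_norm (X m - X n)"])
  show "cuntz_norm (poly_scale c (X m) - poly_scale c (X n)) \<le> cmod c * cuntz_norm (X m - X n)" for m n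
    by (simp flip: poly_scale_diff_right add: cuntz_norm_scale)
qed (intro tendsto_mult_right_zero cuntz_Cauchy_double assms)

lemma cuntz_Cauchy_minus: "cuntz_Cauchy X \<Longrightarrow> cuntz_Cauchy (\<lambda>n. - X n)"
  using cuntz_Cauchy_scale[of X "- 1"] by (simp add: poly_scale_minus_one)

lemma cuntz_Cauchy_diff: "cuntz_Cauchy X \<Longrightarrow> cuntz_Cauchy Y \<Longrightarrow> cuntz_Cauchy (\<lambda>n. X n - Y n)"
  using cuntz_Cauchy_add[of X "\<lambda>n. - Y n"] by (simp add: cuntz_Cauchy_minus)

lemma cuntz_Cauchy_adj: "cuntz_Cauchy X \<Longrightarrow> cuntz_Cauchy (\<lambda>n. poly_adj (X n))"
  by (simp add: cuntz_Cauchy_def flip: poly_adj_diff)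

lemma cuntz_norm_mult_diff:
  assumes "cuntz_norm b \<le> B" "cuntz_norm a' \<le> A"
  shows "cuntz_norm (a * b - a' * b') \<le> cuntz_norm (a - a') * B + A * cuntz_norm (b - b')"
proof -
  have "a * b - a' * b' = (a - a') * b + a' * (b - b')" by (simp add: algebra_simps)
  then have "cuntz_norm (a * b - a' * b') \<le> cuntz_norm ((a - a') * b) + cuntz_norm (a' * (b - b'))"
    by (simp add: cuntz_norm_add)
  also have "cuntz_norm ((a - a') * b) \<le> cuntz_norm (a - a') * B"
    by (rule order_trans[OF cuntz_norm_mult mult_left_mono[OF assms(1) cuntz_norm_ge0]])
  also have "cuntz_norm (a' * (b - b')) \<le> A * cuntz_norm (b - b')"
    by (rule order_trans[OF cuntz_norm_mult mult_right_mono[OF assms(2) cuntz_norm_ge0]])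
  finally show ?thesis by simp
qed

lemma cuntz_Cauchy_mult:
  assumes "cuntz_Cauchy X" "cuntz_Cauchy Y"
  shows "cuntz_Cauchy (\<lambda>n. X n * Y n)"
proof -
  obtain A where A: "\<And>n. cuntz_norm (X n) \<le> A" using cuntz_Cauchy_bounded[OF assms(1)] by blast
  obtain B where B: "\<And>n. cuntz_norm (Y n) \<le> B" using cuntz_Cauchy_bounded[OF assms(2)] by blast
  show ?thesis
  proof (rule cuntz_Cauchy_comparison[where
        g = "\<lambda>m n. cuntz_norm (X m - X n) * B + A * cuntz_norm (Y m - Y n)"])
    show "cuntz_norm (X m * Y m - X n * Y n) \<le> cuntz_norm (X m - X n) * B + A * cuntz_norm (Y m - Y n)"
      for m n by (rule cuntz_norm_mult_diff[OF B A])
  qed (intro tendsto_add_zero tendsto_mult_left_zero tendsto_mult_right_zero cuntz_Cauchy_double assms)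
qed

lemmas cuntz_Cauchy_intros =
  cuntz_Cauchy_const cuntz_Cauchy_add cuntz_Cauchy_scale cuntz_Cauchy_minus cuntz_Cauchy_diff
  cuntz_Cauchy_adj cuntz_Cauchy_mult

lemma cuntz_relD:
  "cuntz_rel X Y \<Longrightarrow> cuntz_Cauchy X" "cuntz_rel X Y \<Longrightarrow> cuntz_Cauchy Y"
  "cuntz_rel X Y \<Longrightarrow> (\<lambda>n. cuntz_norm (X n - Y n)) \<longlonglongrightarrow> 0"
  by (simp_all add: cuntz_rel_def)

lemma cuntz_rel_norm_eq:
  assumes "cuntz_rel X Y" shows "lim (\<lambda>n. cuntz_norm (X n)) = lim (\<lambda>n. cuntz_norm (Y n))"
proof -
  have "(\<lambda>n. cuntz_norm (X n) - cuntz_norm (Y n)) \<longlonglongrightarrow> 0"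
    by (rule Lim_null_comparison[OF _ cuntz_relD(3)[OF assms]]) (simp add: cuntz_norm_abs_diff)
  moreover have "(\<lambda>n. cuntz_norm (X n) - cuntz_norm (Y n))
    \<longlonglongrightarrow> lim (\<lambda>n. cuntz_norm (X n)) - lim (\<lambda>n. cuntz_norm (Y n))"
    by (intro tendsto_diff) (simp_all flip: convergent_LIMSEQ_iff
      add: cuntz_norm_convergent cuntz_relD[OF assms])
  ultimately show ?thesis using LIMSEQ_unique by fastforce
qed

instantiation cuntz :: (finite) "{complex_vector, monoid_mult}"
begin

lift_definition zero_cuntz :: "'a cuntz" is "\<lambda>_. 0"
  by (intro cuntz_rel_refl cuntz_Cauchy_intros)
lift_definition one_cuntz :: "'a cuntz" is "\<lambda>_. 1"
  by (intro cuntz_rel_refl cuntz_Cauchy_intros)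
lift_definition plus_cuntz :: "'a cuntz \<Rightarrow> 'a cuntz \<Rightarrow> 'a cuntz" is "\<lambda>X Y n. X n + Y n"
proof -
  fix X X' Y Y' :: "nat \<Rightarrow> 'a star_poly" assume R: "cuntz_rel X X'" "cuntz_rel Y Y'"
  show "cuntz_rel (\<lambda>n. X n + Y n) (\<lambda>n. X' n + Y' n)"
  proof (rule cuntz_rel_comparison[where g = "\<lambda>n. cuntz_norm (X n - X' n) + cuntz_norm (Y n - Y' n)"])
    show "cuntz_norm (X n + Y n - (X' n + Y' n)) \<le> cuntz_norm (X n - X' n) + cuntz_norm (Y n - Y' n)" for n
      using cuntz_norm_add[of "X n - X' n" "Y n - Y' n"] by (simp add: algebra_simps)
  qed (intro cuntz_Cauchy_intros tendsto_add_zero cuntz_relD(3) R cuntz_relD(1)[OF R(1)]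
      cuntz_relD(1)[OF R(2)] cuntz_relD(2)[OF R(1)] cuntz_relD(2)[OF R(2)])+
qed
lift_definition scaleC_cuntz :: "complex \<Rightarrow> 'a cuntz \<Rightarrow> 'a cuntz" is "\<lambda>c X n. poly_scale c (X n)"
proof -
  fix c and X X' :: "nat \<Rightarrow> 'a star_poly" assume R: "cuntz_rel X X'"
  show "cuntz_rel (\<lambda>n. poly_scale c (X n)) (\<lambda>n. poly_scale c (X' n))"
  proof (rule cuntz_rel_comparison[where g = "\<lambda>n. cmod c * cuntz_norm (X n - X' n)"])
    show "cuntz_norm (poly_scale c (X n) - poly_scale c (X' n)) \<le> cmod c * cuntz_norm (X n - X' n)" for n
      by (simp flip: poly_scale_diff_right add: cuntz_norm_scale)
  qed (intro cuntz_Cauchy_intros tendsto_mult_right_zero cuntz_relD(3) R cuntz_relD(1)[OF R]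
      cuntz_relD(2)[OF R])+
qed
lift_definition times_cuntz :: "'a cuntz \<Rightarrow> 'a cuntz \<Rightarrow> 'a cuntz" is "\<lambda>X Y n. X n * Y n"
proof -
  fix X X' Y Y' :: "nat \<Rightarrow> 'a star_poly" assume R: "cuntz_rel X X'" "cuntz_rel Y Y'"
  obtain A where A: "\<And>n. cuntz_norm (X' n) \<le> A"
    using cuntz_Cauchy_bounded[OF cuntz_relD(2)[OF R(1)]] by blast
  obtain B where B: "\<And>n. cuntz_norm (Y n) \<le> B"
    using cuntz_Cauchy_bounded[OF cuntz_relD(1)[OF R(2)]] by blast
  show "cuntz_rel (\<lambda>n. X n * Y n) (\<lambda>n. X' n * Y' n)"
  proof (rule cuntz_rel_comparison[where
        g = "\<lambda>n. cuntz_norm (X n - X' n) * B + A * cuntz_norm (Y n - Y' n)"])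
    show "cuntz_norm (X n * Y n - X' n * Y' n)
      \<le> cuntz_norm (X n - X' n) * B + A * cuntz_norm (Y n - Y' n)" for n
      by (rule cuntz_norm_mult_diff[OF B A])
  qed (intro cuntz_Cauchy_intros tendsto_add_zero tendsto_mult_left_zero tendsto_mult_right_zero
      cuntz_relD(3) R cuntz_relD(1)[OF R(1)] cuntz_relD(1)[OF R(2)]
      cuntz_relD(2)[OF R(1)] cuntz_relD(2)[OF R(2)])+
qed
definition uminus_cuntz :: "'a cuntz \<Rightarrow> 'a cuntz" where "uminus_cuntz x = (- 1) *\<^sub>C x"
definition minus_cuntz :: "'a cuntz \<Rightarrow> 'a cuntz \<Rightarrow> 'a cuntz" where "minus_cuntz x y = x + (- y)"
definition scaleR_cuntz :: "real \<Rightarrow> 'a cuntz \<Rightarrow> 'a cuntz" where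
  "scaleR_cuntz r x = complex_of_real r *\<^sub>C x"

instance
proof
  fix x y z :: "'a cuntz" and c d :: complex and r t :: real
  show add_assoc: "x + y + z = x + (y + z)"
    by transfer (auto intro!: cuntz_rel_refl cuntz_Cauchy_intros dest: cuntz_relD(1) simp: add.assoc)
  show "x + y = y + x"
    by transfer (auto intro!: cuntz_rel_refl cuntz_Cauchy_intros dest: cuntz_relD(1) simp: add.commute)
  show "0 + x = x"
    by transfer (auto intro!: cuntz_rel_refl cuntz_Cauchy_intros dest: cuntz_relD(1))
  show "- x + x = 0"
    unfolding uminus_cuntz_def
    by transfer (auto intro!: cuntz_rel_refl cuntz_Cauchy_intros dest: cuntz_relD(1) simp: poly_scale_minus_one)
  show "x - y = x + - y" by (rule minus_cuntz_def)
  show scaleC_add: "c *\<^sub>C (x + y) = c *\<^sub>C x + c *\<^sub>C y" for c and x y :: "'a cuntz"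
    by transfer (auto intro!: cuntz_rel_refl cuntz_Cauchy_intros dest: cuntz_relD(1) simp: poly_scale_add_right)
  show scaleC_add': "(c + d) *\<^sub>C x = c *\<^sub>C x + d *\<^sub>C x" for c d and x :: "'a cuntz"
    by transfer (auto intro!: cuntz_rel_refl cuntz_Cauchy_intros dest: cuntz_relD(1) simp: poly_scale_add_left)
  show scaleC_scale: "c *\<^sub>C d *\<^sub>C x = (c * d) *\<^sub>C x" for c d and x :: "'a cuntz"
    by transfer (auto intro!: cuntz_rel_refl cuntz_Cauchy_intros dest: cuntz_relD(1) simp: poly_scale_scale)
  show "complex_of_real r *\<^sub>C x = r *\<^sub>R x" by (simp add: scaleR_cuntz_def)
  show "r *\<^sub>R (x + y) = r *\<^sub>R x + r *\<^sub>R y" by (simp add: scaleR_cuntz_def scaleC_add)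
  show "(r + t) *\<^sub>R x = r *\<^sub>R x + t *\<^sub>R x" by (simp add: scaleR_cuntz_def scaleC_add')
  show "r *\<^sub>R t *\<^sub>R x = (r * t) *\<^sub>R x" by (simp add: scaleR_cuntz_def scaleC_scale)
  show "1 *\<^sub>R x = x" unfolding scaleR_cuntz_def of_real_1
    by transfer (auto intro!: cuntz_rel_refl cuntz_Cauchy_intros dest: cuntz_relD(1) simp: poly_scale_one)
  show "x * y * z = x * (y * z)"
    by transfer (auto intro!: cuntz_rel_refl cuntz_Cauchy_intros dest: cuntz_relD(1) simp: mult.assoc)
  show "1 * x = x"
    by transfer (auto intro!: cuntz_rel_refl cuntz_Cauchy_intros dest: cuntz_relD(1))
  show "x * 1 = x"
    by transfer (auto intro!: cuntz_rel_refl cuntz_Cauchy_intros dest: cuntz_relD(1))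
qed

end

lifting_forget poly_mapping.lifting

lift_definition cuntz_of_poly :: "'n::finite star_poly \<Rightarrow> 'n cuntz" is "\<lambda>p _. p"
  by (intro cuntz_rel_refl cuntz_Cauchy_intros)

lifting_update poly_mapping.lifting

instantiation cuntz :: (finite) real_normed_algebra
begin

lift_definition norm_cuntz :: "'a cuntz \<Rightarrow> real" is "\<lambda>X. lim (\<lambda>n. cuntz_norm (X n))"
  by (rule cuntz_rel_norm_eq)
definition dist_cuntz :: "'a cuntz \<Rightarrow> 'a cuntz \<Rightarrow> real" where "dist_cuntz x y = norm (x - y)"
definition sgn_cuntz :: "'a cuntz \<Rightarrow> 'a cuntz" where "sgn_cuntz x = x /\<^sub>R norm x"
definition uniformity_cuntz :: "('a cuntz \<times> 'a cuntz) filter" where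
  "uniformity_cuntz = (INF e\<in>{0<..}. principal {(x, y). dist x y < e})"
definition open_cuntz :: "'a cuntz set \<Rightarrow> bool" where
  "open_cuntz U \<longleftrightarrow> (\<forall>x\<in>U. eventually (\<lambda>(x', y). x' = x \<longrightarrow> y \<in> U) uniformity)"

lemma cuntz_norm_lim: "cuntz_Cauchy X \<Longrightarrow> (\<lambda>n. cuntz_norm (X n)) \<longlonglongrightarrow> lim (\<lambda>n. cuntz_norm (X n))"
  by (simp add: cuntz_norm_convergent flip: convergent_LIMSEQ_iff)

lemma norm_scaleC_cuntz: "norm (c *\<^sub>C x) = cmod c * norm (x :: 'a cuntz)"
proof transfer
  fix c and X :: "nat \<Rightarrow> 'a star_poly" assume "cuntz_rel X X"
  then have "(\<lambda>n. cmod c * cuntz_norm (X n)) \<longlonglongrightarrow> cmod c * lim (\<lambda>n. cuntz_norm (X n))"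
    by (intro tendsto_mult_left cuntz_norm_lim cuntz_relD(1))
  then show "lim (\<lambda>n. cuntz_norm (poly_scale c (X n))) = cmod c * lim (\<lambda>n. cuntz_norm (X n))"
    by (simp add: cuntz_norm_scale limI)
qed

instance
proof
  fix x y z :: "'a cuntz" and r :: real
  show "dist x y = norm (x - y)" by (rule dist_cuntz_def)
  show "sgn x = x /\<^sub>R norm x" by (rule sgn_cuntz_def)
  show "(uniformity :: ('a cuntz \<times> 'a cuntz) filter)
    = (INF e\<in>{0<..}. principal {(x, y). dist x y < e})" by (rule uniformity_cuntz_def)
  show "open U \<longleftrightarrow> (\<forall>x\<in>U. eventually (\<lambda>(x', y). x' = x \<longrightarrow> y \<in> U) uniformity)" for U :: "'a cuntz set"
    by (rule open_cuntz_def)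
  show "norm x = 0 \<longleftrightarrow> x = 0"
  proof transfer
    fix X :: "nat \<Rightarrow> 'a star_poly" assume R: "cuntz_rel X X"
    show "lim (\<lambda>n. cuntz_norm (X n)) = 0 \<longleftrightarrow> cuntz_rel X (\<lambda>_. 0)"
    proof
      assume "lim (\<lambda>n. cuntz_norm (X n)) = 0"
      then show "cuntz_rel X (\<lambda>_. 0)"
        using cuntz_norm_lim[of X] R by (simp add: cuntz_rel_def cuntz_Cauchy_const)
    next
      assume "cuntz_rel X (\<lambda>_. 0)"
      from cuntz_rel_norm_eq[OF this] show "lim (\<lambda>n. cuntz_norm (X n)) = 0" by (simp add: limI)
    qed
  qed
  show "norm (x + y) \<le> norm x + norm y"
  proof transfer
    fix X Y :: "nat \<Rightarrow> 'a star_poly" assume "cuntz_rel X X" "cuntz_rel Y Y"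
    then have "cuntz_Cauchy X" "cuntz_Cauchy Y" by (auto dest: cuntz_relD)
    then show "lim (\<lambda>n. cuntz_norm (X n + Y n)) \<le> lim (\<lambda>n. cuntz_norm (X n)) + lim (\<lambda>n. cuntz_norm (Y n))"
      by (intro LIMSEQ_le[OF cuntz_norm_lim tendsto_add[OF cuntz_norm_lim cuntz_norm_lim]])
        (auto intro: cuntz_Cauchy_add cuntz_norm_add)
  qed
  show "norm (r *\<^sub>R x) = \<bar>r\<bar> * norm x"
    by (simp add: norm_scaleC_cuntz scaleR_cuntz_def)
  show "norm (x * y) \<le> norm x * norm y"
  proof transfer
    fix X Y :: "nat \<Rightarrow> 'a star_poly" assume "cuntz_rel X X" "cuntz_rel Y Y"
    then have "cuntz_Cauchy X" "cuntz_Cauchy Y" by (auto dest: cuntz_relD)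
    then show "lim (\<lambda>n. cuntz_norm (X n * Y n)) \<le> lim (\<lambda>n. cuntz_norm (X n)) * lim (\<lambda>n. cuntz_norm (Y n))"
      by (intro LIMSEQ_le[OF cuntz_norm_lim tendsto_mult[OF cuntz_norm_lim cuntz_norm_lim]])
        (auto intro: cuntz_Cauchy_mult cuntz_norm_mult)
  qed
  show "(x + y) * z = x * z + y * z"
    by transfer (auto intro!: cuntz_rel_refl cuntz_Cauchy_intros dest: cuntz_relD(1) simp: distrib_right)
  show "x * (y + z) = x * y + x * z"
    by transfer (auto intro!: cuntz_rel_refl cuntz_Cauchy_intros dest: cuntz_relD(1) simp: distrib_left)
  show "(r *\<^sub>R x) * y = r *\<^sub>R (x * y)" unfolding scaleR_cuntz_def
    by transfer (auto intro!: cuntz_rel_refl cuntz_Cauchy_intros dest: cuntz_relD(1) simp: poly_scale_mult_left)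
  show "x * (r *\<^sub>R y) = r *\<^sub>R (x * y)" unfolding scaleR_cuntz_def
    by transfer (auto intro!: cuntz_rel_refl cuntz_Cauchy_intros dest: cuntz_relD(1) simp: poly_scale_mult_right)
qed

end

lemma norm_cuntz_of_poly: "norm (cuntz_of_poly p) = cuntz_norm p"
  by transfer (simp add: limI)

lemma cuntz_of_poly_simps:
  "cuntz_of_poly (p + q) = cuntz_of_poly p + cuntz_of_poly q"
  "cuntz_of_poly (p * q) = cuntz_of_poly p * cuntz_of_poly q"
  "cuntz_of_poly (poly_scale c p) = c *\<^sub>C cuntz_of_poly p"
  "cuntz_of_poly 0 = 0" "cuntz_of_poly 1 = 1"
  by (transfer, intro cuntz_rel_refl cuntz_Cauchy_intros)+

lemma cuntz_of_poly_minus: "cuntz_of_poly (- p) = - cuntz_of_poly p"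
  using cuntz_of_poly_simps(3)[of "- 1" p] by (simp add: poly_scale_minus_one uminus_cuntz_def)

lemma cuntz_of_poly_diff: "cuntz_of_poly (p - q) = cuntz_of_poly p - cuntz_of_poly q"
  using cuntz_of_poly_simps(1)[of p "- q"] by (simp add: cuntz_of_poly_minus)

lemma cuntz_of_poly_sum: "cuntz_of_poly (\<Sum>i\<in>I. f i) = (\<Sum>i\<in>I. cuntz_of_poly (f i))"
  by (induction I rule: infinite_finite_induct) (simp_all add: cuntz_of_poly_simps)

lemma cuntz_limit:
  assumes "cuntz_Cauchy X" shows "(\<lambda>n. cuntz_of_poly (X n)) \<longlonglongrightarrow> abs_cuntz X"
proof (rule LIMSEQ_I)
  fix e :: real assume e: "0 < e"
  then obtain M where M: "\<And>m n. m \<ge> M \<Longrightarrow> n \<ge> M \<Longrightarrow> cuntz_norm (X m - X n) < e / 2"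
    using assms unfolding cuntz_Cauchy_def by (metis half_gt_zero)
  have "norm (cuntz_of_poly (X n) - abs_cuntz X) < e" if n: "n \<ge> M" for n
  proof -
    have C: "cuntz_Cauchy (\<lambda>m. X n + - X m)"
      by (intro cuntz_Cauchy_intros assms)
    have "cuntz_of_poly (X n) - abs_cuntz X = abs_cuntz (\<lambda>m. X n + - X m)"
      by (simp add: minus_cuntz_def uminus_cuntz_def cuntz_of_poly.abs_eq scaleC_cuntz.abs_eq
          plus_cuntz.abs_eq cuntz_rel_refl cuntz_Cauchy_intros assms poly_scale_minus_one)
    then have "norm (cuntz_of_poly (X n) - abs_cuntz X) = lim (\<lambda>m. cuntz_norm (X n - X m))"
      using C by (simp add: norm_cuntz.abs_eq cuntz_rel_refl)
    also have "\<dots> \<le> e / 2"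
      using cuntz_norm_lim[OF C] M[OF n] by (intro LIMSEQ_le_const2) (auto intro: less_imp_le)
    finally show ?thesis using e by simp
  qed
  then show "\<exists>M. \<forall>n\<ge>M. norm (cuntz_of_poly (X n) - abs_cuntz X) < e" by blast
qed

lemma cuntz_dense: "\<exists>X. cuntz_Cauchy X \<and> (\<lambda>n. cuntz_of_poly (X n)) \<longlonglongrightarrow> x"
proof (induction x rule: cuntz.abs_induct)
  case (1 X)
  then show ?case using cuntz_limit[of X] by (auto simp: cuntz_rel_def)
qed

instance cuntz :: (finite) banach
proof
  fix A :: "nat \<Rightarrow> 'a cuntz" assume A: "Cauchy A"
  have "\<exists>p. norm (A n - cuntz_of_poly p) < inverse (real (Suc n))" for n
  proof -
    obtain X where "(\<lambda>k. cuntz_of_poly (X k)) \<longlonglongrightarrow> A n" using cuntz_dense by blast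
    from LIMSEQ_D[OF this, of "inverse (real (Suc n))"] show ?thesis
      by (auto simp: norm_minus_commute)
  qed
  then obtain q where q: "\<And>n. norm (A n - cuntz_of_poly (q n)) < inverse (real (Suc n))" by metis
  have "(\<lambda>n. norm (A n - cuntz_of_poly (q n))) \<longlonglongrightarrow> 0"
    by (rule Lim_null_comparison[OF _ LIMSEQ_inverse_real_of_nat])
      (simp del: of_nat_Suc add: less_imp_le[OF q])
  then have lim: "(\<lambda>n. A n - cuntz_of_poly (q n)) \<longlonglongrightarrow> 0" by (rule tendsto_norm_zero_cancel)
  have "Cauchy (\<lambda>n. cuntz_of_poly (q n))"
  proof (rule CauchyI)
    fix e :: real assume "0 < e"
    then obtain M N
      where M: "\<And>m n. m \<ge> M \<Longrightarrow> n \<ge> M \<Longrightarrow> norm (A m - A n) < e / 3"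
        and N: "\<And>n. n \<ge> N \<Longrightarrow> norm (A n - cuntz_of_poly (q n)) < e / 3"
      using CauchyD[OF A, of "e / 3"] LIMSEQ_D[OF lim, of "e / 3"] by auto
    have "norm (cuntz_of_poly (q m) - cuntz_of_poly (q n)) < e" if "m \<ge> max M N" "n \<ge> max M N" for m n
    proof -
      have "cuntz_of_poly (q m) - cuntz_of_poly (q n)
        = (A m - A n) - (A m - cuntz_of_poly (q m)) + (A n - cuntz_of_poly (q n))" by simp
      then have "norm (cuntz_of_poly (q m) - cuntz_of_poly (q n))
        \<le> norm (A m - A n) + norm (A m - cuntz_of_poly (q m)) + norm (A n - cuntz_of_poly (q n))"
        using norm_triangle_ineq[of "(A m - A n) - (A m - cuntz_of_poly (q m))" "A n - cuntz_of_poly (q n)"]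
          norm_triangle_ineq4[of "A m - A n" "A m - cuntz_of_poly (q m)"] by simp
      with M[of m n] N[of m] N[of n] that show ?thesis by simp
    qed
    then show "\<exists>K. \<forall>m\<ge>K. \<forall>n\<ge>K. norm (cuntz_of_poly (q m) - cuntz_of_poly (q n)) < e" by blast
  qed
  then have C: "cuntz_Cauchy q"
    by (simp add: Cauchy_iff cuntz_Cauchy_def norm_cuntz_of_poly flip: cuntz_of_poly_diff)
  from tendsto_add[OF lim cuntz_limit[OF C]] have "A \<longlonglongrightarrow> abs_cuntz q" by simp
  then show "convergent A" by (rule convergentI)
qed

instantiation cuntz :: (finite) unital_cstar_algebra
begin

lift_definition star_cuntz :: "'a cuntz \<Rightarrow> 'a cuntz" is "\<lambda>X n. poly_adj (X n)"
  by (simp add: cuntz_rel_def cuntz_Cauchy_adj flip: poly_adj_diff)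

instance
proof
  fix a b :: "'a cuntz" and c :: complex
  show "(c *\<^sub>C a) * b = c *\<^sub>C (a * b)"
    by transfer (auto intro!: cuntz_rel_refl cuntz_Cauchy_intros dest: cuntz_relD(1) simp: poly_scale_mult_left)
  show "a * (c *\<^sub>C b) = c *\<^sub>C (a * b)"
    by transfer (auto intro!: cuntz_rel_refl cuntz_Cauchy_intros dest: cuntz_relD(1) simp: poly_scale_mult_right)
  show "norm (c *\<^sub>C a) = cmod c * norm a" by (rule norm_scaleC_cuntz)
  show "star (a + b) = star a + star b"
    by transfer (auto intro!: cuntz_rel_refl cuntz_Cauchy_intros dest: cuntz_relD(1) simp: poly_adj_add)
  show "star (c *\<^sub>C a) = cnj c *\<^sub>C star a"
    by transfer (auto intro!: cuntz_rel_refl cuntz_Cauchy_intros dest: cuntz_relD(1) simp: poly_adj_scale)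
  show "star (a * b) = star b * star a"
    by transfer (auto intro!: cuntz_rel_refl cuntz_Cauchy_intros dest: cuntz_relD(1) simp: poly_adj_mult)
  show "star (star a) = a"
    by transfer (auto intro!: cuntz_rel_refl cuntz_Cauchy_intros dest: cuntz_relD(1))
  show "norm (star a * a) = (norm a)\<^sup>2"
  proof transfer
    fix X :: "nat \<Rightarrow> 'a star_poly" assume "cuntz_rel X X"
    then have "(\<lambda>n. (cuntz_norm (X n))\<^sup>2) \<longlonglongrightarrow> (lim (\<lambda>n. cuntz_norm (X n)))\<^sup>2"
      by (intro tendsto_power cuntz_norm_lim cuntz_relD(1))
    then show "lim (\<lambda>n. cuntz_norm (poly_adj (X n) * X n)) = (lim (\<lambda>n. cuntz_norm (X n)))\<^sup>2"
      by (simp add: cuntz_norm_cstar limI)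
  qed
qed

end

lemma cuntz_of_poly_adj: "cuntz_of_poly (poly_adj p) = star (cuntz_of_poly p)"
  by (transfer, intro cuntz_rel_refl cuntz_Cauchy_intros)

lemma cuntz_of_poly_eq_iff: "cuntz_of_poly p = cuntz_of_poly q \<longleftrightarrow> cuntz_norm (p - q) = 0"
  by (metis cuntz_of_poly_diff norm_cuntz_of_poly norm_eq_zero right_minus_eq)

definition cuntz_gen :: "'n::finite \<Rightarrow> 'n cuntz" where
  "cuntz_gen i = cuntz_of_poly (poly_gen i)"

definition cuntz_family :: "('n::finite \<Rightarrow> 'a::unital_cstar_algebra) \<Rightarrow> bool" where
  "cuntz_family t \<longleftrightarrow>
     (\<forall>i j. star (t i) * t j = (if i = j then 1 else 0)) \<and> (\<Sum>i\<in>UNIV. t i * star (t i)) = 1"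

lemma cuntz_family_cuntz_gen: "cuntz_family cuntz_gen"
proof -
  have "cuntz_of_poly (poly_adj (poly_gen i) * poly_gen j) = cuntz_of_poly (if i = j then 1 else 0)"
    for i j :: 'a
    unfolding cuntz_of_poly_eq_iff by (rule cuntz_norm_isometry)
  moreover have "cuntz_of_poly (\<Sum>i\<in>UNIV. poly_gen i * poly_adj (poly_gen i)) = cuntz_of_poly (1 :: 'a star_poly)"
    unfolding cuntz_of_poly_eq_iff by (rule cuntz_norm_range)
  ultimately show ?thesis
    unfolding cuntz_family_def cuntz_gen_def
    by (simp add: cuntz_of_poly_simps cuntz_of_poly_adj cuntz_of_poly_sum split: if_splits)
qed

lemma scaleC_zero_left [simp]: "0 *\<^sub>C x = (0 :: 'a::complex_vector)"
  using scaleC_of_real[of 0 x] by simp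

lemma scaleC_one [simp]: "1 *\<^sub>C x = (x :: 'a::complex_vector)"
  using scaleC_of_real[of 1 x] by simp

lemma scaleC_minus_one: "(- 1) *\<^sub>C x = - (x :: 'a::complex_vector)"
  using scaleC_of_real[of "- 1" x] by simp

lemma star_zero [simp]: "star 0 = (0 :: 'a::unital_cstar_algebra)"
  using star_add[of "0 :: 'a" 0] by simp

lemma star_one [simp]: "star 1 = (1 :: 'a::unital_cstar_algebra)"
  by (metis mult_1_right star_mult star_star)

section \<open>The universal property\<close>

definition unital_star_hom :: "('a::unital_cstar_algebra \<Rightarrow> 'b::unital_cstar_algebra) \<Rightarrow> bool" where
  "unital_star_hom \<phi> \<longleftrightarrow>
     (\<forall>a b. \<phi> (a + b) = \<phi> a + \<phi> b) \<and> (\<forall>c a. \<phi> (c *\<^sub>C a) = c *\<^sub>C \<phi> a) \<and>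
     (\<forall>a b. \<phi> (a * b) = \<phi> a * \<phi> b) \<and> \<phi> 1 = 1 \<and> (\<forall>a. \<phi> (star a) = star (\<phi> a))"

fun letter_val :: "('n \<Rightarrow> 'a::unital_cstar_algebra) \<Rightarrow> 'n letter \<Rightarrow> 'a" where
  "letter_val t (Gen i) = t i"
| "letter_val t (Adj i) = star (t i)"

definition word_val :: "('n \<Rightarrow> 'a::unital_cstar_algebra) \<Rightarrow> 'n word \<Rightarrow> 'a" where
  "word_val t w = prod_list (map (letter_val t) (letters w))"

definition poly_eval :: "('n \<Rightarrow> 'a::unital_cstar_algebra) \<Rightarrow> 'n star_poly \<Rightarrow> 'a" where
  "poly_eval t p = (\<Sum>w\<in>Poly_Mapping.keys p. Poly_Mapping.lookup p w *\<^sub>C word_val t w)"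

lemma poly_eval_superset:
  assumes "finite S" "Poly_Mapping.keys p \<subseteq> S"
  shows "poly_eval t p = (\<Sum>w\<in>S. Poly_Mapping.lookup p w *\<^sub>C word_val t w)"
  unfolding poly_eval_def using assms by (intro sum.mono_neutral_left) (auto simp: in_keys_iff)

lemma poly_eval_add: "poly_eval t (p + q) = poly_eval t p + poly_eval t q"
proof -
  let ?S = "Poly_Mapping.keys p \<union> Poly_Mapping.keys q"
  have fin: "finite ?S" by simp
  show ?thesis
    unfolding poly_eval_superset[OF fin keys_add] poly_eval_superset[OF fin Un_upper1]
      poly_eval_superset[OF fin Un_upper2]
    by (simp add: lookup_add scaleC_add_left sum.distrib)
qed

lemma poly_eval_zero [simp]: "poly_eval t 0 = 0"
  by (simp add: poly_eval_def)

lemma poly_eval_single: "poly_eval t (Poly_Mapping.single w c) = c *\<^sub>C word_val t w"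
  by (simp add: poly_eval_superset[of "{w}"])

lemma word_val_zero: "word_val t 0 = 1"
  by (simp add: word_val_def zero_word_def)

lemma word_val_add: "word_val t (v + w) = word_val t v * word_val t w"
  by (simp add: word_val_def plus_word_def)

lemma word_val_adj: "word_val t (adj_word w) = star (word_val t w)"
proof -
  have "letter_val t (adj_letter l) = star (letter_val t l)" for l
    by (cases l) (simp_all add: star_star)
  then have "prod_list (map (letter_val t) (rev (map adj_letter ls))) = star (prod_list (map (letter_val t) ls))" for ls
    by (induction ls) (simp_all add: star_mult)
  then show ?thesis by (simp add: word_val_def adj_word_def)
qed

lemma poly_eval_one: "poly_eval t 1 = 1"
  using poly_eval_single[of t 0 1] by (simp add: word_val_zero)

lemma poly_eval_mult: "poly_eval t (p * q) = poly_eval t p * poly_eval t q"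
proof (induction p rule: star_poly_induct)
  case (add p v c)
  have "poly_eval t (Poly_Mapping.single v c * q) = (c *\<^sub>C word_val t v) * poly_eval t q"
  proof (induction q rule: star_poly_induct)
    case (add q w d)
    then show ?case
      by (simp add: distrib_left poly_eval_add mult_single poly_eval_single word_val_add
          mult_scaleC_left mult_scaleC_right scaleC_scaleC scaleC_add_right mult.commute)
  qed simp
  with add show ?case by (simp add: distrib_right poly_eval_add poly_eval_single)
qed simp

lemma poly_eval_scale: "poly_eval t (poly_scale c p) = c *\<^sub>C poly_eval t p"
  by (simp add: poly_scale_def poly_eval_mult poly_eval_single mult_scaleC_left word_val_def zero_word_def)

lemma poly_eval_diff: "poly_eval t (p - q) = poly_eval t p - poly_eval t q"
  using poly_eval_add[of t "p - q" q] by simp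

lemma poly_eval_sum: "poly_eval t (\<Sum>i\<in>I. f i) = (\<Sum>i\<in>I. poly_eval t (f i))"
  by (induction I rule: infinite_finite_induct) (simp_all add: poly_eval_add)

lemma poly_eval_adj: "poly_eval t (poly_adj p) = star (poly_eval t p)"
proof (induction p rule: star_poly_induct)
  case (add p w c)
  then show ?case
    by (simp add: poly_adj_add poly_eval_add poly_adj_single poly_eval_single star_add star_scaleC word_val_adj)
qed simp

lemma poly_eval_gen: "poly_eval t (poly_gen i) = t i"
  by (simp add: poly_gen_def poly_eval_single word_val_def)

lemma cuntz_of_poly_eval: "poly_eval cuntz_gen p = cuntz_of_poly p"
proof (induction p rule: star_poly_induct)
  case (add p w c)
  have "cuntz_of_poly (Poly_Mapping.single (Word ls) 1) = word_val cuntz_gen (Word ls)" for ls :: "'a letter list"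
  proof (induction ls)
    case Nil
    show ?case by (simp add: word_val_zero cuntz_of_poly_simps flip: zero_word_def)
  next
    case (Cons l ls)
    have eq: "Poly_Mapping.single (Word (l # ls)) 1
      = (Poly_Mapping.single (Word [l]) 1 * Poly_Mapping.single (Word ls) 1 :: 'a star_poly)"
      by (simp add: mult_single plus_word_def)
    have "cuntz_of_poly (Poly_Mapping.single (Word [l]) 1) = letter_val cuntz_gen l"
    proof (cases l)
      case (Adj i)
      then show ?thesis
        by (simp add: cuntz_gen_def poly_gen_def poly_adj_single adj_word_def flip: cuntz_of_poly_adj)
    qed (simp add: cuntz_gen_def poly_gen_def)
    with Cons show ?case
      unfolding eq by (simp add: cuntz_of_poly_simps word_val_def)
  qed
  from this[of "letters w"]
  have "cuntz_of_poly (Poly_Mapping.single w 1) = word_val cuntz_gen w" by simp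
  moreover have "Poly_Mapping.single w c = poly_scale c (Poly_Mapping.single w 1)"
    by (simp add: poly_scale_def mult_single)
  ultimately have "cuntz_of_poly (Poly_Mapping.single w c) = c *\<^sub>C word_val cuntz_gen w"
    by (simp add: cuntz_of_poly_simps)
  with add show ?case by (simp add: poly_eval_add poly_eval_single cuntz_of_poly_simps)
qed (simp add: cuntz_of_poly_simps)

lemma cuntz_seminorm_poly_eval:
  assumes "cuntz_family t"
  shows "cuntz_seminorm (\<lambda>p. norm (poly_eval t p))"
proof -
  have "poly_eval t (if i = j then 1 else 0) = (if i = j then 1 else 0)" for i j :: 'a
    by (simp add: poly_eval_one)
  then show ?thesis
    using assms unfolding cuntz_seminorm_def cuntz_family_def
    by (simp add: poly_eval_add norm_triangle_ineq poly_eval_scale norm_scaleC poly_eval_mult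
        norm_mult_ineq poly_eval_adj cstar_identity poly_eval_diff poly_eval_gen poly_eval_sum poly_eval_one)
qed

definition cuntz_hom :: "('n::finite \<Rightarrow> 'a::unital_cstar_algebra) \<Rightarrow> 'n cuntz \<Rightarrow> 'a" where
  "cuntz_hom t x = lim (\<lambda>n. poly_eval t (rep_cuntz x n))"

context
  fixes t :: "'n::finite \<Rightarrow> 'a::unital_cstar_algebra"
  assumes t: "cuntz_family t"
begin

lemma norm_poly_eval_le: "norm (poly_eval t p) \<le> cuntz_norm p"
  by (rule cuntz_norm_upper[OF cuntz_seminorm_poly_eval[OF t]])

lemma cuntz_hom_limit:
  assumes "cuntz_Cauchy X"
  shows "(\<lambda>n. poly_eval t (X n)) \<longlonglongrightarrow> cuntz_hom t (abs_cuntz X)"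
proof -
  let ?Y = "rep_cuntz (abs_cuntz X)"
  have R: "cuntz_rel ?Y X"
    by (rule rep_abs_rsp_left[OF Quotient3_cuntz]) (rule cuntz_rel_refl[OF assms])
  have "Cauchy (\<lambda>n. poly_eval t (?Y n))"
  proof (rule CauchyI)
    fix e :: real assume "0 < e"
    then obtain M where "\<forall>m\<ge>M. \<forall>n\<ge>M. cuntz_norm (?Y m - ?Y n) < e"
      using cuntz_relD(1)[OF R] unfolding cuntz_Cauchy_def by blast
    then show "\<exists>M. \<forall>m\<ge>M. \<forall>n\<ge>M. norm (poly_eval t (?Y m) - poly_eval t (?Y n)) < e"
      using norm_poly_eval_le by (metis le_less_trans poly_eval_diff)
  qed
  then have lim: "(\<lambda>n. poly_eval t (?Y n)) \<longlonglongrightarrow> cuntz_hom t (abs_cuntz X)"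
    unfolding cuntz_hom_def by (simp add: Cauchy_convergent_iff convergent_LIMSEQ_iff)
  have "(\<lambda>n. norm (poly_eval t (?Y n) - poly_eval t (X n))) \<longlonglongrightarrow> 0"
    by (rule Lim_null_comparison[OF _ cuntz_relD(3)[OF R]])
      (simp add: norm_poly_eval_le flip: poly_eval_diff)
  from tendsto_diff[OF lim tendsto_norm_zero_cancel[OF this]] show ?thesis by simp
qed

lemma cuntz_hom_of_poly: "cuntz_hom t (cuntz_of_poly p) = poly_eval t p"
  using cuntz_hom_limit[OF cuntz_Cauchy_const[of p]]
  by (simp add: cuntz_of_poly.abs_eq LIMSEQ_const_iff)

lemma cuntz_hom_gen: "cuntz_hom t (cuntz_gen i) = t i"
  by (simp add: cuntz_gen_def cuntz_hom_of_poly poly_eval_gen)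

lemma cuntz_hom_norm_le: "norm (cuntz_hom t x) \<le> norm x"
proof (induction x rule: cuntz.abs_induct)
  case (1 X)
  then have C: "cuntz_Cauchy X" by (rule cuntz_relD)
  show ?case
    by (rule LIMSEQ_le[OF tendsto_norm[OF cuntz_hom_limit[OF C]] tendsto_norm[OF cuntz_limit[OF C]]])
      (simp add: norm_poly_eval_le norm_cuntz_of_poly)
qed

lemma unital_star_hom_cuntz_hom: "unital_star_hom (cuntz_hom t)"
  unfolding unital_star_hom_def
proof (intro conjI allI)
  fix a b :: "'n cuntz" and c :: complex
  obtain X where X: "cuntz_rel X X" "a = abs_cuntz X" by (induction a rule: cuntz.abs_induct) auto
  obtain Y where Y: "cuntz_rel Y Y" "b = abs_cuntz Y" by (induction b rule: cuntz.abs_induct) auto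
  note C = cuntz_relD(1)[OF X(1)] cuntz_relD(1)[OF Y(1)]
  note L = cuntz_hom_limit[OF C(1)] cuntz_hom_limit[OF C(2)]
  show "cuntz_hom t (a + b) = cuntz_hom t a + cuntz_hom t b"
    using LIMSEQ_unique[OF cuntz_hom_limit[OF cuntz_Cauchy_add[OF C], unfolded poly_eval_add]
        tendsto_add[OF L]] by (simp add: X Y plus_cuntz.abs_eq)
  show "cuntz_hom t (a * b) = cuntz_hom t a * cuntz_hom t b"
    using LIMSEQ_unique[OF cuntz_hom_limit[OF cuntz_Cauchy_mult[OF C], unfolded poly_eval_mult]
        tendsto_mult[OF L]] by (simp add: X Y times_cuntz.abs_eq)
  have "bounded_linear ((*\<^sub>C) c :: 'a \<Rightarrow> 'a)"
    by (rule bounded_linear_intro[where K = "cmod c"])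
      (simp_all add: scaleC_add_right norm_scaleC scaleC_scaleC mult.commute flip: scaleC_of_real)
  from bounded_linear.tendsto[OF this L(1)]
  show "cuntz_hom t (c *\<^sub>C a) = c *\<^sub>C cuntz_hom t a"
    using LIMSEQ_unique[OF cuntz_hom_limit[OF cuntz_Cauchy_scale[OF C(1)], unfolded poly_eval_scale]]
    by (simp add: X scaleC_cuntz.abs_eq)
  show "cuntz_hom t 1 = 1"
    using cuntz_hom_of_poly[of 1] by (simp add: poly_eval_one cuntz_of_poly_simps)
  have n: "norm (star x) \<le> norm x" for x :: 'a
  proof (cases "star x = 0")
    case False
    have "(norm (star x))\<^sup>2 \<le> norm x * norm (star x)"
      using norm_mult_ineq[of x "star x"] cstar_identity[of "star x"] by (simp add: star_star)
    with False show ?thesis by (simp add: power2_eq_square)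
  qed simp
  have "bounded_linear (star :: 'a \<Rightarrow> 'a)"
    by (rule bounded_linear_intro[where K = 1])
      (simp_all add: star_add star_scaleC n flip: scaleC_of_real)
  from bounded_linear.tendsto[OF this L(1)]
  show "cuntz_hom t (star a) = star (cuntz_hom t a)"
    using LIMSEQ_unique[OF cuntz_hom_limit[OF cuntz_Cauchy_adj[OF C(1)], unfolded poly_eval_adj]]
    by (simp add: X star_cuntz.abs_eq)
qed

end

text \<open>The C*-algebra \<^typ>\<open>'n cuntz\<close> with the family \<^const>\<open>cuntz_gen\<close> is universal among unital
  C*-algebras with a Cuntz family. (*-homomorphisms of C*-algebras are automatically bounded; the
  assumption in the uniqueness part only avoids the proof of that.)\<close>

theorem cuntz_universal:
  fixes t :: "'n::finite \<Rightarrow> 'a::unital_cstar_algebra"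
  assumes t: "cuntz_family t"
  shows "\<exists>!\<phi>. bounded_linear \<phi> \<and> unital_star_hom \<phi> \<and> (\<forall>i. \<phi> (cuntz_gen i) = t i)"
proof (rule ex1I[of _ "cuntz_hom t"], intro conjI allI)
  note H = unital_star_hom_cuntz_hom[OF t]
  show bl: "bounded_linear (cuntz_hom t)"
    using H cuntz_hom_norm_le[OF t]
    by (intro bounded_linear_intro[where K = 1]) (auto simp: unital_star_hom_def simp flip: scaleC_of_real)
  show "unital_star_hom (cuntz_hom t)" by (rule H)
  show "cuntz_hom t (cuntz_gen i) = t i" for i by (rule cuntz_hom_gen[OF t])
  fix \<phi> :: "'n cuntz \<Rightarrow> 'a"
  assume \<phi>: "bounded_linear \<phi> \<and> unital_star_hom \<phi> \<and> (\<forall>i. \<phi> (cuntz_gen i) = t i)"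
  have "\<phi> (word_val cuntz_gen (Word ls)) = word_val t (Word ls)" for ls
  proof (induction ls)
    case (Cons l ls)
    then show ?case using \<phi> by (cases l) (auto simp: unital_star_hom_def word_val_def)
  qed (use \<phi> in \<open>auto simp: unital_star_hom_def word_val_def\<close>)
  then have w: "\<phi> (word_val cuntz_gen w) = word_val t w" for w by (metis word.exhaust)
  have p: "\<phi> (cuntz_of_poly p) = poly_eval t p" for p
    unfolding cuntz_of_poly_eval[symmetric]
  proof (induction p rule: star_poly_induct)
    case zero
    show ?case using \<phi> by (simp add: linear_0 bounded_linear.linear)
  next
    case (add p v c)
    then show ?case using \<phi> by (simp add: poly_eval_add poly_eval_single unital_star_hom_def w)
  qed
  show "\<phi> = cuntz_hom t"
  proof
    fix x :: "'n cuntz"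
    obtain X where "(\<lambda>n. cuntz_of_poly (X n)) \<longlonglongrightarrow> x" using cuntz_dense by blast
    from bounded_linear.tendsto[OF conjunct1[OF \<phi>] this] bounded_linear.tendsto[OF bl this]
    show "\<phi> x = cuntz_hom t x"
      unfolding p cuntz_hom_of_poly[OF t] by (rule LIMSEQ_unique)
  qed
qed

section \<open>Generalized permutative representations\<close>

definition unital_star_rep :: "('a::unital_cstar_algebra \<Rightarrow> 'h::chilbert_space \<Rightarrow> 'h) \<Rightarrow> bool" where
  "unital_star_rep \<pi> \<longleftrightarrow>
     (\<forall>a. bounded_linear (\<pi> a)) \<and> (\<forall>a c x. \<pi> a (c *\<^sub>C x) = c *\<^sub>C \<pi> a x) \<and>
     (\<forall>a b x. \<pi> (a + b) x = \<pi> a x + \<pi> b x) \<and> (\<forall>c a x. \<pi> (c *\<^sub>C a) x = c *\<^sub>C \<pi> a x) \<and>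
     (\<forall>a b x. \<pi> (a * b) x = \<pi> a (\<pi> b x)) \<and> (\<forall>x. \<pi> 1 x = x) \<and>
     (\<forall>a x y. cinner (\<pi> (star a) x) y = cinner x (\<pi> a y))"

definition unitarily_equivalent ::
    "('a \<Rightarrow> 'h::chilbert_space \<Rightarrow> 'h) \<Rightarrow> ('a \<Rightarrow> 'k::chilbert_space \<Rightarrow> 'k) \<Rightarrow> bool" where
  "unitarily_equivalent \<pi> \<rho> \<longleftrightarrow>
     (\<exists>U :: 'h \<Rightarrow> 'k. (\<forall>x y. U (x + y) = U x + U y) \<and> (\<forall>c x. U (c *\<^sub>C x) = c *\<^sub>C U x) \<and>
        (\<forall>x y. cinner (U x) (U y) = cinner x y) \<and> surj U \<and>
        (\<forall>a x. U (\<pi> a x) = \<rho> a (U x)))"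

text \<open>For a representation the set \<open>range (\<lambda>a. \<pi> a \<Omega>)\<close> is already a linear subspace.\<close>

definition cyclic_vector :: "('a \<Rightarrow> 'h::chilbert_space \<Rightarrow> 'h) \<Rightarrow> 'h \<Rightarrow> bool" where
  "cyclic_vector \<pi> \<Omega> \<longleftrightarrow> closure (range (\<lambda>a. \<pi> a \<Omega>)) = UNIV"

definition orthonormal_family :: "'i set \<Rightarrow> ('i \<Rightarrow> 'h::chilbert_space) \<Rightarrow> bool" where
  "orthonormal_family I e \<longleftrightarrow> (\<forall>i\<in>I. \<forall>j\<in>I. cinner (e i) (e j) = (if i = j then 1 else 0))"

definition cuntz_vec :: "complex ^ 'n \<Rightarrow> 'n::finite cuntz" where
  "cuntz_vec z = (\<Sum>i\<in>UNIV. (z $ i) *\<^sub>C cuntz_gen i)"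

text \<open>An element of the \<open>k\<close>-fold tensor power of \<open>\<complex>\<^sup>N\<close> is encoded by its coefficients in the product
  basis, as a function on multi-indices of length \<open>k\<close>, extended by zero to lists of other lengths.\<close>

definition elementary_tensor :: "(complex ^ 'n::finite) list \<Rightarrow> 'n list \<Rightarrow> complex" where
  "elementary_tensor zs js =
     (if length js = length zs then \<Prod>m<length zs. (zs ! m) $ (js ! m) else 0)"

text \<open>\<open>Chain z\<close> stands for the sequence \<open>(z\<^sup>(\<^sup>n\<^sup>))\<close> with \<open>n = 1, 2, \<dots>\<close>, where \<open>z n\<close> is its member
  number \<open>n + 1\<close>.\<close>

datatype 'n gp_param =
  Tensor "'n list \<Rightarrow> complex"
| Chain "nat \<Rightarrow> complex ^ ('n::finite)"

definition unit_tensors :: "nat \<Rightarrow> ('n::finite list \<Rightarrow> complex) set" where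
  "unit_tensors k = elementary_tensor ` {zs. length zs = k \<and> set zs \<subseteq> sphere 0 1}"

text \<open>The sets \<open>unit_tensors k\<close> are disjoint for different \<open>k\<close>: their members are not zero and vanish
  outside the lists of length \<open>k\<close>.\<close>

definition gp_params :: "'n::finite gp_param set" where
  "gp_params = Tensor ` (\<Union>k\<in>{1..}. unit_tensors k) \<union> Chain ` {z. range z \<subseteq> sphere 0 1}"

text \<open>With \<open>zs = [z\<^sub>1, \<dots>, z\<^sub>k]\<close>, the product over \<open>zs\<close> is \<open>s(z\<^sub>1) \<cdots> s(z\<^sub>k)\<close> and the product over
  \<open>drop i zs\<close> is \<open>s(z\<^sub>i\<^sub>+\<^sub>1) \<cdots> s(z\<^sub>k)\<close>.\<close>

definition gp_cycle ::
    "(complex ^ 'n) list \<Rightarrow> ('n::finite cuntz \<Rightarrow> 'h::chilbert_space \<Rightarrow> 'h) \<Rightarrow> bool" where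
  "gp_cycle zs \<pi> \<longleftrightarrow>
     (\<exists>\<Omega>. norm \<Omega> = 1 \<and> cyclic_vector \<pi> \<Omega> \<and> \<pi> (prod_list (map cuntz_vec zs)) \<Omega> = \<Omega> \<and>
        orthonormal_family {..<length zs} (\<lambda>i. \<pi> (prod_list (map cuntz_vec (drop i zs))) \<Omega>))"

text \<open>The index \<open>n\<close> gives the vector \<open>s(z n)\<^sup>* \<cdots> s(z 0)\<^sup>* \<Omega>\<close>; the vector \<open>\<Omega>\<close> itself is not in the
  family.\<close>

definition gp_chain ::
    "(nat \<Rightarrow> complex ^ 'n) \<Rightarrow> ('n::finite cuntz \<Rightarrow> 'h::chilbert_space \<Rightarrow> 'h) \<Rightarrow> bool" where
  "gp_chain z \<pi> \<longleftrightarrow>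
     (\<exists>\<Omega>. norm \<Omega> = 1 \<and> cyclic_vector \<pi> \<Omega> \<and>
        orthonormal_family UNIV
          (\<lambda>n. \<pi> (prod_list (map (\<lambda>m. star (cuntz_vec (z m))) (rev [0..<Suc n]))) \<Omega>))"

text \<open>The factors of an elementary tensor of unit vectors are determined up to phases with product 1. These
  change the vectors in \<^const>\<open>gp_cycle\<close> by phases only, so the choice of the factors does not matter.\<close>

fun GP :: "'n::finite gp_param \<Rightarrow> ('n cuntz \<Rightarrow> 'h::chilbert_space \<Rightarrow> 'h) \<Rightarrow> bool" where
  "GP (Tensor u) \<pi> \<longleftrightarrow>
     (\<exists>zs. zs \<noteq> [] \<and> set zs \<subseteq> sphere 0 1 \<and> elementary_tensor zs = u \<and> gp_cycle zs \<pi>)"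
| "GP (Chain z) \<pi> \<longleftrightarrow> gp_chain z \<pi>"

end

theory Submission
  imports Defs
begin

text \<open>
  Both halves of the theorem rest on one picture. In a GP representation the vector \<open>\<Omega>\<close> starts a backward
  orbit \<open>e 0 = \<Omega>, e 1, e 2, \<dots>\<close> with \<open>s(z n) e (n + 1) = e n\<close>: in the chain case \<open>e n\<close> is
  \<open>s(z (n - 1))\<^sup>* \<cdots> s(z 0)\<^sup>* \<Omega>\<close>, and in the cycle case the orbit runs around the cycle, with period \<open>k\<close>. Two members
  of the orbit are equal when their indices agree modulo \<open>k\<close> and orthogonal otherwise; since
  \<open>n mod 0 = n\<close>, a chain is a cycle of length \<open>k = 0\<close>, and both cases are treated together as
  \<open>gp_orbit k z \<pi> e\<close>.

  Uniqueness. The relation \<open>s\<^sub>j\<^sup>* s(z) = z\<^sub>j\<close> gives \<open>s\<^sub>J\<^sup>* \<Omega> = c\<^sub>J e\<^sub>|\<^sub>J\<^sub>|\<close>, where \<open>c\<^sub>J\<close> is a product of coordinates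
  of the parameter vectors. Every word in the generators and their adjoints is zero or of the form
  \<open>s\<^sub>J s\<^sub>K\<^sup>*\<close>, so the vector state of \<open>\<Omega>\<close> is determined on words by the inner products of the vectors
  \<open>s\<^sub>J\<^sup>* \<Omega>\<close>, hence by the numbers \<open>cnj c\<^sub>J * c\<^sub>K\<close> with \<open>|J| = |K|\<close> modulo \<open>k\<close>. These depend only on
  the tensor and not on its factors: appending one more letter and summing over it multiplies by
  \<open>\<parallel>z\<parallel>\<^sup>2 = 1\<close>, and when \<open>|J|\<close> has reached a multiple of \<open>k\<close> the number \<open>c\<^sub>J\<close> is a product of coefficients of
  the tensor (\<open>cnj_elementary_tensor_mult_eq\<close>). Representations of C*-algebras are contractive
  (\<open>rep_contractive\<close>), so the state is determined on the whole algebra, and two cyclic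
  representations with the same state are unitarily equivalent
  (\<open>unitarily_equivalent_if_states_eq\<close>).

  Existence. Let maps \<open>f\<^sub>i\<close> of a countable set \<open>X\<close> into itself be injective with ranges that partition
  \<open>X\<close>. Besides \<open>s\<^sub>j e\<^sub>x = e\<^sub>f\<^sub>j\<^sub>(\<^sub>x\<^sub>)\<close>, every choice of unitary matrices \<open>U\<^sub>x\<close> gives a representation
  \<open>s\<^sub>j e\<^sub>x = \<Sum>\<^sub>i (U\<^sub>x)\<^sub>i\<^sub>j e\<^sub>f\<^sub>i\<^sub>(\<^sub>x\<^sub>)\<close>. If \<open>U\<^sub>x\<close> maps the vector \<open>\<zeta> x\<close> to the basis vector number \<open>d\<close>, then
  \<open>s(\<zeta> x) e\<^sub>x = e\<^sub>f\<^sub>d\<^sub>(\<^sub>x\<^sub>)\<close> (\<open>twisted_permutative_rep\<close>). It remains to take maps for which \<open>f\<^sub>d\<close> has a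
  backward orbit of the prescribed period from which every point of \<open>X\<close> is reached, and to let \<open>\<zeta>\<close> be
  the given parameter along it (\<open>ex_branching\<close>). The representation of the Cuntz algebra comes from the
  universal property, applied to the C*-algebra of operators on the Hilbert space.
\<close>

section \<open>Complex Hilbert spaces\<close>

instance chilbert_space \<subseteq> banach ..

lemma scaleC_zero_right: "c *\<^sub>C 0 = (0 :: 'a::complex_vector)"
  using scaleC_add_right[of c "0 :: 'a" 0] by simp

lemma sum_scaleC_left: "(\<Sum>i\<in>I. f i) *\<^sub>C x = (\<Sum>i\<in>I. f i *\<^sub>C (x :: 'a::complex_vector))"
  by (induction I rule: infinite_finite_induct) (simp_all add: scaleC_add_left)

lemma sum_scaleC_right: "c *\<^sub>C (\<Sum>i\<in>I. f i) = (\<Sum>i\<in>I. c *\<^sub>C (f i :: 'a::complex_vector))"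
  by (induction I rule: infinite_finite_induct) (simp_all add: scaleC_add_right scaleC_zero_right)

lemma cinner_add_left: "cinner (x + y) z = cinner x z + cinner y (z :: 'h::chilbert_space)"
  by (metis cinner_add_right cinner_commute complex_cnj_add)

lemma cinner_scaleC_left: "cinner (c *\<^sub>C x) y = cnj c * cinner x (y :: 'h::chilbert_space)"
  by (metis cinner_scaleC_right cinner_commute complex_cnj_mult)

lemma cinner_scaleR_right: "cinner x (r *\<^sub>R y) = complex_of_real r * cinner x (y :: 'h::chilbert_space)"
  by (metis cinner_scaleC_right scaleC_of_real)

lemma cinner_scaleR_left: "cinner (r *\<^sub>R x) y = complex_of_real r * cinner x (y :: 'h::chilbert_space)"
  by (metis cinner_scaleC_left scaleC_of_real complex_cnj_complex_of_real)

lemma cinner_zero_right [simp]: "cinner x 0 = 0"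
  and cinner_zero_left [simp]: "cinner 0 x = (0 :: complex)"
  for x :: "'h::chilbert_space"
  using cinner_scaleR_right[of x 0 x] cinner_scaleR_left[of 0 x x] by simp_all

lemma cinner_diff_right: "cinner x (y - z) = cinner x y - cinner x (z :: 'h::chilbert_space)"
  using cinner_add_right[of x "y - z" z] by simp

lemma cinner_diff_left: "cinner (x - y) z = cinner x z - cinner y (z :: 'h::chilbert_space)"
  using cinner_add_left[of "x - y" y z] by simp

lemma cinner_sum_right: "cinner x (\<Sum>i\<in>I. f i) = (\<Sum>i\<in>I. cinner x (f i :: 'h::chilbert_space))"
  by (induction I rule: infinite_finite_induct) (simp_all add: cinner_add_right)

lemma cinner_self: "cinner x x = complex_of_real ((norm (x :: 'h::chilbert_space))\<^sup>2)"
proof -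
  have "Im (cinner x x) = 0"
    using cinner_commute[of x x] by (simp add: complex_eq_iff)
  then show ?thesis
    by (simp add: complex_eq_iff Re_cinner power2_norm_eq_inner)
qed

lemma norm_scaleC_vec: "norm (c *\<^sub>C x) = cmod c * norm (x :: 'h::chilbert_space)"
proof -
  have "complex_of_real ((norm (c *\<^sub>C x))\<^sup>2) = complex_of_real ((cmod c * norm x)\<^sup>2)"
    unfolding cinner_self[symmetric] cinner_scaleC_left cinner_scaleC_right power_mult_distrib
    by (simp add: cinner_self flip: complex_norm_square)
  then show ?thesis
    by (simp only: of_real_eq_iff) (simp add: power2_eq_iff_nonneg)
qed

lemma norm_cinner_le: "cmod (cinner x y) \<le> norm x * norm (y :: 'h::chilbert_space)"
proof (cases "cinner x y = 0")
  case False
  define u where "u = cnj (sgn (cinner x y))"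
  have u: "cmod u = 1" using False by (simp add: u_def norm_sgn)
  have "cinner x (u *\<^sub>C y) = complex_of_real (cmod (cinner x y))"
    using False by (simp add: u_def cinner_scaleC_right sgn_div_norm field_simps scaleR_conv_of_real
        flip: complex_norm_square) (simp add: complex_norm_square mult.commute power2_eq_square)
  then have "cmod (cinner x y) = inner x (u *\<^sub>C y)"
    by (simp flip: Re_cinner)
  also have "\<dots> \<le> norm x * norm (u *\<^sub>C y)" by (rule norm_cauchy_schwarz)
  finally show ?thesis by (simp add: norm_scaleC_vec u)
qed simp

lemma bounded_bilinear_cinner: "bounded_bilinear (cinner :: 'h::chilbert_space \<Rightarrow> _)"
  by standard (auto simp: cinner_add_left cinner_add_right cinner_scaleR_left cinner_scaleR_right
      scaleR_conv_of_real intro!: exI[of _ 1] norm_cinner_le)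

lemmas tendsto_cinner = bounded_bilinear.tendsto[OF bounded_bilinear_cinner]

lemma bounded_linear_scaleC_vec: "bounded_linear (\<lambda>x :: 'h::chilbert_space. c *\<^sub>C x)"
proof (rule bounded_linear_intro[where K = "cmod c"])
  show "c *\<^sub>C r *\<^sub>R x = r *\<^sub>R c *\<^sub>C x" for r and x :: 'h
    by (simp add: scaleC_scaleC mult.commute flip: scaleC_of_real)
qed (simp_all add: scaleC_add_right norm_scaleC_vec mult.commute)

lemma cinner_ext:
  assumes "\<And>z. cinner x z = cinner y (z :: 'h::chilbert_space)" shows "x = y"
proof -
  have "cinner (x - y) (x - y) = 0" by (simp only: cinner_diff_left assms[of "x - y"]) simp
  then show ?thesis by (simp add: cinner_self)
qed

lemma norm_eq_1_iff_cinner: "norm x = 1 \<longleftrightarrow> cinner x (x :: 'h::chilbert_space) = 1"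
  using power2_eq_iff_nonneg[of "norm x" 1] by (simp add: cinner_self flip: of_real_power)

lemma eq_if_cinner_eq_1:
  assumes "norm x = 1" "norm y = 1" "cinner x (y :: 'h::chilbert_space) = 1" shows "x = y"
proof -
  have "cinner (x - y) (x - y) = cinner x x + cinner y y - cinner x y - cnj (cinner x y)"
    by (simp add: cinner_diff_left cinner_diff_right flip: cinner_commute[of y x])
  also have "\<dots> = 0" using assms by (simp add: cinner_self)
  finally show ?thesis by (simp add: cinner_self)
qed

definition adjoint_of :: "('h::chilbert_space \<Rightarrow> 'h) \<Rightarrow> ('h \<Rightarrow> 'h) \<Rightarrow> bool" where
  "adjoint_of T S \<longleftrightarrow> (\<forall>x y. cinner (S x) y = cinner x (T y))"

lemma adjoint_ofD: "adjoint_of T S \<Longrightarrow> cinner (S x) y = cinner x (T y)"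
  by (simp add: adjoint_of_def)

lemma adjoint_of_sym: "adjoint_of T S \<Longrightarrow> adjoint_of S T"
  unfolding adjoint_of_def by (metis cinner_commute)

lemma adjoint_of_unique: "adjoint_of T S \<Longrightarrow> adjoint_of T S' \<Longrightarrow> S = S'"
  by (rule ext, rule cinner_ext) (simp add: adjoint_of_def)

lemma adjoint_of_scaleC: "adjoint_of T S \<Longrightarrow> S (c *\<^sub>C x) = c *\<^sub>C S x"
  by (rule cinner_ext) (simp add: adjoint_of_def cinner_scaleC_left)

lemma adjoint_of_add: "adjoint_of T S \<Longrightarrow> S (x + y) = S x + S y"
  by (rule cinner_ext) (simp add: adjoint_of_def cinner_add_left)

lemma adjoint_of_norm_le:
  assumes TS: "adjoint_of T S" and K: "\<And>x. norm (T x) \<le> K * norm x"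
  shows "norm (S x) \<le> K * norm x"
proof (cases "S x = 0")
  case True
  have "0 \<le> K * norm x" by (rule order_trans[OF norm_ge_zero K])
  then show ?thesis by (simp add: True)
next
  case False
  have "(norm (S x))\<^sup>2 = cmod (cinner x (T (S x)))"
    by (simp add: cinner_self norm_power flip: adjoint_ofD[OF TS])
  also have "\<dots> \<le> norm x * (K * norm (S x))"
    by (rule order_trans[OF norm_cinner_le mult_left_mono[OF K]]) simp
  finally have "norm (S x) * norm (S x) \<le> K * norm x * norm (S x)" by (simp add: power2_eq_square mult_ac)
  then show ?thesis using False by (simp add: mult_le_cancel_right)
qed

section \<open>Representations of C*-algebras\<close>

text \<open>The Neumann series.\<close>

lemma left_inverse_one_minus:
  fixes a :: "'a::unital_cstar_algebra"
  assumes "norm a < 1" shows "\<exists>b. b * (1 - a) = 1"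
proof -
  have n: "norm (a ^ Suc n) \<le> norm a ^ Suc n" for n
  proof (induction n)
    case (Suc n)
    then show ?case
      by (metis mult_left_mono norm_ge_zero norm_mult_ineq order_trans power_Suc)
  qed simp
  have "summable (\<lambda>n. a ^ Suc n)"
    by (rule summable_comparison_test'[OF _ n])
      (use assms in \<open>simp add: summable_Suc_iff del: power_Suc\<close>)
  then have S: "summable (\<lambda>n. a ^ n)" by (simp only: summable_Suc_iff)
  then have "(\<lambda>n. a ^ n * (1 - a)) sums (suminf (\<lambda>n. a ^ n) * (1 - a))"
    by (intro bounded_linear.sums[OF bounded_linear_mult_left] summable_sums)
  moreover have "(\<lambda>n. a ^ n - a ^ Suc n) sums (a ^ 0 - 0)"
    by (rule telescope_sums') (rule summable_LIMSEQ_zero[OF S])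
  ultimately show ?thesis
    by (intro exI[of _ "suminf (\<lambda>n. a ^ n)"]) (auto simp: right_diff_distrib power_commutes dest: sums_unique2)
qed

context
  fixes \<pi> :: "'a::unital_cstar_algebra \<Rightarrow> 'h::chilbert_space \<Rightarrow> 'h"
  assumes \<pi>: "unital_star_rep \<pi>"
begin

lemma unital_star_repD:
  shows "bounded_linear (\<pi> a)" "\<pi> a (c *\<^sub>C x) = c *\<^sub>C \<pi> a x"
    "\<pi> (a + b) x = \<pi> a x + \<pi> b x" "\<pi> (c *\<^sub>C a) x = c *\<^sub>C \<pi> a x"
    "\<pi> (a * b) x = \<pi> a (\<pi> b x)" "\<pi> 1 x = x" "cinner (\<pi> (star a) x) y = cinner x (\<pi> a y)"
  using \<pi> unfolding unital_star_rep_def by blast+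

lemmas rep_add = unital_star_repD(3) and rep_scaleC = unital_star_repD(4)
  and rep_mult = unital_star_repD(5) and rep_one = unital_star_repD(6)
  and rep_star = unital_star_repD(7) and rep_vec_scaleC = unital_star_repD(2)
  and rep_bounded = unital_star_repD(1)

lemma rep_star_right: "cinner x (\<pi> (star a) y) = cinner (\<pi> a x) y"
  by (metis rep_star cinner_commute)

lemma rep_scaleR: "\<pi> (r *\<^sub>R a) x = r *\<^sub>R \<pi> a x"
  by (simp add: rep_scaleC flip: scaleC_of_real)

lemma rep_zero: "\<pi> 0 x = 0"
  using rep_scaleR[of 0 0 x] by simp

lemma rep_diff: "\<pi> (a - b) x = \<pi> a x - \<pi> b x"
  using rep_add[of "a - b" b x] by simp

lemma rep_sum: "\<pi> (\<Sum>i\<in>I. f i) x = (\<Sum>i\<in>I. \<pi> (f i) x)"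
  by (induction I rule: infinite_finite_induct) (simp_all add: rep_add rep_zero)

text \<open>Let \<open>T = \<pi> a\<close> have norm \<open>K > \<parallel>a\<parallel>\<close>. The norm of \<open>T\<close> is almost attained at unit vectors \<open>y\<close>, for which
  \<open>y - T\<^sup>*T y / K\<^sup>2\<close> is almost zero. But \<open>\<parallel>a\<^sup>*a / K\<^sup>2\<parallel> < 1\<close>, so \<open>1 - a\<^sup>*a / K\<^sup>2\<close> has a left inverse in the
  algebra, and its image is bounded below.\<close>

lemma rep_contractive: "norm (\<pi> a x) \<le> norm a * norm x"
proof -
  define K where "K = onorm (\<pi> a)"
  have K: "norm (\<pi> a y) \<le> K * norm y" for y
    unfolding K_def by (rule onorm[OF rep_bounded])
  have "K \<le> norm a"
  proof (rule ccontr)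
    assume "\<not> K \<le> norm a"
    then have less: "norm a < K" by simp
    then have pos: "0 < K" using norm_ge_zero[of a] by linarith
    define c where "c = (1 / K\<^sup>2) *\<^sub>R (star a * a)"
    have "norm c = (norm a)\<^sup>2 / K\<^sup>2" by (simp add: c_def cstar_identity)
    also have "\<dots> < 1" using less pos by (simp add: power_strict_mono)
    finally obtain b where b: "b * (1 - c) = 1" using left_inverse_one_minus by blast
    obtain B where B: "0 < B" "\<And>y. norm (\<pi> b y) \<le> norm y * B"
      using bounded_linear.pos_bounded[OF rep_bounded[of b]] by blast
    have "adjoint_of (\<pi> a) (\<pi> (star a))" by (simp add: adjoint_of_def rep_star)
    note adj = adjoint_of_norm_le[OF this K]
    have low: "(norm y)\<^sup>2 \<le> B\<^sup>2 * ((norm y)\<^sup>2 - (norm (\<pi> a y))\<^sup>2 / K\<^sup>2)" for y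
    proof -
      let ?s = "\<pi> (star a * a) y"
      have s: "inner y ?s = (norm (\<pi> a y))\<^sup>2"
        by (simp add: rep_mult rep_star_right cinner_self flip: Re_cinner)
      have "norm ?s \<le> K * norm (\<pi> a y)" by (simp add: rep_mult adj)
      then have "(norm ?s)\<^sup>2 \<le> K\<^sup>2 * (norm (\<pi> a y))\<^sup>2"
        using power_mono[of "norm ?s" "K * norm (\<pi> a y)" 2] by (simp add: power_mult_distrib)
      then have t: "(norm ?s)\<^sup>2 / K ^ 4 \<le> (norm (\<pi> a y))\<^sup>2 / K\<^sup>2"
        using pos by (simp add: field_simps power4_eq_xxxx power2_eq_square)
      have "y = \<pi> b (y - (1 / K\<^sup>2) *\<^sub>R ?s)"
        using rep_mult[of b "1 - c" y] rep_scaleR[of "1 / K\<^sup>2" "star a * a" y]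
        by (simp add: b rep_diff rep_one flip: c_def)
      then have "norm y \<le> B * norm (y - (1 / K\<^sup>2) *\<^sub>R ?s)" using B(2) by (metis mult.commute)
      then have "(norm y)\<^sup>2 \<le> B\<^sup>2 * (norm (y - (1 / K\<^sup>2) *\<^sub>R ?s))\<^sup>2"
        using power_mono[of "norm y" "B * norm (y - (1 / K\<^sup>2) *\<^sub>R ?s)" 2] by (simp add: power_mult_distrib)
      also have "(norm (y - (1 / K\<^sup>2) *\<^sub>R ?s))\<^sup>2 = (norm y)\<^sup>2 - 2 * (norm (\<pi> a y))\<^sup>2 / K\<^sup>2 + (norm ?s)\<^sup>2 / K ^ 4"
        unfolding power2_norm_eq_inner[of "y - _"] inner_diff_left inner_diff_right
        by (simp add: s inner_commute[of ?s y] power4_eq_xxxx power2_eq_square mult.assoc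
            flip: power2_norm_eq_inner)
      also have "\<dots> \<le> (norm y)\<^sup>2 - (norm (\<pi> a y))\<^sup>2 / K\<^sup>2" using t by simp
      finally show ?thesis by (simp add: mult_left_mono)
    qed
    \<comment> \<open>Since the bound is below 1 uniformly in \<open>y\<close>, the norm of \<open>\<pi> a\<close> is smaller than \<open>K\<close>.\<close>
    define q where "q = max 0 (1 - 1 / B\<^sup>2)"
    have q: "0 \<le> q" "q < 1" using B(1) by (auto simp: q_def)
    have up: "norm (\<pi> a y) \<le> K * sqrt q * norm y" for y
    proof -
      have "(norm (\<pi> a y))\<^sup>2 \<le> K\<^sup>2 * ((1 - 1 / B\<^sup>2) * (norm y)\<^sup>2)"
        using low[of y] pos B(1) by (simp add: field_simps)
      also have "\<dots> \<le> K\<^sup>2 * (q * (norm y)\<^sup>2)"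
        by (intro mult_left_mono mult_right_mono) (auto simp: q_def)
      also have "\<dots> = (K * sqrt q * norm y)\<^sup>2" using q by (simp add: power_mult_distrib)
      finally show ?thesis using pos q by (auto intro: power2_le_imp_le)
    qed
    have "onorm (\<pi> a) \<le> K * sqrt q" using q pos by (intro onorm_bound up) auto
    then have "K * 1 \<le> K * sqrt q" by (simp add: K_def)
    then show False using pos q by simp
  qed
  then have "K * norm x \<le> norm a * norm x" by (intro mult_right_mono) auto
  with K[of x] show ?thesis by linarith
qed

lemma rep_tendsto:
  assumes "X \<longlonglongrightarrow> a" shows "(\<lambda>n. \<pi> (X n) x) \<longlonglongrightarrow> \<pi> a x"
proof -
  have "(\<lambda>n. norm (X n - a) * norm x) \<longlonglongrightarrow> 0"
    using assms by (intro tendsto_mult_left_zero tendsto_norm_zero) (simp add: LIM_zero)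
  then have "(\<lambda>n. \<pi> (X n) x - \<pi> a x) \<longlonglongrightarrow> 0"
    by (rule Lim_null_comparison[rotated]) (simp add: rep_contractive flip: rep_diff)
  then show ?thesis by (simp add: LIM_zero_iff)
qed

end

text \<open>The uniqueness part of the GNS construction: the state fixes all inner products of the vectors \<open>\<pi> a v\<close>,
  so \<open>\<pi> a v \<mapsto> \<rho> a w\<close> is isometric between dense subspaces and extends to a unitary \<open>U\<close>. The value \<open>U x\<close>
  is defined through one approximating sequence \<open>A x\<close>; the fact \<open>lim\<close> says that every other
  approximating sequence gives the same value, and all properties of \<open>U\<close> follow from it.\<close>

theorem unitarily_equivalent_if_states_eq:
  fixes \<pi> :: "'a::unital_cstar_algebra \<Rightarrow> 'h::chilbert_space \<Rightarrow> 'h"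
    and \<rho> :: "'a \<Rightarrow> 'k::chilbert_space \<Rightarrow> 'k"
  assumes \<pi>: "unital_star_rep \<pi>" and \<rho>: "unital_star_rep \<rho>"
    and v: "cyclic_vector \<pi> v" and w: "cyclic_vector \<rho> w"
    and state: "\<And>a. cinner v (\<pi> a v) = cinner w (\<rho> a w)"
  shows "unitarily_equivalent \<pi> \<rho>"
proof -
  have ip: "cinner (\<pi> a v) (\<pi> b v) = cinner (\<rho> a w) (\<rho> b w)" for a b
    using state[of "star a * b"]
    by (simp add: rep_mult[OF \<pi>] rep_mult[OF \<rho>] rep_star_right[OF \<pi>] rep_star_right[OF \<rho>])
  have "norm (\<pi> a v) = norm (\<rho> a w)" for a
    using ip[of a a] unfolding cinner_self of_real_eq_iff by simp
  then have iso: "norm (\<pi> a v - \<pi> b v) = norm (\<rho> a w - \<rho> b w)" for a b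
    by (simp flip: rep_diff[OF \<pi>] rep_diff[OF \<rho>])
  have Cauchy_iff_iso: "Cauchy (\<lambda>n. \<pi> (X n) v) \<longleftrightarrow> Cauchy (\<lambda>n. \<rho> (X n) w)" for X
    by (simp add: Cauchy_iff iso)
  have "\<exists>X. (\<lambda>n. \<pi> (X n) v) \<longlonglongrightarrow> x" for x
  proof -
    have "x \<in> closure (range (\<lambda>a. \<pi> a v))" using v by (simp add: cyclic_vector_def)
    then obtain y where y: "\<And>n. y n \<in> range (\<lambda>a. \<pi> a v)" "y \<longlonglongrightarrow> x"
      unfolding closure_sequential by blast
    from y(1) have "\<forall>n. \<exists>a. y n = \<pi> a v" by blast
    then obtain X where "y = (\<lambda>n. \<pi> (X n) v)" by metis
    with y(2) show ?thesis by blast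
  qed
  then obtain A where A: "\<And>x. (\<lambda>n. \<pi> (A x n) v) \<longlonglongrightarrow> x" by metis
  define U where "U x = lim (\<lambda>n. \<rho> (A x n) w)" for x
  have lim: "(\<lambda>n. \<rho> (X n) w) \<longlonglongrightarrow> U x" if X: "(\<lambda>n. \<pi> (X n) v) \<longlonglongrightarrow> x" for X x
  proof -
    have "convergent (\<lambda>n. \<rho> (A x n) w)"
      using LIMSEQ_imp_Cauchy[OF A[of x]] Cauchy_iff_iso by (intro Cauchy_convergent) simp
    then have U: "(\<lambda>n. \<rho> (A x n) w) \<longlonglongrightarrow> U x" by (simp add: U_def convergent_LIMSEQ_iff)
    have "(\<lambda>n. norm (\<pi> (X n) v - \<pi> (A x n) v)) \<longlonglongrightarrow> norm (x - x)"
      by (intro tendsto_intros X A)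
    then have "(\<lambda>n. norm (\<rho> (X n) w - \<rho> (A x n) w)) \<longlonglongrightarrow> 0"
      unfolding iso by simp
    then have "(\<lambda>n. \<rho> (X n) w - \<rho> (A x n) w) \<longlonglongrightarrow> 0"
      by (rule tendsto_norm_zero_cancel)
    from tendsto_add[OF this U] show ?thesis by simp
  qed
  have "U (x + y) = U x + U y" for x y
  proof (rule LIMSEQ_unique)
    show "(\<lambda>n. \<rho> (A x n + A y n) w) \<longlonglongrightarrow> U (x + y)"
      by (intro lim) (simp add: rep_add[OF \<pi>] tendsto_add A)
    show "(\<lambda>n. \<rho> (A x n + A y n) w) \<longlonglongrightarrow> U x + U y"
      unfolding rep_add[OF \<rho>] by (intro tendsto_add lim A)
  qed
  moreover have "U (c *\<^sub>C x) = c *\<^sub>C U x" for c x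
  proof (rule LIMSEQ_unique)
    show "(\<lambda>n. \<rho> (c *\<^sub>C A x n) w) \<longlonglongrightarrow> U (c *\<^sub>C x)"
      by (intro lim)
        (simp add: rep_scaleC[OF \<pi>] bounded_linear.tendsto[OF bounded_linear_scaleC_vec] A)
    show "(\<lambda>n. \<rho> (c *\<^sub>C A x n) w) \<longlonglongrightarrow> c *\<^sub>C U x"
      unfolding rep_scaleC[OF \<rho>] by (intro bounded_linear.tendsto[OF bounded_linear_scaleC_vec] lim A)
  qed
  moreover have "cinner (U x) (U y) = cinner x y" for x y
  proof (rule LIMSEQ_unique)
    show "(\<lambda>n. cinner (\<rho> (A x n) w) (\<rho> (A y n) w)) \<longlonglongrightarrow> cinner (U x) (U y)"
      by (intro tendsto_cinner lim A)
    show "(\<lambda>n. cinner (\<rho> (A x n) w) (\<rho> (A y n) w)) \<longlonglongrightarrow> cinner x y"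
      unfolding ip[symmetric] by (intro tendsto_cinner A)
  qed
  moreover have "surj U"
  proof -
    have "y \<in> range U" for y
    proof -
      have "y \<in> closure (range (\<lambda>a. \<rho> a w))" using w by (simp add: cyclic_vector_def)
      then obtain u where u: "\<And>n. u n \<in> range (\<lambda>a. \<rho> a w)" "u \<longlonglongrightarrow> y"
        unfolding closure_sequential by blast
      from u(1) have "\<forall>n. \<exists>a. u n = \<rho> a w" by blast
      then obtain X where X: "u = (\<lambda>n. \<rho> (X n) w)" by metis
      have "convergent (\<lambda>n. \<pi> (X n) v)"
        using LIMSEQ_imp_Cauchy[OF u(2)] Cauchy_iff_iso unfolding X by (intro Cauchy_convergent) simp
      then obtain x where "(\<lambda>n. \<pi> (X n) v) \<longlonglongrightarrow> x" unfolding convergent_def by blast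
      from LIMSEQ_unique[OF lim[OF this]] u(2) show ?thesis unfolding X by blast
    qed
    then show ?thesis by blast
  qed
  moreover have "U (\<pi> a x) = \<rho> a (U x)" for a x
  proof (rule LIMSEQ_unique)
    show "(\<lambda>n. \<rho> (a * A x n) w) \<longlonglongrightarrow> U (\<pi> a x)"
      by (intro lim) (simp add: rep_mult[OF \<pi>] bounded_linear.tendsto[OF rep_bounded[OF \<pi>]] A)
    show "(\<lambda>n. \<rho> (a * A x n) w) \<longlonglongrightarrow> \<rho> a (U x)"
      unfolding rep_mult[OF \<rho>] by (intro bounded_linear.tendsto[OF rep_bounded[OF \<rho>]] lim A)
  qed
  ultimately show ?thesis unfolding unitarily_equivalent_def by blast
qed

section \<open>Words in the generators of the Cuntz algebra\<close>

lemma star_sum: "star (\<Sum>i\<in>I. f i) = (\<Sum>i\<in>I. star (f i :: 'a::unital_cstar_algebra))"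
  by (induction I rule: infinite_finite_induct) (simp_all add: star_add)

lemma star_gen_mult_gen: "star (cuntz_gen i) * cuntz_gen j = (if i = j then 1 else 0)"
  using cuntz_family_cuntz_gen unfolding cuntz_family_def by blast

lemma star_gen_mult_vec: "star (cuntz_gen i) * cuntz_vec z = (z $ i) *\<^sub>C 1"
proof -
  have "star (cuntz_gen i) * cuntz_vec z = (\<Sum>j\<in>UNIV. if j = i then (z $ i) *\<^sub>C 1 else 0)"
    unfolding cuntz_vec_def sum_distrib_left mult_scaleC_right star_gen_mult_gen
    by (intro sum.cong) (auto simp: scaleC_zero_right)
  then show ?thesis by simp
qed

lemma sum_norm_sq_unit:
  fixes z :: "complex ^ 'n::finite"
  assumes "norm z = 1" shows "(\<Sum>i\<in>UNIV. cnj (z $ i) * z $ i) = 1"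
proof -
  have "(\<Sum>i\<in>UNIV. (cmod (z $ i))\<^sup>2) = 1"
    using assms by (simp add: norm_vec_def L2_set_def real_sqrt_eq_1_iff)
  then have "complex_of_real (\<Sum>i\<in>UNIV. (cmod (z $ i))\<^sup>2) = 1" by simp
  then show ?thesis by (simp only: of_real_sum complex_norm_square mult.commute[of "cnj _"])
qed

lemma star_vec_mult_vec:
  "star (cuntz_vec y) * cuntz_vec z = (\<Sum>i\<in>UNIV. cnj (y $ i) * z $ i) *\<^sub>C 1"
  unfolding cuntz_vec_def[of y] star_sum sum_distrib_right star_scaleC mult_scaleC_left star_gen_mult_vec
  by (simp add: scaleC_scaleC sum_scaleC_left)

lemma star_vec_mult_vec_unit: "norm z = 1 \<Longrightarrow> star (cuntz_vec z) * cuntz_vec z = 1"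
  by (simp add: star_vec_mult_vec sum_norm_sq_unit)

definition gen_word :: "'n::finite list \<Rightarrow> 'n cuntz" where
  "gen_word J = prod_list (map cuntz_gen J)"

lemma gen_word_simps: "gen_word [] = 1" "gen_word (j # J) = cuntz_gen j * gen_word J"
  "gen_word (J @ K) = gen_word J * gen_word K"
  by (simp_all add: gen_word_def)

text \<open>Reading a word from the right, each letter \<open>s\<^sub>i\<^sup>*\<close> either cancels against the first letter of \<open>J\<close>, or
  annihilates the word, or, when \<open>J\<close> is empty, joins \<open>K\<close>.\<close>

lemma word_val_cuntz_gen_cases:
  "word_val cuntz_gen w = 0 \<or> (\<exists>J K. word_val cuntz_gen w = gen_word J * star (gen_word K))"
proof -
  have "word_val cuntz_gen (Word ls) = 0 \<or>
    (\<exists>J K. word_val cuntz_gen (Word ls) = gen_word J * star (gen_word K))" for ls :: "'a letter list"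
  proof (induction ls)
    case Nil
    have "word_val cuntz_gen (Word []) = gen_word [] * star (gen_word [] :: 'a cuntz)"
      by (simp add: word_val_def gen_word_simps)
    then show ?case by blast
  next
    case (Cons l ls)
    have step: "word_val cuntz_gen (Word (l # ls)) = letter_val cuntz_gen l * word_val cuntz_gen (Word ls)"
      by (simp add: word_val_def)
    show ?case
    proof (cases "word_val cuntz_gen (Word ls) = 0")
      case False
      with Cons obtain J K where JK: "word_val cuntz_gen (Word ls) = gen_word J * star (gen_word K)" by blast
      show ?thesis
      proof (cases l)
        case (Gen i)
        have "word_val cuntz_gen (Word (l # ls)) = gen_word (i # J) * star (gen_word K)"
          unfolding step JK by (simp add: Gen gen_word_simps mult.assoc)
        then show ?thesis by blast
      next
        case (Adj i)
        show ?thesis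
        proof (cases J)
          case Nil
          have "word_val cuntz_gen (Word (l # ls)) = gen_word [] * star (gen_word (K @ [i]))"
            unfolding step JK by (simp add: Adj Nil gen_word_simps star_mult)
          then show ?thesis by blast
        next
          case (Cons j J')
          have "word_val cuntz_gen (Word (l # ls))
            = (star (cuntz_gen i) * cuntz_gen j) * (gen_word J' * star (gen_word K))"
            unfolding step JK by (simp add: Adj Cons gen_word_simps mult.assoc)
          then show ?thesis by (auto simp: star_gen_mult_gen split: if_splits)
        qed
      qed
    qed (simp add: step)
  qed
  from this[of "letters w"] show ?thesis by simp
qed

text \<open>The state of \<open>s\<^sub>J s\<^sub>K\<^sup>*\<close> is the inner product of \<open>s\<^sub>J\<^sup>* v\<close> and \<open>s\<^sub>K\<^sup>* v\<close>. By linearity and continuity these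
  numbers determine the whole state.\<close>

theorem unitarily_equivalent_if_gram_eq:
  fixes \<pi> :: "'n::finite cuntz \<Rightarrow> 'h::chilbert_space \<Rightarrow> 'h" and \<rho> :: "'n cuntz \<Rightarrow> 'k::chilbert_space \<Rightarrow> 'k"
  assumes \<pi>: "unital_star_rep \<pi>" and \<rho>: "unital_star_rep \<rho>"
    and v: "cyclic_vector \<pi> v" and w: "cyclic_vector \<rho> w"
    and gram: "\<And>J K. cinner (\<pi> (star (gen_word J)) v) (\<pi> (star (gen_word K)) v)
      = cinner (\<rho> (star (gen_word J)) w) (\<rho> (star (gen_word K)) w)"
  shows "unitarily_equivalent \<pi> \<rho>"
proof (rule unitarily_equivalent_if_states_eq[OF \<pi> \<rho> v w])
  have word: "cinner v (\<pi> (word_val cuntz_gen u) v) = cinner w (\<rho> (word_val cuntz_gen u) w)" for u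
  proof (cases "word_val cuntz_gen u = 0")
    case False
    then obtain J K where JK: "word_val cuntz_gen u = gen_word J * star (gen_word K)"
      using word_val_cuntz_gen_cases by blast
    show ?thesis
      using gram[of J K] by (simp add: JK rep_mult[OF \<pi>] rep_mult[OF \<rho>] rep_star[OF \<pi>] rep_star[OF \<rho>])
  qed (simp add: rep_zero[OF \<pi>] rep_zero[OF \<rho>])
  have poly: "cinner v (\<pi> (cuntz_of_poly p) v) = cinner w (\<rho> (cuntz_of_poly p) w)" for p
    unfolding cuntz_of_poly_eval[symmetric]
    by (induction p rule: star_poly_induct)
      (simp_all add: rep_zero[OF \<pi>] rep_zero[OF \<rho>] poly_eval_add poly_eval_single rep_add[OF \<pi>] rep_add[OF \<rho>]
        rep_scaleC[OF \<pi>] rep_scaleC[OF \<rho>] cinner_add_right cinner_scaleC_right word)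
  fix a :: "'n cuntz"
  obtain X where X: "(\<lambda>n. cuntz_of_poly (X n)) \<longlonglongrightarrow> a" using cuntz_dense by blast
  have "(\<lambda>n. cinner v (\<pi> (cuntz_of_poly (X n)) v)) \<longlonglongrightarrow> cinner v (\<pi> a v)"
    "(\<lambda>n. cinner w (\<rho> (cuntz_of_poly (X n)) w)) \<longlonglongrightarrow> cinner w (\<rho> a w)"
    by (intro tendsto_cinner tendsto_const rep_tendsto[OF \<pi>] rep_tendsto[OF \<rho>] X)+
  then show "cinner v (\<pi> a v) = cinner w (\<rho> a w)"
    unfolding poly by (rule LIMSEQ_unique)
qed

section \<open>Backward orbits\<close>

text \<open>The common form of the conditions for cycles and chains. For \<open>k > 0\<close> it forces \<open>e (n + k) = e n\<close>; for
  \<open>k = 0\<close>, where \<open>n mod k = n\<close>, the whole sequence is orthonormal.\<close>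

definition gp_orbit :: "nat \<Rightarrow> (nat \<Rightarrow> complex ^ 'n) \<Rightarrow> ('n::finite cuntz \<Rightarrow> 'h::chilbert_space \<Rightarrow> 'h)
    \<Rightarrow> (nat \<Rightarrow> 'h) \<Rightarrow> bool" where
  "gp_orbit k z \<pi> e \<longleftrightarrow> cyclic_vector \<pi> (e 0) \<and> (\<forall>n. \<pi> (cuntz_vec (z n)) (e (Suc n)) = e n) \<and>
     (\<forall>m n. cinner (e m) (e n) = (if m mod k = n mod k then 1 else 0))"

lemma gp_orbitD:
  assumes "gp_orbit k z \<pi> e"
  shows "cyclic_vector \<pi> (e 0)" "\<pi> (cuntz_vec (z n)) (e (Suc n)) = e n"
    "cinner (e m) (e n) = (if m mod k = n mod k then 1 else 0)" "norm (e n) = 1"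
proof -
  show *: "cinner (e m) (e n) = (if m mod k = n mod k then 1 else 0)" for m n
    using assms by (simp add: gp_orbit_def)
  show "norm (e n) = 1" using *[of n n] by (simp add: norm_eq_1_iff_cinner)
qed (use assms in \<open>simp_all add: gp_orbit_def\<close>)

text \<open>The family in the definition of a chain starts with \<open>e 1\<close>; two facts about \<open>e 0 = \<Omega>\<close> have to be
  derived. The adjoint of an isometry does not lengthen vectors, and here the norm stays 1, so \<open>e n\<close> lies in the
  range of \<open>s(z n)\<close> and \<open>s(z n) e (n + 1) = e n\<close>. Consequently \<open>\<langle>e 0, e n\<rangle>\<close> with \<open>n > 0\<close> is a multiple of
  \<open>\<langle>e 1, e (n + 1)\<rangle> = 0\<close>.\<close>

lemma gp_chain_imp_gp_orbit:
  assumes \<pi>: "unital_star_rep \<pi>" and z: "\<And>n. norm (z n) = 1" and "gp_chain z \<pi>"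
  shows "\<exists>e. gp_orbit 0 z \<pi> e"
proof -
  obtain \<Omega> where \<Omega>: "norm \<Omega> = 1" "cyclic_vector \<pi> \<Omega>"
    and ON: "orthonormal_family UNIV
          (\<lambda>n. \<pi> (prod_list (map (\<lambda>m. star (cuntz_vec (z m))) (rev [0..<Suc n]))) \<Omega>)"
    using assms(3) unfolding gp_chain_def by blast
  define e where "e n = \<pi> (prod_list (map (\<lambda>m. star (cuntz_vec (z m))) (rev [0..<n]))) \<Omega>" for n
  have e0: "e 0 = \<Omega>" by (simp add: e_def rep_one[OF \<pi>])
  have down: "e (Suc n) = \<pi> (star (cuntz_vec (z n))) (e n)" for n
    by (simp add: e_def rep_mult[OF \<pi>])
  have on: "cinner (e (Suc m)) (e (Suc n)) = (if m = n then 1 else 0)" for m n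
    using ON unfolding orthonormal_family_def e_def by blast
  have norm: "norm (e n) = 1" for n
  proof (cases n)
    case (Suc m)
    then show ?thesis using on[of m m] by (simp add: norm_eq_1_iff_cinner)
  qed (simp add: e0 \<Omega>)
  have up: "\<pi> (cuntz_vec (z n)) (e (Suc n)) = e n" for n
  proof (rule eq_if_cinner_eq_1)
    have "cinner (\<pi> (cuntz_vec (z n)) (e (Suc n))) (\<pi> (cuntz_vec (z n)) (e (Suc n))) = 1"
      using on[of n n] unfolding rep_star_right[OF \<pi>, symmetric] rep_mult[OF \<pi>, symmetric]
      by (simp add: star_vec_mult_vec_unit[OF z] rep_one[OF \<pi>])
    then show "norm (\<pi> (cuntz_vec (z n)) (e (Suc n))) = 1"
      by (simp add: norm_eq_1_iff_cinner)
    show "cinner (\<pi> (cuntz_vec (z n)) (e (Suc n))) (e n) = 1"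
      using on[of n n] unfolding rep_star_right[OF \<pi>, symmetric] down[symmetric] by simp
  qed (rule norm)
  have "cinner (e 0) (e (Suc n)) = 0" for n
  proof -
    have "cinner (e 0) (e (Suc n))
      = cinner (e (Suc 0)) (\<pi> (star (cuntz_vec (z 0)) * cuntz_vec (z (Suc n))) (e (Suc (Suc n))))"
      by (simp only: rep_mult[OF \<pi>] rep_star_right[OF \<pi>] up)
    also have "\<dots> = 0"
      by (simp add: star_vec_mult_vec rep_scaleC[OF \<pi>] rep_one[OF \<pi>] cinner_scaleC_right on)
    finally show ?thesis .
  qed
  moreover from this have "cinner (e (Suc n)) (e 0) = 0" for n
    by (metis cinner_commute complex_cnj_zero)
  moreover have "cinner (e 0) (e 0) = 1" by (simp add: cinner_self norm)
  ultimately have "cinner (e m) (e n) = (if m = n then 1 else 0)" for m n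
    using on by (cases m; cases n) auto
  then show ?thesis
    using \<Omega> up by (intro exI[of _ e]) (simp add: gp_orbit_def e0)
qed

lemma gp_orbit_imp_gp_chain:
  assumes \<pi>: "unital_star_rep \<pi>" and z: "\<And>n. norm (z n) = 1" and e: "gp_orbit 0 z \<pi> e"
  shows "gp_chain z \<pi>"
proof -
  have "\<pi> (prod_list (map (\<lambda>m. star (cuntz_vec (z m))) (rev [0..<n]))) (e 0) = e n" for n
  proof (induction n)
    case (Suc n)
    have "\<pi> (star (cuntz_vec (z n))) (e n) = \<pi> (star (cuntz_vec (z n)) * cuntz_vec (z n)) (e (Suc n))"
      by (simp add: rep_mult[OF \<pi>] gp_orbitD(2)[OF e])
    then show ?case
      by (simp add: Suc rep_mult[OF \<pi>] star_vec_mult_vec_unit[OF z] rep_one[OF \<pi>])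
  qed (simp add: rep_one[OF \<pi>])
  then show ?thesis
    unfolding gp_chain_def orthonormal_family_def
    by (intro exI[of _ "e 0"]) (simp add: gp_orbitD[OF e] del: upt_Suc)
qed

lemma gp_cycle_imp_gp_orbit:
  assumes \<pi>: "unital_star_rep \<pi>" and zs: "zs \<noteq> []" and "gp_cycle zs \<pi>"
  shows "\<exists>e. gp_orbit (length zs) (\<lambda>n. zs ! (n mod length zs)) \<pi> e"
proof -
  let ?k = "length zs"
  obtain \<Omega> where \<Omega>: "cyclic_vector \<pi> \<Omega>" "\<pi> (prod_list (map cuntz_vec zs)) \<Omega> = \<Omega>"
    and ON: "orthonormal_family {..<?k} (\<lambda>i. \<pi> (prod_list (map cuntz_vec (drop i zs))) \<Omega>)"
    using assms(3) unfolding gp_cycle_def by blast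
  define e where "e n = \<pi> (prod_list (map cuntz_vec (drop (n mod ?k) zs))) \<Omega>" for n
  have e0: "e 0 = \<Omega>" by (simp add: e_def \<Omega>)
  have less: "n mod ?k < ?k" for n using zs by simp
  have up: "\<pi> (cuntz_vec (zs ! (n mod ?k))) (e (Suc n)) = e n" for n
  proof -
    have drop: "drop (n mod ?k) zs = zs ! (n mod ?k) # drop (Suc (n mod ?k)) zs"
      using less by (rule Cons_nth_drop_Suc[symmetric])
    have "e (Suc n) = \<pi> (prod_list (map cuntz_vec (drop (Suc (n mod ?k)) zs))) \<Omega>"
      by (simp add: e_def mod_Suc \<Omega> rep_one[OF \<pi>])
    then show ?thesis by (simp add: e_def[of n] drop rep_mult[OF \<pi>])
  qed
  have "cinner (e m) (e n) = (if m mod ?k = n mod ?k then 1 else 0)" for m n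
    using ON less unfolding orthonormal_family_def e_def by blast
  with up \<Omega> show ?thesis
    by (intro exI[of _ e]) (simp add: gp_orbit_def e0)
qed

lemma gp_orbit_imp_gp_cycle:
  assumes \<pi>: "unital_star_rep \<pi>" and e: "gp_orbit (length zs) (\<lambda>n. zs ! (n mod length zs)) \<pi> e"
  shows "gp_cycle zs \<pi>"
proof -
  let ?k = "length zs"
  have ek: "e ?k = e 0"
    by (rule eq_if_cinner_eq_1) (simp_all add: gp_orbitD[OF e])
  have val: "\<pi> (prod_list (map cuntz_vec (drop i zs))) (e 0) = e i" if "i \<le> ?k" for i
    using that
  proof (induction i rule: inc_induct)
    case base
    then show ?case by (simp add: ek rep_one[OF \<pi>])
  next
    case (step i)
    have "drop i zs = zs ! i # drop (Suc i) zs"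
      using step by (simp add: Cons_nth_drop_Suc)
    then show ?case
      using step gp_orbitD(2)[OF e, of i] by (simp add: rep_mult[OF \<pi>])
  qed
  show ?thesis
    unfolding gp_cycle_def orthonormal_family_def
    using val[of 0] by (intro exI[of _ "e 0"]) (simp add: gp_orbitD[OF e] val)
qed

section \<open>Uniqueness\<close>

lemma elementary_tensor_Nil [simp]: "elementary_tensor [] [] = 1"
  by (simp add: elementary_tensor_def)

lemma elementary_tensor_Cons [simp]:
  "elementary_tensor (z # zs) (j # J) = z $ j * elementary_tensor zs J"
  by (simp add: elementary_tensor_def prod.lessThan_Suc_shift del: prod.lessThan_Suc)

lemma elementary_tensor_append:
  "length zs = length J \<Longrightarrow>
    elementary_tensor (zs @ ys) (J @ K) = elementary_tensor zs J * elementary_tensor ys K"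
  by (induction zs J rule: list_induct2) simp_all

lemma star_gen_word_gp_orbit:
  assumes \<pi>: "unital_star_rep \<pi>" and e: "gp_orbit k z \<pi> e"
  shows "\<pi> (star (gen_word J)) (e n)
    = elementary_tensor (map z [n..<n + length J]) J *\<^sub>C e (n + length J)"
proof (induction J arbitrary: n)
  case (Cons j J)
  have "\<pi> (star (cuntz_gen j)) (e n) = \<pi> (star (cuntz_gen j) * cuntz_vec (z n)) (e (Suc n))"
    by (simp add: rep_mult[OF \<pi>] gp_orbitD(2)[OF e])
  also have "\<dots> = z n $ j *\<^sub>C e (Suc n)"
    by (simp add: star_gen_mult_vec rep_scaleC[OF \<pi>] rep_one[OF \<pi>])
  finally have "\<pi> (star (gen_word (j # J))) (e n) = z n $ j *\<^sub>C \<pi> (star (gen_word J)) (e (Suc n))"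
    by (simp add: gen_word_simps star_mult rep_mult[OF \<pi>] rep_vec_scaleC[OF \<pi>])
  then show ?case
    by (simp add: Cons scaleC_scaleC upt_conv_Cons del: upt_Suc)
qed (simp add: gen_word_simps rep_one[OF \<pi>])

lemma unitarily_equivalent_if_gp_orbit:
  fixes \<pi> :: "'n::finite cuntz \<Rightarrow> 'h::chilbert_space \<Rightarrow> 'h" and \<rho> :: "'n cuntz \<Rightarrow> 'k::chilbert_space \<Rightarrow> 'k"
  assumes \<pi>: "unital_star_rep \<pi>" and \<rho>: "unital_star_rep \<rho>"
    and d: "gp_orbit k y \<pi> d" and e: "gp_orbit k z \<rho> e"
    and coeff: "\<And>J K. length J mod k = length K mod k \<Longrightarrow>
      cnj (elementary_tensor (map y [0..<length J]) J) * elementary_tensor (map y [0..<length K]) K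
      = cnj (elementary_tensor (map z [0..<length J]) J) * elementary_tensor (map z [0..<length K]) K"
  shows "unitarily_equivalent \<pi> \<rho>"
proof (rule unitarily_equivalent_if_gram_eq[OF \<pi> \<rho> gp_orbitD(1)[OF d] gp_orbitD(1)[OF e]])
  fix J K
  show "cinner (\<pi> (star (gen_word J)) (d 0)) (\<pi> (star (gen_word K)) (d 0))
      = cinner (\<rho> (star (gen_word J)) (e 0)) (\<rho> (star (gen_word K)) (e 0))"
    using coeff[of J K]
    by (simp add: star_gen_word_gp_orbit[OF \<pi> d] star_gen_word_gp_orbit[OF \<rho> e]
        cinner_scaleC_left cinner_scaleC_right gp_orbitD(3)[OF d] gp_orbitD(3)[OF e])
      (simp add: mult.commute)
qed

lemma elementary_tensor_eq_imp_length_eq: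
  assumes "set ys \<subseteq> sphere 0 1" "elementary_tensor ys = elementary_tensor zs"
  shows "length ys = length zs"
proof -
  have "\<exists>j. y $ j \<noteq> 0" if "y \<in> set ys" for y
  proof -
    have "y \<noteq> 0" using assms(1) that by auto
    then show ?thesis by (simp add: vec_eq_iff)
  qed
  then obtain j where j: "\<And>y. y \<in> set ys \<Longrightarrow> y $ j y \<noteq> 0" by metis
  have "elementary_tensor ys (map j ys) \<noteq> 0"
    by (simp add: elementary_tensor_def j)
  then have "elementary_tensor zs (map j ys) \<noteq> 0" by (simp add: assms(2))
  then show ?thesis by (simp add: elementary_tensor_def split: if_splits)
qed

text \<open>For the periodic continuation of the factors, a word whose length is a multiple of the period is cut into
  blocks, and each block contributes a coefficient of the tensor.\<close>

lemma elementary_tensor_periodic_eq: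
  assumes len: "length ys = length zs" and ne: "zs \<noteq> []"
    and eq: "elementary_tensor ys = elementary_tensor zs"
    and dvd: "length zs dvd length J"
  defines "k \<equiv> length zs"
  shows "elementary_tensor (map (\<lambda>n. ys ! (n mod k)) [0..<length J]) J
    = elementary_tensor (map (\<lambda>n. zs ! (n mod k)) [0..<length J]) J"
  using dvd
proof (induction J rule: length_induct)
  case (1 J)
  have k: "0 < k" using ne by (simp add: k_def)
  show ?case
  proof (cases "J = []")
    case False
    then have kJ: "k \<le> length J" using 1(2) by (intro dvd_imp_le) (simp_all add: k_def)
    let ?L = "take k J" and ?M = "drop k J"
    have M: "length ?M < length J" "k dvd length ?M" and L: "length ?L = k"
      using kJ k 1(2) by (auto simp: k_def dvd_minus_self)
    have split: "elementary_tensor (map (\<lambda>n. xs ! (n mod k)) [0..<length J]) J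
      = elementary_tensor xs ?L * elementary_tensor (map (\<lambda>n. xs ! (n mod k)) [0..<length ?M]) ?M"
      if xs: "length xs = k" for xs :: "(complex ^ 'a) list"
    proof -
      have "[0..<length J] = [0..<k] @ [k..<length J]"
        using kJ by (metis le_add_diff_inverse upt_add_eq_append zero_le)
      also have "[k..<length J] = map (\<lambda>n. n + k) [0..<length ?M]"
        using kJ by (simp add: map_add_upt)
      finally have upt: "[0..<length J] = [0..<k] @ map (\<lambda>n. n + k) [0..<length ?M]" .
      have "map (\<lambda>n. xs ! (n mod k)) [0..<k] = xs"
        using xs by (intro nth_equalityI) simp_all
      then have "map (\<lambda>n. xs ! (n mod k)) [0..<length J]
        = xs @ map (\<lambda>n. xs ! (n mod k)) [0..<length ?M]"
        by (simp only: upt map_append map_map o_def mod_add_self2)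
      then show ?thesis
        using elementary_tensor_append[of xs ?L _ ?M] xs L by (simp only: append_take_drop_id)
    qed
    have lens: "length ys = k" "length zs = k" by (simp_all add: k_def len)
    have "elementary_tensor (map (\<lambda>n. ys ! (n mod k)) [0..<length ?M]) ?M
      = elementary_tensor (map (\<lambda>n. zs ! (n mod k)) [0..<length ?M]) ?M"
      using 1(1)[rule_format, OF M[unfolded k_def], folded k_def] .
    then show ?thesis by (simp only: split[OF lens(1)] split[OF lens(2)] eq)
  qed simp
qed

text \<open>Two factorisations of a tensor differ by phases, which cancel in \<open>cnj c\<^sub>J * c\<^sub>K\<close> when \<open>J\<close> and \<open>K\<close> end
  at the same place of the period. The phases are never made explicit: both words are prolonged by a
  common word until their lengths are multiples of the period.\<close>

lemma cnj_elementary_tensor_mult_eq: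
  fixes ys zs :: "(complex ^ 'n::finite) list"
  assumes unit: "set ys \<subseteq> sphere 0 1" "set zs \<subseteq> sphere 0 1" and ne: "zs \<noteq> []"
    and eq: "elementary_tensor ys = elementary_tensor zs"
  defines "k \<equiv> length zs"
  defines "c xs J \<equiv> elementary_tensor (map (\<lambda>n. xs ! (n mod k)) [0..<length J]) (J :: 'n list)"
  assumes JK: "length J mod k = length K mod k"
  shows "cnj (c ys J) * c ys K = cnj (c zs J) * c zs K"
proof -
  have len: "length ys = length zs" by (rule elementary_tensor_eq_imp_length_eq[OF unit(1) eq])
  have k: "0 < k" using ne by (simp add: k_def)
  have next_letter: "cnj (c xs J) * c xs K = (\<Sum>i\<in>UNIV. cnj (c xs (J @ [i])) * c xs (K @ [i]))"
    if xs: "length xs = k" "set xs \<subseteq> sphere 0 1" and "length J mod k = length K mod k" for xs J K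
  proof -
    let ?x = "xs ! (length J mod k)"
    have "?x \<in> set xs" using xs k by simp
    then have "norm ?x = 1" using xs by auto
    have snoc: "c xs (M @ [i]) = c xs M * xs ! (length M mod k) $ i" for M i
      by (simp add: c_def elementary_tensor_append)
    have "(\<Sum>i\<in>UNIV. cnj (c xs (J @ [i])) * c xs (K @ [i]))
      = cnj (c xs J) * c xs K * (\<Sum>i\<in>UNIV. cnj (?x $ i) * ?x $ i)"
      unfolding snoc that(3)[symmetric] sum_distrib_left by (simp add: mult_ac)
    then show ?thesis by (simp add: sum_norm_sq_unit[OF \<open>norm ?x = 1\<close>])
  qed
  \<comment> \<open>The number \<open>d\<close> counts letters that are still to be appended.\<close>
  have "cnj (c ys J) * c ys K = cnj (c zs J) * c zs K"
    if "length J mod k = length K mod k" "k dvd length J + d" for J K d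
    using that
  proof (induction d arbitrary: J K)
    case 0
    then have "k dvd length J" "k dvd length K" by (simp_all add: dvd_eq_mod_eq_0)
    then show ?case
      using elementary_tensor_periodic_eq[OF len ne eq] by (simp add: c_def k_def)
  next
    case (Suc d)
    have "cnj (c ys (J @ [i])) * c ys (K @ [i]) = cnj (c zs (J @ [i])) * c zs (K @ [i])" for i
      using Suc.prems by (intro Suc.IH) (simp_all add: mod_Suc)
    then show ?case
      using Suc.prems(1) unit len by (simp add: next_letter k_def)
  qed
  \<comment> \<open>A number of letters that always leads to a multiple of the period.\<close>
  moreover have "length J + length J * (k - 1) = k * length J"
    using k by (cases k) simp_all
  then have "k dvd length J + length J * (k - 1)" by simp
  ultimately show ?thesis using JK by blast
qed

theorem GP_unique:
  fixes \<pi> :: "'n::finite cuntz \<Rightarrow> 'h::chilbert_space \<Rightarrow> 'h" and \<rho> :: "'n cuntz \<Rightarrow> 'k::chilbert_space \<Rightarrow> 'k"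
  assumes z: "z \<in> gp_params" and \<pi>: "unital_star_rep \<pi>" "GP z \<pi>" and \<rho>: "unital_star_rep \<rho>" "GP z \<rho>"
  shows "unitarily_equivalent \<pi> \<rho>"
proof (cases z)
  case (Tensor u)
  obtain ys where ys: "set ys \<subseteq> sphere 0 1" "ys \<noteq> []" "elementary_tensor ys = u" "gp_cycle ys \<pi>"
    using \<pi>(2) by (auto simp: Tensor)
  obtain zs where zs: "set zs \<subseteq> sphere 0 1" "zs \<noteq> []" "elementary_tensor zs = u" "gp_cycle zs \<rho>"
    using \<rho>(2) by (auto simp: Tensor)
  have eq: "elementary_tensor ys = elementary_tensor zs" by (simp add: ys zs)
  have len: "length ys = length zs" by (rule elementary_tensor_eq_imp_length_eq[OF ys(1) eq])
  obtain d where "gp_orbit (length zs) (\<lambda>n. ys ! (n mod length zs)) \<pi> d"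
    using gp_cycle_imp_gp_orbit[OF \<pi>(1) ys(2,4)] unfolding len by blast
  moreover obtain e where "gp_orbit (length zs) (\<lambda>n. zs ! (n mod length zs)) \<rho> e"
    using gp_cycle_imp_gp_orbit[OF \<rho>(1) zs(2,4)] by blast
  ultimately show ?thesis
    by (rule unitarily_equivalent_if_gp_orbit[OF \<pi>(1) \<rho>(1)])
      (rule cnj_elementary_tensor_mult_eq[OF ys(1) zs(1,2) eq])
next
  case (Chain y)
  have y: "norm (y n) = 1" for n
    using z by (auto simp: Chain gp_params_def image_subset_iff)
  have "gp_chain y \<pi>" "gp_chain y \<rho>" using \<pi>(2) \<rho>(2) by (simp_all add: Chain)
  then obtain d e where "gp_orbit 0 y \<pi> d" "gp_orbit 0 y \<rho> e"
    using gp_chain_imp_gp_orbit[of \<pi> y, OF \<pi>(1) y] gp_chain_imp_gp_orbit[of \<rho> y, OF \<rho>(1) y] by blast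
  then show ?thesis
    by (rule unitarily_equivalent_if_gp_orbit[OF \<pi>(1) \<rho>(1)]) simp
qed

section \<open>The C*-algebra of bounded operators on a Hilbert space\<close>

lemma bounded_linear_if_adjoint_of:
  assumes "adjoint_of T S" "\<And>x. norm (S x) \<le> norm x * K"
  shows "bounded_linear S"
  using assms by (intro bounded_linear_intro[where K = K])
    (auto simp: adjoint_of_add adjoint_of_scaleC simp flip: scaleC_of_real)

text \<open>Every bounded complex-linear operator on a Hilbert space has an adjoint, and a function with an adjoint is
  complex-linear. So these are all bounded operators, and their adjoints are at hand.\<close>

typedef (overloaded) 'h operator = "{T :: 'h::chilbert_space \<Rightarrow> 'h. bounded_linear T \<and> (\<exists>S. bounded_linear S \<and> adjoint_of T S)}"
  morphisms apply_op Abs_operator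
  by (rule exI[of _ "\<lambda>_. 0"]) (auto simp: adjoint_of_def intro!: exI[of _ "\<lambda>_. 0"])

setup_lifting type_definition_operator

lemma bounded_linear_apply_op: "bounded_linear (apply_op T)"
  using apply_op[of T] by simp

lemma operator_eqI: "(\<And>x. apply_op S x = apply_op T x) \<Longrightarrow> S = T"
  by (simp add: fun_eq_iff flip: apply_op_inject)

lemma operatorI:
  assumes "adjoint_of T S" "\<And>x. norm (T x) \<le> norm x * K"
  shows "bounded_linear T \<and> (\<exists>S. bounded_linear S \<and> adjoint_of T S)"
proof -
  have "norm (S x) \<le> norm x * K" for x
    using adjoint_of_norm_le[OF assms(1), of K x] assms(2) by (simp add: mult.commute)
  then show ?thesis
    using bounded_linear_if_adjoint_of[OF adjoint_of_sym[OF assms(1)] assms(2)]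
      bounded_linear_if_adjoint_of[OF assms(1)] assms(1) by blast
qed

instantiation operator :: (chilbert_space) "{complex_vector, monoid_mult}"
begin

lift_definition zero_operator :: "'a operator" is "\<lambda>_. 0"
  by (auto simp: adjoint_of_def intro!: exI[of _ "\<lambda>_. 0"])
lift_definition one_operator :: "'a operator" is "\<lambda>x. x"
  by (auto simp: adjoint_of_def intro!: exI[of _ "\<lambda>x. x"])
lift_definition plus_operator :: "'a operator \<Rightarrow> 'a operator \<Rightarrow> 'a operator" is "\<lambda>S T x. S x + T x"
proof (elim conjE exE)
  fix S T S' T' :: "'a \<Rightarrow> 'a"
  assume "bounded_linear S" "bounded_linear T" "bounded_linear S'" "bounded_linear T'"
    "adjoint_of S S'" "adjoint_of T T'"
  then show "bounded_linear (\<lambda>x. S x + T x) \<and> (\<exists>R. bounded_linear R \<and> adjoint_of (\<lambda>x. S x + T x) R)"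
    by (intro conjI exI[of _ "\<lambda>x. S' x + T' x"] bounded_linear_add)
      (auto simp: adjoint_of_def cinner_add_left cinner_add_right)
qed
lift_definition scaleC_operator :: "complex \<Rightarrow> 'a operator \<Rightarrow> 'a operator" is "\<lambda>c T x. c *\<^sub>C T x"
proof (elim conjE exE)
  fix c and T T' :: "'a \<Rightarrow> 'a"
  assume "bounded_linear T" "bounded_linear T'" "adjoint_of T T'"
  then show "bounded_linear (\<lambda>x. c *\<^sub>C T x) \<and> (\<exists>R. bounded_linear R \<and> adjoint_of (\<lambda>x. c *\<^sub>C T x) R)"
    by (intro conjI exI[of _ "\<lambda>x. cnj c *\<^sub>C T' x"]
        bounded_linear_compose[OF bounded_linear_scaleC_vec])
      (auto simp: adjoint_of_def cinner_scaleC_left cinner_scaleC_right)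
qed
lift_definition times_operator :: "'a operator \<Rightarrow> 'a operator \<Rightarrow> 'a operator" is "\<lambda>S T x. S (T x)"
proof (elim conjE exE)
  fix S T S' T' :: "'a \<Rightarrow> 'a"
  assume "bounded_linear S" "bounded_linear T" "bounded_linear S'" "bounded_linear T'"
    "adjoint_of S S'" "adjoint_of T T'"
  then show "bounded_linear (\<lambda>x. S (T x)) \<and> (\<exists>R. bounded_linear R \<and> adjoint_of (\<lambda>x. S (T x)) R)"
    by (intro conjI exI[of _ "\<lambda>x. T' (S' x)"]) (auto simp: adjoint_of_def intro: bounded_linear_compose)
qed
definition uminus_operator :: "'a operator \<Rightarrow> 'a operator" where "uminus_operator T = (- 1) *\<^sub>C T"
definition minus_operator :: "'a operator \<Rightarrow> 'a operator \<Rightarrow> 'a operator" where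
  "minus_operator S T = S + (- T)"
definition scaleR_operator :: "real \<Rightarrow> 'a operator \<Rightarrow> 'a operator" where
  "scaleR_operator r T = complex_of_real r *\<^sub>C T"

lemmas apply_op_simps = zero_operator.rep_eq one_operator.rep_eq plus_operator.rep_eq
  scaleC_operator.rep_eq times_operator.rep_eq

lemma apply_op_vec:
  "apply_op T (x + y) = apply_op T x + apply_op T y"
  "apply_op T (c *\<^sub>C x) = c *\<^sub>C apply_op T x"
proof -
  obtain S where "adjoint_of (apply_op T) S" using apply_op[of T] by blast
  then have "adjoint_of S (apply_op T)" by (rule adjoint_of_sym)
  then show "apply_op T (x + y) = apply_op T x + apply_op T y"
    "apply_op T (c *\<^sub>C x) = c *\<^sub>C apply_op T x"
    by (rule adjoint_of_add, rule adjoint_of_scaleC)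
qed

instance
proof
  fix R S T :: "'a operator" and c d :: complex and r t :: real
  show "R + S + T = R + (S + T)" "S + T = T + S" "0 + T = T" "R * S * T = R * (S * T)"
    "1 * T = T" "T * 1 = T"
    by (rule operator_eqI; simp add: apply_op_simps add_ac)+
  show "- T + T = 0"
    by (rule operator_eqI) (simp add: apply_op_simps uminus_operator_def scaleC_minus_one)
  show "S - T = S + - T" by (rule minus_operator_def)
  show "c *\<^sub>C (S + T) = c *\<^sub>C S + c *\<^sub>C T" "(c + d) *\<^sub>C T = c *\<^sub>C T + d *\<^sub>C T"
    "c *\<^sub>C d *\<^sub>C T = (c * d) *\<^sub>C T"
    by (rule operator_eqI; simp only: apply_op_simps scaleC_add_left scaleC_add_right scaleC_scaleC)+
  show "complex_of_real r *\<^sub>C T = r *\<^sub>R T" by (simp add: scaleR_operator_def)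
  show "r *\<^sub>R (S + T) = r *\<^sub>R S + r *\<^sub>R T" "(r + t) *\<^sub>R T = r *\<^sub>R T + t *\<^sub>R T"
    "r *\<^sub>R t *\<^sub>R T = (r * t) *\<^sub>R T" "1 *\<^sub>R T = T"
    by (rule operator_eqI; simp only: scaleR_operator_def apply_op_simps scaleC_add_left scaleC_add_right
      scaleC_scaleC of_real_add of_real_mult of_real_1 scaleC_one)+
qed

end

lemma apply_op_uminus: "apply_op (- T) x = - apply_op T x"
  unfolding uminus_operator_def scaleC_operator.rep_eq by (rule scaleC_minus_one)

lemma apply_op_minus: "apply_op (S - T) x = apply_op S x - apply_op T x"
  unfolding minus_operator_def plus_operator.rep_eq apply_op_uminus by simp

lemma apply_op_scaleR: "apply_op (r *\<^sub>R T) x = r *\<^sub>R apply_op T x"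
  unfolding scaleR_operator_def scaleC_operator.rep_eq by (rule scaleC_of_real)

lemma apply_op_sum: "apply_op (\<Sum>i\<in>I. f i) x = (\<Sum>i\<in>I. apply_op (f i) x)"
  by (induction I rule: infinite_finite_induct) (simp_all add: apply_op_simps)

instantiation operator :: (chilbert_space) real_normed_algebra
begin

definition norm_operator :: "'a operator \<Rightarrow> real" where "norm_operator T = onorm (apply_op T)"
definition dist_operator :: "'a operator \<Rightarrow> 'a operator \<Rightarrow> real" where "dist_operator S T = norm (S - T)"
definition sgn_operator :: "'a operator \<Rightarrow> 'a operator" where "sgn_operator T = T /\<^sub>R norm T"
definition uniformity_operator :: "('a operator \<times> 'a operator) filter" where
  "uniformity_operator = (INF e\<in>{0<..}. principal {(x, y). dist x y < e})"
definition open_operator :: "'a operator set \<Rightarrow> bool" where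
  "open_operator U \<longleftrightarrow> (\<forall>x\<in>U. eventually (\<lambda>(x', y). x' = x \<longrightarrow> y \<in> U) uniformity)"

lemma norm_apply_op: "norm (apply_op T x) \<le> norm T * norm (x :: 'a)"
  unfolding norm_operator_def by (rule onorm[OF bounded_linear_apply_op])

lemma norm_operator_le: "0 \<le> K \<Longrightarrow> (\<And>x. norm (apply_op T x) \<le> K * norm x) \<Longrightarrow> norm (T :: 'a operator) \<le> K"
  unfolding norm_operator_def by (rule onorm_bound)

instance
proof
  fix S T R :: "'a operator" and r :: real
  show "dist S T = norm (S - T)" by (rule dist_operator_def)
  show "sgn T = T /\<^sub>R norm T" by (rule sgn_operator_def)
  show "(uniformity :: ('a operator \<times> 'a operator) filter)
    = (INF e\<in>{0<..}. principal {(x, y). dist x y < e})" by (rule uniformity_operator_def)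
  show "open U \<longleftrightarrow> (\<forall>x\<in>U. eventually (\<lambda>(x', y). x' = x \<longrightarrow> y \<in> U) uniformity)" for U :: "'a operator set"
    by (rule open_operator_def)
  have pos: "0 \<le> norm T" for T :: "'a operator"
    unfolding norm_operator_def by (rule onorm_pos_le[OF bounded_linear_apply_op])
  show "norm T = 0 \<longleftrightarrow> T = 0"
    unfolding norm_operator_def onorm_eq_0[OF bounded_linear_apply_op]
    using operator_eqI[of T 0] by (auto simp: zero_operator.rep_eq)
  show "norm (S + T) \<le> norm S + norm T"
    unfolding norm_operator_def plus_operator.rep_eq
    by (rule onorm_triangle[OF bounded_linear_apply_op bounded_linear_apply_op])
  have "apply_op (r *\<^sub>R T) = (\<lambda>x. r *\<^sub>R apply_op T x)" by (simp add: fun_eq_iff apply_op_scaleR)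
  then show "norm (r *\<^sub>R T) = \<bar>r\<bar> * norm T"
    by (simp add: norm_operator_def onorm_scaleR[OF bounded_linear_apply_op])
  show "norm (S * T) \<le> norm S * norm T"
  proof (rule norm_operator_le)
    show "norm (apply_op (S * T) x) \<le> norm S * norm T * norm x" for x
      unfolding times_operator.rep_eq mult.assoc
      by (rule order_trans[OF norm_apply_op mult_left_mono[OF norm_apply_op pos]])
  qed (simp add: pos)
  show "(S + T) * R = S * R + T * R" "R * (S + T) = R * S + R * T"
    "(r *\<^sub>R S) * T = r *\<^sub>R (S * T)" "S * (r *\<^sub>R T) = r *\<^sub>R (S * T)"
    by (rule operator_eqI; simp add: apply_op_simps apply_op_vec apply_op_scaleR
        linear_scale[OF bounded_linear.linear[OF bounded_linear_apply_op]])+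
qed

end

lift_definition op_adj :: "'h::chilbert_space operator \<Rightarrow> 'h operator" is "\<lambda>T. (THE S. adjoint_of T S)"
proof (elim conjE exE)
  fix T S :: "'h \<Rightarrow> 'h" assume *: "bounded_linear T" "bounded_linear S" "adjoint_of T S"
  then have "(THE S. adjoint_of T S) = S" using adjoint_of_unique by blast
  then show "bounded_linear (THE S. adjoint_of T S) \<and>
    (\<exists>R. bounded_linear R \<and> adjoint_of (THE S. adjoint_of T S) R)"
    using * adjoint_of_sym[OF *(3)] by (intro conjI exI[of _ T]) simp_all
qed

lemma apply_op_adj: "adjoint_of (apply_op T) (apply_op (op_adj T))"
proof -
  obtain S where S: "adjoint_of (apply_op T) S" using apply_op[of T] by blast
  then have "(THE S. adjoint_of (apply_op T) S) = S" using adjoint_of_unique by blast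
  with S show ?thesis by (simp add: op_adj.rep_eq)
qed

lemma op_adj_eqI: "adjoint_of (apply_op T) (apply_op S) \<Longrightarrow> op_adj T = S"
  unfolding apply_op_inject[symmetric] by (rule adjoint_of_unique[OF apply_op_adj])

lemma norm_op_adj: "norm (op_adj T) = norm T"
proof -
  have le: "norm (op_adj T) \<le> norm T" for T :: "'a operator"
    by (rule norm_operator_le[OF norm_ge_zero])
      (rule adjoint_of_norm_le[OF apply_op_adj norm_apply_op])
  have "op_adj (op_adj T) = T" by (rule op_adj_eqI) (rule adjoint_of_sym[OF apply_op_adj])
  with le[of T] le[of "op_adj T"] show ?thesis by simp
qed

lemma op_adj_diff: "op_adj (S - T) = op_adj S - op_adj T"
  by (rule op_adj_eqI) (simp add: adjoint_of_def apply_op_minus cinner_diff_left cinner_diff_right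
      adjoint_ofD[OF apply_op_adj])

text \<open>Completeness is inherited from the Banach space of bounded linear functions. That the limit of operators
  with adjoints has an adjoint follows from a second application to the sequence of adjoints.\<close>

lemma operator_Cauchy_pointwise:
  fixes X :: "nat \<Rightarrow> 'h::chilbert_space operator"
  assumes "Cauchy X"
  shows "\<exists>L. bounded_linear L \<and> (\<forall>x. (\<lambda>n. apply_op (X n) x) \<longlonglongrightarrow> L x) \<and>
    (\<forall>e>0. \<exists>M. \<forall>n\<ge>M. \<forall>x. norm (apply_op (X n) x - L x) \<le> e * norm x)"
proof -
  let ?B = "\<lambda>n. Blinfun (apply_op (X n))"
  have B: "blinfun_apply (?B n) = apply_op (X n)" for n
    by (rule bounded_linear_Blinfun_apply[OF bounded_linear_apply_op])
  have "blinfun_apply (?B m - ?B n) = apply_op (X m - X n)" for m n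
    by (rule ext) (simp add: blinfun.diff_left B apply_op_minus)
  then have "norm (?B m - ?B n) = norm (X m - X n)" for m n
    by (simp add: norm_blinfun.rep_eq norm_operator_def)
  then have "Cauchy ?B" using assms by (simp add: Cauchy_iff)
  then obtain L where L: "?B \<longlonglongrightarrow> L" using Cauchy_convergent convergent_def by blast
  show ?thesis
  proof (intro exI[of _ "blinfun_apply L"] conjI allI impI)
    show "(\<lambda>n. apply_op (X n) x) \<longlonglongrightarrow> blinfun_apply L x" for x
      using blinfun.tendsto[OF L tendsto_const[of x]] by (simp add: B)
    fix e :: real assume "0 < e"
    then obtain M where M: "\<And>n. n \<ge> M \<Longrightarrow> norm (?B n - L) < e" using LIMSEQ_D[OF L] by blast
    have "norm (apply_op (X n) x - blinfun_apply L x) \<le> e * norm x" if "n \<ge> M" for n x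
    proof -
      have "norm (apply_op (X n) x - blinfun_apply L x) \<le> norm (?B n - L) * norm x"
        using norm_blinfun[of "?B n - L" x] by (simp add: blinfun.diff_left B)
      also have "\<dots> \<le> e * norm x" using M[OF that] by (intro mult_right_mono) auto
      finally show ?thesis .
    qed
    then show "\<exists>M. \<forall>n\<ge>M. \<forall>x. norm (apply_op (X n) x - blinfun_apply L x) \<le> e * norm x" by blast
  qed (rule blinfun.bounded_linear_right)
qed

instance operator :: (chilbert_space) banach
proof
  fix X :: "nat \<Rightarrow> 'a operator" assume X: "Cauchy X"
  then have X': "Cauchy (\<lambda>n. op_adj (X n))"
    by (simp add: Cauchy_iff norm_op_adj flip: op_adj_diff)
  obtain L where L: "bounded_linear L" "\<forall>x. (\<lambda>n. apply_op (X n) x) \<longlonglongrightarrow> L x"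
    "\<forall>e>0. \<exists>M. \<forall>n\<ge>M. \<forall>x. norm (apply_op (X n) x - L x) \<le> e * norm x"
    using operator_Cauchy_pointwise[OF X] by blast
  obtain L' where L': "bounded_linear L'" "\<forall>x. (\<lambda>n. apply_op (op_adj (X n)) x) \<longlonglongrightarrow> L' x"
    using operator_Cauchy_pointwise[OF X'] by blast
  have "adjoint_of L L'"
    unfolding adjoint_of_def
  proof (intro allI, rule LIMSEQ_unique)
    fix x y
    show "(\<lambda>n. cinner (apply_op (op_adj (X n)) x) y) \<longlonglongrightarrow> cinner (L' x) y"
      by (intro tendsto_cinner tendsto_const L'(2)[rule_format])
    show "(\<lambda>n. cinner (apply_op (op_adj (X n)) x) y) \<longlonglongrightarrow> cinner x (L y)"
      unfolding adjoint_ofD[OF apply_op_adj] by (intro tendsto_cinner tendsto_const L(2)[rule_format])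
  qed
  with L(1) L'(1) have op: "apply_op (Abs_operator L) = L" by (auto intro: Abs_operator_inverse)
  have "X \<longlonglongrightarrow> Abs_operator L"
  proof (rule LIMSEQ_I)
    fix r :: real assume r: "0 < r"
    then obtain M where M: "\<forall>n\<ge>M. \<forall>x. norm (apply_op (X n) x - L x) \<le> r / 2 * norm x"
      using L(3)[rule_format, of "r / 2"] by auto
    have "norm (X n - Abs_operator L) < r" if "n \<ge> M" for n
    proof -
      have "norm (X n - Abs_operator L) \<le> r / 2"
        using r M that by (intro norm_operator_le) (simp_all add: apply_op_minus op)
      with r show ?thesis by linarith
    qed
    then show "\<exists>M. \<forall>n\<ge>M. norm (X n - Abs_operator L) < r" by blast
  qed
  then show "convergent X" by (rule convergentI)
qed

instantiation operator :: (chilbert_space) unital_cstar_algebra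
begin

definition star_operator :: "'a operator \<Rightarrow> 'a operator" where "star_operator = op_adj"

instance
proof
  fix S T :: "'a operator" and c :: complex
  note A = adjoint_ofD[OF apply_op_adj]
  show "(c *\<^sub>C S) * T = c *\<^sub>C (S * T)" "S * (c *\<^sub>C T) = c *\<^sub>C (S * T)"
    by (rule operator_eqI; simp add: apply_op_simps apply_op_vec)+
  have "norm (c *\<^sub>C T) \<le> cmod c * norm T" for c and T :: "'a operator"
  proof (rule norm_operator_le)
    show "norm (apply_op (c *\<^sub>C T) x) \<le> cmod c * norm T * norm x" for x
      using mult_left_mono[OF norm_apply_op[of T x], of "cmod c"]
      by (simp add: apply_op_simps norm_scaleC_vec mult.assoc)
  qed simp
  note le = this
  show "norm (c *\<^sub>C T) = cmod c * norm T"
  proof (cases "c = 0")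
    case False
    have "norm T \<le> cmod (inverse c) * norm (c *\<^sub>C T)"
      using le[of "inverse c" "c *\<^sub>C T"] False by (simp add: scaleC_scaleC)
    then have "cmod c * norm T \<le> norm (c *\<^sub>C T)"
      using False by (simp add: norm_inverse norm_divide field_simps)
    with le[of c T] show ?thesis by simp
  qed simp
  show "star (star T) = T"
    unfolding star_operator_def by (rule op_adj_eqI) (rule adjoint_of_sym[OF apply_op_adj])
  show "star (S + T) = star S + star T" "star (c *\<^sub>C T) = cnj c *\<^sub>C star T"
    "star (S * T) = star T * star S"
    unfolding star_operator_def
    by (rule op_adj_eqI; simp add: adjoint_of_def apply_op_simps A cinner_add_left cinner_add_right
        cinner_scaleC_left cinner_scaleC_right)+
  show "norm (star T * T) = (norm T)\<^sup>2"
  proof (rule antisym)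
    show "norm (star T * T) \<le> (norm T)\<^sup>2"
      using norm_mult_ineq[of "star T" T] by (simp add: star_operator_def norm_op_adj power2_eq_square)
    have "norm T \<le> sqrt (norm (star T * T))"
    proof (rule norm_operator_le)
      fix x
      have "(norm (apply_op T x))\<^sup>2 = cmod (cinner (apply_op (star T * T) x) x)"
        by (simp add: apply_op_simps star_operator_def A cinner_self norm_power)
      also have "\<dots> \<le> norm (star T * T) * norm x * norm x"
        by (rule order_trans[OF norm_cinner_le mult_right_mono[OF norm_apply_op]]) simp
      finally have "(norm (apply_op T x))\<^sup>2 \<le> (sqrt (norm (star T * T)) * norm x)\<^sup>2"
        by (simp add: power_mult_distrib power2_eq_square[of "norm x"] mult.assoc)
      then show "norm (apply_op T x) \<le> sqrt (norm (star T * T)) * norm x"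
        by (rule power2_le_imp_le) simp
    qed simp
    then have "(norm T)\<^sup>2 \<le> (sqrt (norm (star T * T)))\<^sup>2" by (rule power_mono) simp
    then show "(norm T)\<^sup>2 \<le> norm (star T * T)" by simp
  qed
qed

end

lemma cinner_star_operator: "cinner (apply_op (star T) x) y = cinner x (apply_op T y)"
  unfolding star_operator_def by (rule adjoint_ofD[OF apply_op_adj])

lemma unital_star_rep_cuntz_hom:
  fixes t :: "'n::finite \<Rightarrow> 'h::chilbert_space operator"
  assumes "cuntz_family t"
  shows "unital_star_rep (\<lambda>a. apply_op (cuntz_hom t a))"
  using unital_star_hom_cuntz_hom[OF assms] unfolding unital_star_hom_def unital_star_rep_def
  by (simp add: bounded_linear_apply_op apply_op_vec apply_op_simps cinner_star_operator)

section \<open>Operators on square-summable families\<close>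

lemma ell2_eqI: "(\<And>i. ell2_coord v i = ell2_coord w i) \<Longrightarrow> v = w"
  by (simp add: fun_eq_iff flip: ell2_coord_inject)

lemma ell2_coord_sum: "ell2_coord (\<Sum>j\<in>I. v j) i = (\<Sum>j\<in>I. ell2_coord (v j) i)"
  by (induction I rule: infinite_finite_induct) (simp_all add: zero_ell2.rep_eq plus_ell2.rep_eq)

lift_definition ket :: "'i \<Rightarrow> 'i ell2" is "\<lambda>i j. if j = i then 1 else 0"
proof -
  fix i :: 'i
  have "(\<lambda>j. (cmod (if j = i then 1 else 0))\<^sup>2) summable_on {i}" by simp
  then show "(\<lambda>j. (cmod (if j = i then 1 else 0))\<^sup>2) summable_on UNIV"
    by (rule summable_on_cong_neutral[THEN iffD1, rotated -1]) auto
qed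

lemma cinner_ket_left: "cinner (ket i) v = ell2_coord v i"
proof -
  have "cinner (ket i) v = (\<Sum>\<^sub>\<infinity>j\<in>{i}. ell2_coord v j)"
    unfolding cinner_ell2.rep_eq by (rule infsum_cong_neutral) (auto simp: ket.rep_eq)
  then show ?thesis by simp
qed

lemma cinner_ket_ket: "cinner (ket i) (ket j) = (if i = j then 1 else 0)"
  by (simp add: cinner_ket_left ket.rep_eq)

text \<open>The finite partial sums of a square-summable family approximate it.\<close>

lemma closure_eq_UNIV_if_ket:
  assumes add: "\<And>v w. v \<in> V \<Longrightarrow> w \<in> V \<Longrightarrow> v + w \<in> V"
    and scale: "\<And>c v. v \<in> V \<Longrightarrow> c *\<^sub>C v \<in> V" and ket: "\<And>i. ket i \<in> V"
  shows "closure V = (UNIV :: 'i ell2 set)"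
proof -
  have "\<exists>y\<in>V. dist y v < e" if e: "0 < e" for v :: "'i ell2" and e
  proof -
    let ?f = "\<lambda>i. (cmod (ell2_coord v i))\<^sup>2"
    have "(sum ?f \<longlongrightarrow> (norm v)\<^sup>2) (finite_subsets_at_top UNIV)"
      using has_sum_infsum[OF ell2_coord_summable[of v]] by (simp add: has_sum_def norm_ell2_sq)
    then have "\<forall>\<^sub>F F in finite_subsets_at_top UNIV. dist (sum ?f F) ((norm v)\<^sup>2) < e\<^sup>2"
      using e by (intro tendstoD) simp_all
    then obtain F where F: "finite F" "dist (sum ?f F) ((norm v)\<^sup>2) < e\<^sup>2"
      unfolding eventually_finite_subsets_at_top by blast
    define p where "p = (\<Sum>i\<in>F. ell2_coord v i *\<^sub>C ket i)"
    have coord: "ell2_coord p i = (if i \<in> F then ell2_coord v i else 0)" for i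
      by (simp add: p_def ell2_coord_sum scaleC_ell2.rep_eq ket.rep_eq F(1) mult_delta_right)
    have "cinner w p = (\<Sum>i\<in>F. ell2_coord v i * cnj (ell2_coord w i))" for w
      unfolding p_def cinner_sum_right cinner_scaleC_right
      by (subst cinner_commute) (simp add: cinner_ket_left)
    from this[of p] this[of v]
    have vp: "cinner p p = complex_of_real (sum ?f F)" "cinner v p = complex_of_real (sum ?f F)"
      by (simp_all add: coord flip: complex_norm_square)
    have "(norm (v - p))\<^sup>2 = (norm v)\<^sup>2 - 2 * Re (cinner v p) + Re (cinner p p)"
      unfolding power2_norm_eq_inner Re_cinner inner_diff_left inner_diff_right
      by (simp add: inner_commute)
    also have "\<dots> = (norm v)\<^sup>2 - sum ?f F" by (simp add: vp)
    also have "\<dots> < e\<^sup>2" using F(2) by (simp add: dist_real_def)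
    finally have "norm (v - p) < e" by (rule power2_less_imp_less) (use e in simp)
    moreover have zero: "0 \<in> V" using scale[OF ket, of 0] by simp
    have "(\<Sum>i\<in>G. ell2_coord v i *\<^sub>C ket i) \<in> V" if "finite G" for G
      using that by (induction G rule: finite_induct) (auto intro: add scale ket zero)
    then have "p \<in> V" unfolding p_def using F(1) .
    ultimately show ?thesis by (auto simp: dist_norm norm_minus_commute)
  qed
  then show ?thesis by (auto simp: closure_approachable)
qed

lemma infsum_reindex_range:
  fixes h :: "'y \<Rightarrow> 'a::{comm_monoid_add, t2_space}"
  assumes "inj g" "\<And>y. y \<notin> range g \<Longrightarrow> h y = 0"
  shows "infsum h UNIV = infsum (\<lambda>x. h (g x)) UNIV"
proof -
  have "infsum h UNIV = infsum h (range g)"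
    by (rule infsum_cong_neutral) (use assms(2) in auto)
  then show ?thesis by (simp add: infsum_reindex[OF assms(1)] o_def)
qed

lemma summable_on_reindex_range:
  fixes h :: "'y \<Rightarrow> 'a::{comm_monoid_add, t2_space}"
  assumes "inj g" "\<And>y. y \<notin> range g \<Longrightarrow> h y = 0"
  shows "h summable_on UNIV \<longleftrightarrow> (\<lambda>x. h (g x)) summable_on UNIV"
proof -
  have "h summable_on UNIV \<longleftrightarrow> h summable_on (range g)"
    by (rule summable_on_cong_neutral) (use assms(2) in auto)
  then show ?thesis by (simp add: summable_on_reindex[OF assms(1)] o_def)
qed

text \<open>The isometry \<open>ket x \<mapsto> ket (g x)\<close>, for injective \<open>g\<close>.\<close>

definition shift_op :: "('i \<Rightarrow> 'i) \<Rightarrow> 'i ell2 operator" where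
  "shift_op g = Abs_operator (\<lambda>v. Abs_ell2 (\<lambda>y. if y \<in> range g then ell2_coord v (inv g y) else 0))"

lemma shift_op:
  fixes g :: "'i \<Rightarrow> 'i"
  assumes g: "inj g"
  shows coord_shift_op:
      "ell2_coord (apply_op (shift_op g) v) y = (if y \<in> range g then ell2_coord v (inv g y) else 0)"
    and coord_star_shift_op: "ell2_coord (apply_op (star (shift_op g)) v) x = ell2_coord v (g x)"
proof -
  let ?push = "\<lambda>v :: 'i ell2. Abs_ell2 (\<lambda>y. if y \<in> range g then ell2_coord v (inv g y) else 0)"
  let ?pull = "\<lambda>v :: 'i ell2. Abs_ell2 (\<lambda>x. ell2_coord v (g x))"
  have push: "ell2_coord (?push v) = (\<lambda>y. if y \<in> range g then ell2_coord v (inv g y) else 0)" for v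
    using ell2_coord_summable[of v] g
    by (intro Abs_ell2_inverse) (subst mem_Collect_eq, subst summable_on_reindex_range[OF g], auto)
  have "(\<lambda>x. (cmod (ell2_coord v (g x)))\<^sup>2) summable_on UNIV" for v
  proof -
    have "(\<lambda>y. (cmod (ell2_coord v y))\<^sup>2) summable_on range g"
      by (rule summable_on_subset_banach[OF ell2_coord_summable]) simp
    then show ?thesis by (simp add: summable_on_reindex[OF g] o_def)
  qed
  then have pull: "ell2_coord (?pull v) = (\<lambda>x. ell2_coord v (g x))" for v
    by (intro Abs_ell2_inverse) simp
  have adj: "adjoint_of ?push ?pull"
    unfolding adjoint_of_def cinner_ell2.rep_eq push pull
    by (intro allI, subst (2) infsum_reindex_range[OF g]) (simp_all add: inv_f_f[OF g])
  have "(norm (?push v))\<^sup>2 = (norm v)\<^sup>2" for v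
    unfolding norm_ell2_sq push by (subst infsum_reindex_range[OF g]) (simp_all add: inv_f_f[OF g])
  then have "norm (?push v) \<le> norm v * 1" for v by (simp add: power2_eq_iff_nonneg)
  from operatorI[OF adj this] have op: "apply_op (shift_op g) = ?push"
    unfolding shift_op_def by (intro Abs_operator_inverse) simp
  show "ell2_coord (apply_op (shift_op g) v) y = (if y \<in> range g then ell2_coord v (inv g y) else 0)"
    by (simp add: op push)
  have "apply_op (star (shift_op g)) = ?pull"
    unfolding star_operator_def
    by (rule adjoint_of_unique[OF apply_op_adj]) (simp add: op adj)
  then show "ell2_coord (apply_op (star (shift_op g)) v) x = ell2_coord v (g x)"
    by (simp add: pull)
qed

lemma shift_op_ket: "inj g \<Longrightarrow> apply_op (shift_op g) (ket x) = ket (g x)"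
  by (rule ell2_eqI) (auto simp: coord_shift_op ket.rep_eq inv_f_f)

definition diag_op :: "('i \<Rightarrow> complex) \<Rightarrow> 'i ell2 operator" where
  "diag_op c = Abs_operator (\<lambda>v. Abs_ell2 (\<lambda>x. c x * ell2_coord v x))"

lemma diag_op:
  fixes c :: "'i \<Rightarrow> complex"
  assumes c: "\<And>x. cmod (c x) \<le> 1"
  shows coord_diag_op: "ell2_coord (apply_op (diag_op c) v) x = c x * ell2_coord v x"
    and coord_star_diag_op: "ell2_coord (apply_op (star (diag_op c)) v) x = cnj (c x) * ell2_coord v x"
proof -
  let ?D = "\<lambda>c v :: 'i ell2. Abs_ell2 (\<lambda>x. c x * ell2_coord v x)"
  have le: "(cmod (a x * ell2_coord v x))\<^sup>2 \<le> (cmod (ell2_coord v x))\<^sup>2"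
    if "\<And>x. cmod (a x) \<le> 1" for a v x
    using that[of x] by (intro power_mono) (simp_all add: norm_mult mult_left_le_one_le)
  have D: "ell2_coord (?D a v) = (\<lambda>x. a x * ell2_coord v x)" if "\<And>x. cmod (a x) \<le> 1" for a v
    by (intro Abs_ell2_inverse, subst mem_Collect_eq)
      (rule summable_on_comparison_test[OF ell2_coord_summable[of v]], use le[OF that] in auto)
  note D1 = D[of c, OF c]
  have D2: "ell2_coord (?D (\<lambda>x. cnj (c x)) v) = (\<lambda>x. cnj (c x) * ell2_coord v x)" for v
    by (rule D) (simp add: c)
  have adj: "adjoint_of (?D c) (?D (\<lambda>x. cnj (c x)))"
    unfolding adjoint_of_def cinner_ell2.rep_eq D1 D2 by (simp add: mult_ac)
  have "(norm (?D c v))\<^sup>2 \<le> (norm v)\<^sup>2" for v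
    unfolding norm_ell2_sq
    by (rule infsum_mono[OF ell2_coord_summable ell2_coord_summable]) (simp only: D1 le[of c, OF c])
  then have "norm (?D c v) \<le> norm v * 1" for v by (simp add: power2_le_iff_abs_le)
  from operatorI[OF adj this] have op: "apply_op (diag_op c) = ?D c"
    unfolding diag_op_def by (intro Abs_operator_inverse) simp
  show "ell2_coord (apply_op (diag_op c) v) x = c x * ell2_coord v x"
    by (simp add: op D1)
  have "apply_op (star (diag_op c)) = ?D (\<lambda>x. cnj (c x))"
    unfolding star_operator_def
    by (rule adjoint_of_unique[OF apply_op_adj]) (simp add: op adj)
  then show "ell2_coord (apply_op (star (diag_op c)) v) x = cnj (c x) * ell2_coord v x"
    by (simp add: D2)
qed

lemma diag_op_ket: "(\<And>x. cmod (c x) \<le> 1) \<Longrightarrow> apply_op (diag_op c) (ket x) = c x *\<^sub>C ket x"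
  by (rule ell2_eqI) (simp add: coord_diag_op ket.rep_eq scaleC_ell2.rep_eq)

section \<open>Twisted permutative representations\<close>

lemma cuntz_family_shift_op:
  fixes f :: "'n::finite \<Rightarrow> 'i \<Rightarrow> 'i"
  assumes f: "bij (\<lambda>(i, x). f i x)"
  shows "cuntz_family (\<lambda>i. shift_op (f i))"
proof -
  have inj: "i = j \<and> x = y" if "f i x = f j y" for i j x y
    using injD[OF bij_is_inj[OF f], of "(i, x)" "(j, y)"] that by simp
  then have g: "inj (f i)" for i by (meson injI)
  have "star (shift_op (f i)) * shift_op (f j) = (if i = j then 1 else 0)" for i j
  proof (cases "i = j")
    case True
    then show ?thesis
      by (intro operator_eqI ell2_eqI)
        (simp add: apply_op_simps coord_star_shift_op[OF g] coord_shift_op[OF g] inv_f_f[OF g])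
  next
    case False
    then have "f i x \<notin> range (f j)" for x using inj by blast
    with False show ?thesis
      by (intro operator_eqI ell2_eqI)
        (simp add: apply_op_simps coord_star_shift_op[OF g] coord_shift_op[OF g] zero_ell2.rep_eq)
  qed
  moreover have "(\<Sum>i\<in>UNIV. shift_op (f i) * star (shift_op (f i))) = 1"
  proof (intro operator_eqI ell2_eqI)
    fix v y
    obtain j x where y: "y = f j x" using bij_is_surj[OF f] by (metis case_prod_conv surj_pair surjD)
    have "ell2_coord (apply_op (shift_op (f i) * star (shift_op (f i))) v) y
      = (if i = j then ell2_coord v y else 0)" for i
    proof (cases "i = j")
      case False
      then have "y \<notin> range (f i)" using inj y by blast
      with False show ?thesis by (simp add: apply_op_simps coord_shift_op[OF g])
    qed (simp add: apply_op_simps coord_shift_op[OF g] coord_star_shift_op[OF g] y inv_f_f[OF g])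
    then show "ell2_coord (apply_op (\<Sum>i\<in>UNIV. shift_op (f i) * star (shift_op (f i))) v) y
      = ell2_coord (apply_op 1 v) y"
      by (simp add: apply_op_sum ell2_coord_sum one_operator.rep_eq)
  qed
  ultimately show ?thesis by (simp add: cuntz_family_def)
qed

text \<open>A Cuntz family is the same as a unitary row \<open>(t\<^sub>1, \<dots>, t\<^sub>N)\<close> from \<open>H\<^sup>N\<close> to \<open>H\<close>, so it may be multiplied by a
  unitary matrix over the algebra.\<close>

lemma cuntz_family_twist:
  fixes t :: "'n::finite \<Rightarrow> 'a::unital_cstar_algebra"
  assumes t: "cuntz_family t"
    and columns: "\<And>j l. (\<Sum>i\<in>UNIV. star (M i j) * M i l) = (if j = l then 1 else 0)"
    and rows: "\<And>i k. (\<Sum>j\<in>UNIV. M i j * star (M k j)) = (if i = k then 1 else 0)"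
  shows "cuntz_family (\<lambda>j. \<Sum>i\<in>UNIV. t i * M i j)"
proof -
  have tt: "star (t i) * t j = (if i = j then 1 else 0)" and ran: "(\<Sum>i\<in>UNIV. t i * star (t i)) = 1" for i j
    using t unfolding cuntz_family_def by blast+
  have "star (\<Sum>i\<in>UNIV. t i * M i j) * (\<Sum>i\<in>UNIV. t i * M i l) = (if j = l then 1 else 0)" for j l
  proof -
    have "star (t i * M i j) * (t k * M k l) = (if k = i then star (M i j) * M i l else 0)" for i k
    proof -
      have "star (t i * M i j) * (t k * M k l) = star (M i j) * ((star (t i) * t k) * M k l)"
        by (simp only: star_mult mult.assoc)
      then show ?thesis by (simp add: tt)
    qed
    then show ?thesis
      unfolding star_sum sum_distrib_left sum_distrib_right by (simp add: columns)
  qed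
  moreover have "(\<Sum>j\<in>UNIV. (\<Sum>i\<in>UNIV. t i * M i j) * star (\<Sum>i\<in>UNIV. t i * M i j)) = 1"
  proof -
    have "(\<Sum>j\<in>UNIV. (\<Sum>i\<in>UNIV. t i * M i j) * star (\<Sum>i\<in>UNIV. t i * M i j))
      = (\<Sum>j\<in>UNIV. \<Sum>i\<in>UNIV. \<Sum>k\<in>UNIV. t i * (M i j * star (M k j)) * star (t k))"
      unfolding star_sum sum_distrib_left sum_distrib_right star_mult
      by (simp only: mult.assoc) (subst sum.swap, rule refl)
    also have "\<dots> = (\<Sum>i\<in>UNIV. \<Sum>k\<in>UNIV. \<Sum>j\<in>UNIV. t i * (M i j * star (M k j)) * star (t k))"
      by (subst sum.swap, intro sum.cong refl, subst sum.swap, rule refl)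
    also have "\<dots> = (\<Sum>i\<in>UNIV. \<Sum>k\<in>UNIV. t i * (if i = k then 1 else 0) * star (t k))"
      by (simp only: rows flip: sum_distrib_left sum_distrib_right)
    also have "\<dots> = (\<Sum>i\<in>UNIV. \<Sum>k\<in>UNIV. if i = k then t i * star (t i) else 0)"
      by (intro sum.cong) auto
    finally show ?thesis by (simp add: ran)
  qed
  ultimately show ?thesis by (simp add: cuntz_family_def)
qed

text \<open>The matrix \<open>1 - w w\<^sup>* / (1 - \<langle>b, a\<rangle>)\<close> with \<open>w = a - b\<close>, a complex reflection along \<open>w\<close>. Its
  factor is chosen such that \<open>a\<close> is mapped to \<open>b\<close>, and for unit vectors the matrix is unitary. If
  \<open>\<langle>b, a\<rangle> = 1\<close>, then \<open>a = b\<close>, and because of \<open>x / 0 = 0\<close> the formula gives the identity matrix.\<close>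

definition reflection :: "complex ^ 'n \<Rightarrow> complex ^ 'n \<Rightarrow> 'n::finite \<Rightarrow> 'n \<Rightarrow> complex" where
  "reflection a b i j = (if i = j then 1 else 0)
     - (a $ i - b $ i) * cnj (a $ j - b $ j) / (1 - (\<Sum>k\<in>UNIV. cnj (b $ k) * a $ k))"

context
  fixes a b :: "complex ^ 'n::finite"
  assumes a: "norm a = 1" and b: "norm b = 1"
begin

lemma sum_norm_sq_diff:
  defines "h \<equiv> \<Sum>k\<in>UNIV. cnj (b $ k) * a $ k"
  shows "(\<Sum>k\<in>UNIV. cnj (a $ k - b $ k) * (a $ k - b $ k)) = (1 - h) + (1 - cnj h)"
proof -
  have "cnj h = (\<Sum>k\<in>UNIV. cnj (a $ k) * b $ k)" by (simp add: h_def mult.commute)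
  then show ?thesis
    by (simp add: left_diff_distrib right_diff_distrib sum_subtractf sum_norm_sq_unit[OF a]
        sum_norm_sq_unit[OF b] h_def)
qed

lemma reflection_apply: "(\<Sum>j\<in>UNIV. reflection a b i j * a $ j) = b $ i"
proof -
  define h where "h = (\<Sum>k\<in>UNIV. cnj (b $ k) * a $ k)"
  define w where "w k = a $ k - b $ k" for k
  have wa: "(\<Sum>j\<in>UNIV. cnj (w j) * a $ j) = 1 - h"
    by (simp add: w_def left_diff_distrib sum_subtractf sum_norm_sq_unit[OF a] h_def)
  have "(\<Sum>j\<in>UNIV. reflection a b i j * a $ j)
    = (\<Sum>j\<in>UNIV. (if i = j then a $ j else 0))
      - (\<Sum>j\<in>UNIV. w i / (1 - h) * (cnj (w j) * a $ j))"
    unfolding reflection_def h_def[symmetric] w_def[symmetric] sum_subtractf[symmetric]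
    by (intro sum.cong refl) (simp add: left_diff_distrib)
  also have "\<dots> = a $ i - w i / (1 - h) * (1 - h)"
    unfolding sum_distrib_left[symmetric] wa by simp
  also have "\<dots> = b $ i"
  proof (cases "h = 1")
    case True
    then have "(\<Sum>j\<in>UNIV. cnj (a $ j - b $ j) * (a $ j - b $ j)) = 0"
      by (simp only: sum_norm_sq_diff flip: h_def) simp
    then have "complex_of_real (\<Sum>j\<in>UNIV. (cmod (a $ j - b $ j))\<^sup>2) = 0"
      by (simp only: of_real_sum complex_norm_square mult.commute[of "cnj _"])
    then have "(\<Sum>j\<in>UNIV. (cmod (a $ j - b $ j))\<^sup>2) = 0" by (simp only: of_real_eq_0_iff)
    then show ?thesis by (simp add: sum_nonneg_eq_0_iff w_def)
  qed (simp add: w_def)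
  finally show ?thesis .
qed

text \<open>The condition on \<open>c\<close> for \<open>1 - c w w\<^sup>*\<close> to be unitary.\<close>

lemma reflection_coefficient:
  defines "c \<equiv> 1 / (1 - (\<Sum>k\<in>UNIV. cnj (b $ k) * a $ k))"
  shows "c + cnj c = c * cnj c * (\<Sum>k\<in>UNIV. cnj (a $ k - b $ k) * (a $ k - b $ k))"
proof -
  define h where "h = (\<Sum>k\<in>UNIV. cnj (b $ k) * a $ k)"
  show ?thesis
  proof (cases "h = 1")
    case False
    then have "cnj h \<noteq> 1" by (metis complex_cnj_cnj complex_cnj_one)
    with False have "1 - h \<noteq> 0" "1 - cnj h \<noteq> 0" by auto
    then show ?thesis unfolding c_def sum_norm_sq_diff h_def[symmetric] by (simp add: field_simps)
  qed (simp add: c_def flip: h_def)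
qed

lemma reflection_rows: "(\<Sum>j\<in>UNIV. reflection a b i j * cnj (reflection a b k j)) = (if i = k then 1 else 0)"
  and reflection_columns: "(\<Sum>i\<in>UNIV. cnj (reflection a b i j) * reflection a b i l) = (if j = l then 1 else 0)"
proof -
  define c where "c = 1 / (1 - (\<Sum>k\<in>UNIV. cnj (b $ k) * a $ k))"
  define w where "w k = a $ k - b $ k" for k
  note cw = reflection_coefficient[folded c_def w_def]
  have R: "reflection a b i j = (if i = j then 1 else 0) - c * w i * cnj (w j)" for i j
    by (simp add: reflection_def c_def w_def)
  have delta: "(\<Sum>j\<in>UNIV. ((if i = j then 1 else 0) - p * cnj (w j)) * ((if k = j then 1 else 0) - q * w j))
    = (if i = k then 1 else 0) - q * w i - p * cnj (w k) + p * q * (\<Sum>j\<in>UNIV. cnj (w j) * w j)"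
    for i k p q
  proof -
    have "((if i = j then 1 else 0) - p * cnj (w j)) * ((if k = j then 1 else 0) - q * w j)
      = (if i = j then (if i = k then 1 else 0) else 0) - (if i = j then q * w i else 0)
        - (if k = j then p * cnj (w k) else 0) + p * q * (cnj (w j) * w j)" for j
      by (auto simp: algebra_simps)
    then show ?thesis by (simp add: sum.distrib sum_subtractf sum_distrib_left)
  qed
  have "reflection a b i j * cnj (reflection a b k j) = ((if i = j then 1 else 0) - (c * w i) * cnj (w j))
      * ((if k = j then 1 else 0) - (cnj c * cnj (w k)) * w j)" for j
    by (simp add: R)
  then have "(\<Sum>j\<in>UNIV. reflection a b i j * cnj (reflection a b k j))
    = (if i = k then 1 else 0) - (c + cnj c - c * cnj c * (\<Sum>j\<in>UNIV. cnj (w j) * w j)) * w i * cnj (w k)"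
    by (simp only: delta) (simp add: algebra_simps)
  then show "(\<Sum>j\<in>UNIV. reflection a b i j * cnj (reflection a b k j)) = (if i = k then 1 else 0)"
    by (simp add: cw)
  have "cnj (reflection a b i j) * reflection a b i l = ((if l = i then 1 else 0) - (c * cnj (w l)) * w i)
      * ((if j = i then 1 else 0) - (cnj c * w j) * cnj (w i))" for i
    by (auto simp: R algebra_simps)
  then have "(\<Sum>i\<in>UNIV. cnj (reflection a b i j) * reflection a b i l)
    = (\<Sum>i\<in>UNIV. ((if j = i then 1 else 0) - (cnj c * w j) * cnj (w i))
       * ((if l = i then 1 else 0) - (c * cnj (w l)) * w i))"
    by (simp add: mult.commute)
  also have "\<dots> = (if j = l then 1 else 0) - (c + cnj c - c * cnj c * (\<Sum>j\<in>UNIV. cnj (w j) * w j)) * w j * cnj (w l)"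
    by (simp only: delta) (simp add: algebra_simps)
  finally show "(\<Sum>i\<in>UNIV. cnj (reflection a b i j) * reflection a b i l) = (if j = l then 1 else 0)"
    by (simp add: cw)
qed

lemma cmod_reflection_le: "cmod (reflection a b i j) \<le> 1"
proof -
  have "complex_of_real (\<Sum>j\<in>UNIV. (cmod (reflection a b i j))\<^sup>2) = 1"
    using reflection_rows[of i i] by (simp only: of_real_sum complex_norm_square) simp
  then have "(\<Sum>j\<in>UNIV. (cmod (reflection a b i j))\<^sup>2) = 1" by (simp only: of_real_eq_1_iff)
  moreover have "(cmod (reflection a b i j))\<^sup>2 \<le> (\<Sum>j\<in>UNIV. (cmod (reflection a b i j))\<^sup>2)"
    by (rule member_le_sum) simp_all
  ultimately show ?thesis by (simp add: power_le_one_iff)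
qed

end

text \<open>The isometries \<open>s\<^sub>j ket x = \<Sum>\<^sub>i (U\<^sub>x)\<^sub>i\<^sub>j ket (f\<^sub>i x)\<close>, where \<open>U\<^sub>x\<close> maps \<open>\<zeta> x\<close> to the basis vector number \<open>d\<close>.
  The last claim holds because \<open>ket (f\<^sub>i x)\<close> is obtained from the vectors \<open>s\<^sub>j ket x\<close> with the inverse
  matrix. The matrix entries \<open>(U\<^sub>x)\<^sub>i\<^sub>j\<close> become diagonal operators, which form the unitary matrix for
  \<open>cuntz_family_twist\<close>.\<close>

theorem twisted_permutative_rep:
  fixes f :: "'n::finite \<Rightarrow> 'i \<Rightarrow> 'i" and \<zeta> :: "'i \<Rightarrow> complex ^ 'n"
  assumes f: "bij (\<lambda>(i, x). f i x)" and \<zeta>: "\<And>x. norm (\<zeta> x) = 1"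
  shows "\<exists>\<pi> :: 'n cuntz \<Rightarrow> 'i ell2 \<Rightarrow> 'i ell2. unital_star_rep \<pi> \<and>
    (\<forall>x. \<pi> (cuntz_vec (\<zeta> x)) (ket x) = ket (f d x)) \<and> (\<forall>i x. \<exists>a. \<pi> a (ket x) = ket (f i x))"
proof -
  define b :: "complex ^ 'n" where "b = axis d 1"
  have b: "norm b = 1" by (simp add: b_def)
  define u where "u x = reflection (\<zeta> x) b" for x
  have le: "cmod (u x i j) \<le> 1" for x i j unfolding u_def by (rule cmod_reflection_le[OF \<zeta> b])
  define M where "M i j = diag_op (\<lambda>x. u x i j)" for i j
  define t where "t j = (\<Sum>i\<in>UNIV. shift_op (f i) * M i j)" for j
  have t: "cuntz_family t"
    unfolding t_def
  proof (rule cuntz_family_twist[OF cuntz_family_shift_op[OF f]])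
    show "(\<Sum>i\<in>UNIV. star (M i j) * M i l) = (if j = l then 1 else 0)" for j l
    proof (intro operator_eqI ell2_eqI)
      fix v x
      have "ell2_coord (apply_op (\<Sum>i\<in>UNIV. star (M i j) * M i l) v) x
        = (\<Sum>i\<in>UNIV. cnj (u x i j) * u x i l) * ell2_coord v x"
        by (simp add: M_def apply_op_sum ell2_coord_sum apply_op_simps coord_diag_op[OF le]
            coord_star_diag_op[OF le] sum_distrib_right mult.assoc)
      then show "ell2_coord (apply_op (\<Sum>i\<in>UNIV. star (M i j) * M i l) v) x
        = ell2_coord (apply_op (if j = l then 1 else 0) v) x"
        by (simp add: u_def reflection_columns[OF \<zeta> b] apply_op_simps zero_ell2.rep_eq)
    qed
    show "(\<Sum>j\<in>UNIV. M i j * star (M k j)) = (if i = k then 1 else 0)" for i k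
    proof (intro operator_eqI ell2_eqI)
      fix v x
      have "ell2_coord (apply_op (\<Sum>j\<in>UNIV. M i j * star (M k j)) v) x
        = (\<Sum>j\<in>UNIV. u x i j * cnj (u x k j)) * ell2_coord v x"
        by (simp add: M_def apply_op_sum ell2_coord_sum apply_op_simps coord_diag_op[OF le]
            coord_star_diag_op[OF le] sum_distrib_right mult.assoc)
      then show "ell2_coord (apply_op (\<Sum>j\<in>UNIV. M i j * star (M k j)) v) x
        = ell2_coord (apply_op (if i = k then 1 else 0) v) x"
        by (simp add: u_def reflection_rows[OF \<zeta> b] apply_op_simps zero_ell2.rep_eq)
    qed
  qed
  define \<pi> where "\<pi> a = apply_op (cuntz_hom t a)" for a
  have \<pi>: "unital_star_rep \<pi>" unfolding \<pi>_def by (rule unital_star_rep_cuntz_hom[OF t])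
  have inj: "inj (f i)" for i
    using bij_is_inj[OF f] by (auto simp: inj_def)
  have gen: "\<pi> (cuntz_gen j) (ket x) = (\<Sum>i\<in>UNIV. u x i j *\<^sub>C ket (f i x))" for j x
    by (simp add: \<pi>_def cuntz_hom_gen[OF t] t_def apply_op_sum apply_op_simps M_def
        diag_op_ket[OF le] apply_op_vec shift_op_ket[OF inj])
  have vec: "\<pi> (cuntz_vec y) (ket x) = (\<Sum>i\<in>UNIV. (\<Sum>j\<in>UNIV. u x i j * y $ j) *\<^sub>C ket (f i x))" for y x
  proof -
    have "\<pi> (cuntz_vec y) (ket x) = (\<Sum>j\<in>UNIV. \<Sum>i\<in>UNIV. (u x i j * y $ j) *\<^sub>C ket (f i x))"
      by (simp add: cuntz_vec_def rep_sum[OF \<pi>] rep_scaleC[OF \<pi>] gen sum_scaleC_right scaleC_scaleC mult.commute)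
    then show ?thesis by (subst (asm) sum.swap) (simp add: sum_scaleC_left)
  qed
  have delta: "(\<Sum>i\<in>UNIV. (if i = k then 1 else 0) *\<^sub>C ket (f i x)) = ket (f k x)" for k x
  proof -
    have "(\<Sum>i\<in>UNIV. (if i = k then 1 else 0) *\<^sub>C ket (f i x)) = (\<Sum>i\<in>UNIV. if i = k then ket (f i x) else 0)"
      by (intro sum.cong) auto
    then show ?thesis by simp
  qed
  have "\<pi> (cuntz_vec (\<zeta> x)) (ket x) = ket (f d x)" for x
    unfolding vec u_def reflection_apply[OF \<zeta> b] using delta[of d x]
    by (simp add: b_def axis_def)
  moreover have "\<pi> (cuntz_vec (\<chi> j. cnj (u x k j))) (ket x) = ket (f k x)" for k x
    unfolding vec vec_lambda_beta u_def reflection_rows[OF \<zeta> b] by (rule delta)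
  ultimately show ?thesis using \<pi> by blast
qed

section \<open>Existence\<close>

text \<open>On pairs of a natural number \<open>q\<close> and a residue \<open>p\<close> modulo \<open>k\<close> take \<open>f\<^sub>i (q, p) = (N q + i, p - 1)\<close>, with the
  letters numbered from \<open>0\<close> to \<open>N - 1\<close> and \<open>d\<close> the letter number \<open>0\<close>. Going backwards, \<open>q\<close> is divided by
  \<open>N \<ge> 2\<close> and becomes \<open>0\<close> eventually; the backward orbit of \<open>(0, 0)\<close> under \<open>f\<^sub>d\<close> consists of the pairs
  \<open>(0, n)\<close>. The residues are the integers that are fixed by \<open>p mod k\<close>, which for \<open>k = 0\<close> are all integers. The
  pairs form a countable set, which is finally enumerated by the natural numbers. The function \<open>r\<close>
  recovers the place in the period; it assigns to \<open>\<sigma> (n + 1)\<close> the index of the parameter that leads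
  from there to \<open>\<sigma> n\<close>.\<close>

lemma ex_branching:
  fixes k :: nat
  assumes N: "2 \<le> CARD('n::finite)"
  shows "\<exists>(f :: 'n \<Rightarrow> nat \<Rightarrow> nat) d \<sigma> r. bij (\<lambda>(i, x). f i x) \<and>
    (\<forall>n. f d (\<sigma> (Suc n)) = \<sigma> n \<and> r (\<sigma> (Suc n)) = n mod k) \<and>
    (\<forall>m n. \<sigma> m = \<sigma> n \<longleftrightarrow> m mod k = n mod k) \<and>
    (\<forall>A. (\<forall>n. \<sigma> n \<in> A) \<longrightarrow> (\<forall>i. \<forall>x\<in>A. f i x \<in> A) \<longrightarrow> A = UNIV)"
proof -
  define N where "N = CARD('n)"
  have N2: "2 \<le> N" using assms by (simp add: N_def)
  obtain h :: "'n \<Rightarrow> nat" where h: "bij_betw h UNIV {0..<N}"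
    using ex_bij_betw_finite_nat[of "UNIV :: 'n set"] by (auto simp: N_def)
  have h_less: "h i < N" for i using bij_betwE[OF h] by auto
  have h_inj: "h i = h j \<Longrightarrow> i = j" for i j using bij_betw_imp_inj_on[OF h] by (auto simp: inj_on_def)
  have h_surj: "\<exists>i. h i = m" if "m < N" for m using bij_betw_imp_surj_on[OF h] that by (metis atLeastLessThan_iff rangeE zero_le)
  let ?k = "int k"
  define P where "P = {p :: int. p mod ?k = p}"
  define X where "X = (UNIV :: nat set) \<times> P"
  have modP: "p mod ?k \<in> P" for p by (simp add: P_def)
  have "infinite X"
    unfolding X_def using modP[of 0] by (metis finite_cartesian_productD1 empty_iff infinite_UNIV_nat)
  then obtain g where g: "bij_betw g (UNIV :: nat set) X"
    using bij_betw_from_nat_into[OF countableI_type] by blast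
  have gX: "g x \<in> X" for x using bij_betwE[OF g] by blast
  have g_inj: "g x = g y \<longleftrightarrow> x = y" for x y
    using bij_betw_imp_inj_on[OF g] by (auto simp: inj_on_def)
  define g' where "g' = inv g"
  have gg': "g (g' y) = y" if "y \<in> X" for y
    using bij_betw_imp_surj_on[OF g] that unfolding g'_def by (metis f_inv_into_f)
  have g'g: "g' (g x) = x" for x unfolding g'_def using bij_betw_imp_inj_on[OF g] by simp
  define F where "F i y = (N * fst y + h i, (snd y - 1) mod ?k)" for i and y :: "nat \<times> int"
  have FX: "F i y \<in> X" for i y by (simp add: F_def X_def modP)
  have F_inj: "i = j \<and> x = y" if "F i x = F j y" "x \<in> X" "y \<in> X" for i j x y
  proof -
    have 1: "N * fst x + h i = N * fst y + h j" and 2: "(snd x - 1) mod ?k = (snd y - 1) mod ?k"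
      using that(1) by (simp_all add: F_def)
    have "h i = (N * fst x + h i) mod N" "fst x = (N * fst x + h i) div N" for i and x :: "nat \<times> int"
      using h_less[of i] by simp_all
    then have "h i = h j" "fst x = fst y" using 1 by metis+
    moreover have "snd x mod ?k = snd y mod ?k"
      using mod_add_cong[OF 2 refl, of 1] by simp
    then have "snd x = snd y" using that(2,3) by (simp add: X_def P_def mem_Times_iff)
    ultimately show ?thesis using h_inj by (simp add: prod_eq_iff)
  qed
  have F_surj: "\<exists>i. h i = fst y mod N \<and> F i (fst y div N, (snd y + 1) mod ?k) = y" if "y \<in> X" for y
  proof -
    obtain i where "h i = fst y mod N" using h_surj N2 by (metis mod_less_divisor not_numeral_le_zero not_gr_zero)
    moreover have "((snd y + 1) mod ?k - 1) mod ?k = snd y"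
      using that by (simp add: X_def P_def mod_diff_left_eq mem_Times_iff)
    ultimately show ?thesis by (intro exI[of _ i]) (simp add: F_def prod_eq_iff)
  qed
  define f where "f i x = g' (F i (g x))" for i x
  have gf: "g (f i x) = F i (g x)" for i x by (simp add: f_def gg'[OF FX])
  obtain d where d: "h d = 0" using h_surj[of 0] N2 by auto
  define \<sigma> where "\<sigma> n = g' (0, int n mod ?k)" for n
  have g\<sigma>: "g (\<sigma> n) = (0, int n mod ?k)" for n
    unfolding \<sigma>_def by (rule gg') (simp add: X_def modP)
  define r where "r x = nat ((snd (g x) - 1) mod ?k)" for x
  have pred: "((int (Suc n)) mod ?k - 1) mod ?k = int n mod ?k" for n
    by (simp add: mod_diff_left_eq)
  have "bij (\<lambda>(i, x). f i x)"
  proof (rule bijI)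
    show "inj (\<lambda>(i, x). f i x)"
      using F_inj[OF _ gX gX] by (auto simp: inj_def simp flip: g_inj simp: gf)
    show "surj (\<lambda>(i, x). f i x)"
    proof -
      have "\<exists>i x. f i x = y" for y
      proof -
        obtain i where "F i (fst (g y) div N, (snd (g y) + 1) mod ?k) = g y"
          using F_surj[OF gX] by blast
        then have "f i (g' (fst (g y) div N, (snd (g y) + 1) mod ?k)) = y"
          by (simp add: f_def gg' g'g X_def modP)
        then show ?thesis by blast
      qed
      then show ?thesis by (auto simp: surj_def) metis
    qed
  qed
  moreover have "f d (\<sigma> (Suc n)) = \<sigma> n" for n
    unfolding g_inj[symmetric] gf g\<sigma> by (simp add: F_def d pred del: of_nat_Suc)
  moreover have "r (\<sigma> (Suc n)) = n mod k" for n
    unfolding r_def g\<sigma> snd_conv pred by (simp flip: of_nat_mod)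
  moreover have "\<sigma> m = \<sigma> n \<longleftrightarrow> m mod k = n mod k" for m n
    unfolding g_inj[of "\<sigma> m", symmetric] g\<sigma> by (simp flip: of_nat_mod)
  moreover have "A = UNIV" if \<sigma>A: "\<forall>n. \<sigma> n \<in> A" and fA: "\<forall>i. \<forall>x\<in>A. f i x \<in> A" for A
  proof -
    have F_mem: "g' (F i y) \<in> A" if "g' y \<in> A" "y \<in> X" for i y
      using fA[rule_format, OF that(1), of i] by (simp add: f_def gg'[OF that(2)])
    \<comment> \<open>Negative \<open>p\<close> occur for \<open>k = 0\<close>: the pairs \<open>(0, p)\<close> lie on the forward orbit of \<open>(0, 0)\<close>.\<close>
    have root: "g' (0, p mod ?k) \<in> A" for p
    proof (cases "0 \<le> p")
      case True
      then show ?thesis using \<sigma>A[rule_format, of "nat p"] by (simp add: \<sigma>_def)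
    next
      case False
      then have "p \<le> 0" by simp
      then show ?thesis
      proof (induction p rule: int_le_induct)
        case base
        then show ?case using \<sigma>A[rule_format, of 0] by (simp add: \<sigma>_def)
      next
        case (step p)
        have "F d (0, p mod ?k) = (0, (p - 1) mod ?k)" by (simp add: F_def d mod_diff_left_eq)
        with F_mem[OF step(2), of d] show ?case by (simp add: X_def modP)
      qed
    qed
    have "g' (q, p) \<in> A" if "p \<in> P" for q p
      using that
    proof (induction q arbitrary: p rule: less_induct)
      case (less q)
      show ?case
      proof (cases "q = 0")
        case True
        then show ?thesis using root[of p] less.prems by (simp add: P_def)
      next
        case False
        then have "q div N < q" using N2 by simp
        then have "g' (q div N, (p + 1) mod ?k) \<in> A" by (rule less.IH) (rule modP)
        moreover obtain i where "F i (q div N, (p + 1) mod ?k) = (q, p)"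
          using F_surj[of "(q, p)"] less.prems by (auto simp: X_def)
        ultimately show ?thesis using F_mem[of "(q div N, (p + 1) mod ?k)" i] by (simp add: X_def modP)
      qed
    qed
    then have "g' (g x) \<in> A" for x using gX[of x] by (auto simp: X_def)
    then show ?thesis by (auto simp: g'g)
  qed
  ultimately show ?thesis by blast
qed

text \<open>The orbit vectors are \<open>ket (\<sigma> n)\<close>. The first one is cyclic because the vectors \<open>ket x\<close> that it generates
  include the orbit, which is descended with the adjoints \<open>s(z n)\<^sup>*\<close>, and are closed under the maps \<open>f\<^sub>i\<close>.\<close>

theorem ex_gp_orbit:
  fixes z :: "nat \<Rightarrow> complex ^ 'n::finite"
  assumes N: "2 \<le> CARD('n)" and z: "\<And>n. norm (z n) = 1" "\<And>n. z (n mod k) = z n"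
  shows "\<exists>(\<pi> :: 'n cuntz \<Rightarrow> nat ell2 \<Rightarrow> nat ell2) e. unital_star_rep \<pi> \<and> gp_orbit k z \<pi> e"
proof -
  obtain f :: "'n \<Rightarrow> nat \<Rightarrow> nat" and d \<sigma> r where f: "bij (\<lambda>(i, x). f i x)"
    and \<sigma>: "\<forall>n. f d (\<sigma> (Suc n)) = \<sigma> n \<and> r (\<sigma> (Suc n)) = n mod k"
    and eq: "\<forall>m n. \<sigma> m = \<sigma> n \<longleftrightarrow> m mod k = n mod k"
    and all: "\<forall>A. (\<forall>n. \<sigma> n \<in> A) \<longrightarrow> (\<forall>i. \<forall>x\<in>A. f i x \<in> A) \<longrightarrow> A = UNIV"
    using ex_branching[OF N, of k] by (elim exE conjE) (rule that)
  obtain \<pi> :: "'n cuntz \<Rightarrow> nat ell2 \<Rightarrow> nat ell2" where \<pi>: "unital_star_rep \<pi>"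
    and spine: "\<forall>x. \<pi> (cuntz_vec (z (r x))) (ket x) = ket (f d x)"
    and branch: "\<forall>i x. \<exists>a. \<pi> a (ket x) = ket (f i x)"
    using twisted_permutative_rep[OF f, of "\<lambda>x. z (r x)" d, OF z(1)] by (elim exE conjE) (rule that)
  let ?e = "\<lambda>n. ket (\<sigma> n)"
  have up: "\<pi> (cuntz_vec (z n)) (?e (Suc n)) = ?e n" for n
    using spine[rule_format, of "\<sigma> (Suc n)"] by (simp add: \<sigma> z(2))
  have trans: "\<exists>c. \<pi> c u = w" if "\<exists>a. \<pi> a u = v" "\<exists>b. \<pi> b v = w" for u v w
    using that rep_mult[OF \<pi>] by metis
  define A where "A = {x. \<exists>a. \<pi> a (?e 0) = ket x}"
  have "\<sigma> n \<in> A" for n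
  proof (induction n)
    case 0
    show ?case using rep_one[OF \<pi>] by (auto simp: A_def)
  next
    case (Suc n)
    have "\<pi> (star (cuntz_vec (z n))) (?e n) = \<pi> (star (cuntz_vec (z n)) * cuntz_vec (z n)) (?e (Suc n))"
      by (simp add: rep_mult[OF \<pi>] up)
    also have "\<dots> = ?e (Suc n)" by (simp add: star_vec_mult_vec_unit z(1) rep_one[OF \<pi>])
    finally show ?case using Suc trans unfolding A_def mem_Collect_eq by blast
  qed
  moreover have "f i x \<in> A" if "x \<in> A" for i x
    using that trans branch unfolding A_def mem_Collect_eq by blast
  ultimately have "A = UNIV" using all by blast
  then have ket: "\<exists>a. \<pi> a (?e 0) = ket x" for x by (auto simp: A_def)
  have "cyclic_vector \<pi> (?e 0)"
    unfolding cyclic_vector_def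
  proof (rule closure_eq_UNIV_if_ket)
    show "ket i \<in> range (\<lambda>a. \<pi> a (?e 0))" for i using ket[of i] by (metis rangeI)
  qed (auto simp flip: rep_add[OF \<pi>] rep_scaleC[OF \<pi>])
  moreover have "cinner (?e m) (?e n) = (if m mod k = n mod k then 1 else 0)" for m n
    by (simp add: cinner_ket_ket eq)
  ultimately show ?thesis
    using \<pi> up by (intro exI[of _ \<pi>] exI[of _ ?e]) (simp add: gp_orbit_def)
qed

theorem GP_exists:
  fixes z :: "'n::finite gp_param"
  assumes N: "2 \<le> CARD('n)" and z: "z \<in> gp_params"
  shows "\<exists>\<pi> :: 'n cuntz \<Rightarrow> nat ell2 \<Rightarrow> nat ell2. unital_star_rep \<pi> \<and> GP z \<pi>"
proof (cases z)
  case (Tensor u)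
  with z obtain k zs where "1 \<le> k" "length zs = k" "set zs \<subseteq> sphere 0 1" "elementary_tensor zs = u"
    unfolding gp_params_def unit_tensors_def by blast
  then have zs: "zs \<noteq> []" "set zs \<subseteq> sphere 0 1" "elementary_tensor zs = u" by auto
  let ?k = "length zs"
  have "norm (zs ! (n mod ?k)) = 1" for n
  proof -
    have "zs ! (n mod ?k) \<in> set zs" using zs(1) by simp
    then show ?thesis using zs(2) by auto
  qed
  then obtain \<pi> :: "'n cuntz \<Rightarrow> nat ell2 \<Rightarrow> nat ell2" and e
    where \<pi>: "unital_star_rep \<pi>" and e: "gp_orbit ?k (\<lambda>n. zs ! (n mod ?k)) \<pi> e"
    using ex_gp_orbit[OF N, of "\<lambda>n. zs ! (n mod ?k)" ?k] by auto
  show ?thesis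
    using gp_orbit_imp_gp_cycle[OF \<pi> e] \<pi> zs by (auto simp: Tensor)
next
  case (Chain y)
  have y: "norm (y n) = 1" for n
    using z by (auto simp: Chain gp_params_def image_subset_iff)
  then obtain \<pi> :: "'n cuntz \<Rightarrow> nat ell2 \<Rightarrow> nat ell2" and e
    where \<pi>: "unital_star_rep \<pi>" and e: "gp_orbit 0 y \<pi> e"
    using ex_gp_orbit[OF N, of y 0] by auto
  show ?thesis
    using gp_orbit_imp_gp_chain[of \<pi> y e, OF \<pi> y e] \<pi> by (auto simp: Chain)
qed

theorem theorem1p2:
  fixes z :: "'n::finite gp_param"
  assumes "CARD('n) \<ge> 2" and "z \<in> gp_params"
  shows "(\<exists>\<pi> :: 'n cuntz \<Rightarrow> nat ell2 \<Rightarrow> nat ell2. unital_star_rep \<pi> \<and> GP z \<pi>) \<and>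
    (\<forall>(\<pi> :: 'n cuntz \<Rightarrow> 'h::chilbert_space \<Rightarrow> 'h) (\<rho> :: 'n cuntz \<Rightarrow> 'k::chilbert_space \<Rightarrow> 'k).
       unital_star_rep \<pi> \<and> unital_star_rep \<rho> \<and> GP z \<pi> \<and> GP z \<rho> \<longrightarrow> unitarily_equivalent \<pi> \<rho>)"
  using GP_exists[OF assms] GP_unique[OF assms(2)] by blast

end
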